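(* Let $r\ge 1$ be such that for a.a. $x\in\Omega$ the function $(0,\infty)\ni s\mapsto \dfrac{\Phi(x,s)}{s^{r-1}}$ is increasing (non-decreasing). Let $w_1,w_2\in W^{1,p(x)}(\Omega)$ with $w_1,w_2>0$ a.e. on $\Omega$ and $\dfrac{w_2}{w_1},\dfrac{w_1}{w_2}\in L^{\infty}(\Omega)$. Then $$\int_{\Omega} \mathbf{a}(x,\nabla w_1)\cdot\nabla\left (w_1-\frac{w_2^r}{w_1^{r-1}}\right )\,dx\ \geq\ \int_{\Omega} \mathbf{a}(x,\nabla w_2)\cdot\nabla\left (\frac{w_1^r}{w_2^{r-1}}-w_2\right )\,dx .$$
   Context: Setting. $\Omega\subset\mathbb{R}^N$, $N\ge 2$, is an open, bounded, connected Lipschitz domain. $p:\overline\Omega\to(1,\infty)$ is either log-Hölder continuous with $p^-\ge \frac{2N}{N+2}$, or continuous with $p^->\frac{2N}{N+2}$, where $p^-=\min_{\overline\Omega}p$. $p'(x)=\frac{p(x)}{p(x)-1}$. $L^{p(x)}(\Omega)$ and $W^{1,p(x)}(\Omega)$ are the usual variable exponent Lebesgue and Sobolev spaces. $\Psi:\overline\Omega\times(0,\infty)\to(0,\infty)$ satisfies: $\Psi(\cdot,s)$ is measurable for each $s>0$; $\Psi(x,\cdot)$ is locally absolutely continuous on $(0,\infty)$ for a.a. $x\in\Omega$; $\lim_{s\to0^+}\Psi(x,s)s=0$ for each $x\in\Omega$; for a.a. $x\in\Omega$ the map $(0,\infty)\ni s\mapsto\Psi(x,s)s$ is strictly increasing.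 Define $\mathbf a:\overline\Omega\times\mathbb R^N\to\mathbb R^N$ by $\mathbf a(x,\xi)=\Psi(x,|\xi|)\xi$ for $\xi\ne\mathbf 0$, $\mathbf a(x,\mathbf 0)=\mathbf 0$, and $\Phi:\overline\Omega\times\mathbb R\to[0,\infty)$ by $\Phi(x,s)=\Psi(x,|s|)|s|$ for $s\neq0$, $\Phi(x,0)=0$. There are $a_0\in L^{p'(x)}(\Omega)$, $a_0\ge0$, and a constant $b\ge0$ with $\Phi(x,s)\le a_0(x)+b|s|^{p(x)-1}$ for all $s\ge0$ and a.a. $x\in\Omega$. With $A(x,\xi)=\int_0^{|\xi|}\Phi(x,s)\,ds$, there are constants $\delta_0>0$, $\tilde\delta_0\ge0$ such that $\int_\Omega A(x,\nabla v)\,dx\ge\delta_0\int_\Omega|\nabla v|^{p(x)}dx-\tilde\delta_0$ for all $v\in W^{1,p(x)}(\Omega)$. *)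

theory Defs
  imports "HOL-Analysis.Analysis"
begin

section \<open>Domains\<close>

text \<open>
  Near every boundary point \<^term>\<open>z\<close> the set is the part of a ball lying strictly above the
  graph of a Lipschitz function.  The vertical direction is a unit vector \<^term>\<open>e\<close>, and the
  graph function \<^term>\<open>g\<close> is used only on the hyperplane orthogonal to \<^term>\<open>e\<close>.
\<close>

definition lipschitz_boundary :: "'a::euclidean_space set \<Rightarrow> bool" where
  "lipschitz_boundary \<Omega> \<longleftrightarrow>
     (\<forall>z\<in>frontier \<Omega>. \<exists>\<rho>>0. \<exists>e g L. norm e = 1 \<and> L-lipschitz_on {y. y \<bullet> e = 0} g \<and>
        \<Omega> \<inter> ball z \<rho> = {y \<in> ball z \<rho>. g (y - (y \<bullet> e) *\<^sub>R e) < y \<bullet> e})"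

definition bounded_lipschitz_domain :: "'a::euclidean_space set \<Rightarrow> bool" where
  "bounded_lipschitz_domain \<Omega> \<longleftrightarrow>
     open \<Omega> \<and> \<Omega> \<noteq> {} \<and> bounded \<Omega> \<and> connected \<Omega> \<and> lipschitz_boundary \<Omega>"

section \<open>Variable exponents\<close>

definition log_Hoelder_on :: "'a::metric_space set \<Rightarrow> ('a \<Rightarrow> real) \<Rightarrow> bool" where
  "log_Hoelder_on S p \<longleftrightarrow>
     (\<exists>C. \<forall>x\<in>S. \<forall>y\<in>S. 0 < dist x y \<and> dist x y < 1/2 \<longrightarrow> \<bar>p x - p y\<bar> * ln (1 / dist x y) \<le> C)"

definition exponent_min :: "'a::topological_space set \<Rightarrow> ('a \<Rightarrow> real) \<Rightarrow> real" where
  "exponent_min \<Omega> p = (INF x\<in>closure \<Omega>. p x)"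

definition conj_exponent :: "('a \<Rightarrow> real) \<Rightarrow> 'a \<Rightarrow> real" where
  "conj_exponent p x = p x / (p x - 1)"

text \<open>
  Membership is finiteness of the Luxemburg norm.  Elements are functions rather than classes
  modulo null sets, and their values outside \<^term>\<open>\<Omega>\<close> are irrelevant.
\<close>

definition var_Lebesgue :: "'a::euclidean_space set \<Rightarrow> ('a \<Rightarrow> real) \<Rightarrow> ('a \<Rightarrow> real) set" where
  "var_Lebesgue \<Omega> p =
     {u \<in> borel_measurable (lebesgue_on \<Omega>).
        \<exists>l>0. integrable (lebesgue_on \<Omega>) (\<lambda>x. \<bar>u x / l\<bar> powr p x)}"

definition Linfty :: "'a::euclidean_space set \<Rightarrow> ('a \<Rightarrow> real) set" where
  "Linfty \<Omega> =
     {u \<in> borel_measurable (lebesgue_on \<Omega>). \<exists>C. AE x in lebesgue_on \<Omega>. \<bar>u x\<bar> \<le> C}"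

section \<open>Weak gradients and variable exponent Sobolev spaces\<close>

definition pderivative :: "'n \<Rightarrow> (real^'n \<Rightarrow> real) \<Rightarrow> real^'n \<Rightarrow> real" where
  "pderivative i \<phi> x = frechet_derivative \<phi> (at x) (axis i 1)"

fun Ck :: "nat \<Rightarrow> (real^'n \<Rightarrow> real) \<Rightarrow> bool" where
  "Ck 0 \<phi> \<longleftrightarrow> continuous_on UNIV \<phi>"
| "Ck (Suc k) \<phi> \<longleftrightarrow> \<phi> differentiable_on UNIV \<and> (\<forall>i. Ck k (pderivative i \<phi>))"

definition test_function :: "(real^'n) set \<Rightarrow> (real^'n \<Rightarrow> real) \<Rightarrow> bool" where
  "test_function \<Omega> \<phi> \<longleftrightarrow>
     (\<forall>k. Ck k \<phi>) \<and> compact (closure {x. \<phi> x \<noteq> 0}) \<and> closure {x. \<phi> x \<noteq> 0} \<subseteq> \<Omega>"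

definition locally_integrable ::
    "'a::euclidean_space set \<Rightarrow> ('a \<Rightarrow> 'b::{banach, second_countable_topology}) \<Rightarrow> bool" where
  "locally_integrable \<Omega> f \<longleftrightarrow> (\<forall>K. compact K \<and> K \<subseteq> \<Omega> \<longrightarrow> integrable (lebesgue_on K) f)"

definition has_weak_gradient ::
    "(real^'n) set \<Rightarrow> (real^'n \<Rightarrow> real) \<Rightarrow> (real^'n \<Rightarrow> real^'n) \<Rightarrow> bool" where
  "has_weak_gradient \<Omega> v G \<longleftrightarrow>
     locally_integrable \<Omega> v \<and> locally_integrable \<Omega> G \<and>
     (\<forall>\<phi>. test_function \<Omega> \<phi> \<longrightarrow>
        (\<forall>i. (\<integral>x. v x * pderivative i \<phi> x \<partial>lebesgue_on \<Omega>) = - (\<integral>x. G x $ i * \<phi> x \<partial>lebesgue_on \<Omega>)))"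

text \<open>
  Where it exists, the weak gradient on an open \<^term>\<open>\<Omega>\<close> is unique up to a null set; the choice operator picks a
  representative.
\<close>

definition weak_gradient ::
    "(real^'n) set \<Rightarrow> (real^'n \<Rightarrow> real) \<Rightarrow> real^'n \<Rightarrow> real^'n" where
  "weak_gradient \<Omega> v = (SOME G. has_weak_gradient \<Omega> v G)"

definition var_Sobolev :: "(real^'n) set \<Rightarrow> (real^'n \<Rightarrow> real) \<Rightarrow> (real^'n \<Rightarrow> real) set" where
  "var_Sobolev \<Omega> p =
     {v \<in> var_Lebesgue \<Omega> p.
        \<exists>G. has_weak_gradient \<Omega> v G \<and> (\<lambda>x. norm (G x)) \<in> var_Lebesgue \<Omega> p}"

section \<open>The operator\<close>

definition absolutely_continuous_on_interval :: "real \<Rightarrow> real \<Rightarrow> (real \<Rightarrow> real) \<Rightarrow> bool" where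
  "absolutely_continuous_on_interval c d f \<longleftrightarrow>
     (\<forall>\<epsilon>>0. \<exists>\<delta>>0. \<forall>(n::nat) l u.
        (\<forall>i<n. c \<le> l i \<and> l i \<le> u i \<and> u i \<le> d) \<and>
        disjoint_family_on (\<lambda>i. {l i<..<u i}) {..<n} \<and>
        (\<Sum>i<n. u i - l i) < \<delta> \<longrightarrow> (\<Sum>i<n. \<bar>f (u i) - f (l i)\<bar>) < \<epsilon>)"

definition locally_absolutely_continuous_pos :: "(real \<Rightarrow> real) \<Rightarrow> bool" where
  "locally_absolutely_continuous_pos f \<longleftrightarrow>
     (\<forall>c d. 0 < c \<and> c \<le> d \<longrightarrow> absolutely_continuous_on_interval c d f)"

definition Phi :: "('a \<Rightarrow> real \<Rightarrow> real) \<Rightarrow> 'a \<Rightarrow> real \<Rightarrow> real" where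
  "Phi \<Psi> x s = (if s = 0 then 0 else \<Psi> x \<bar>s\<bar> * \<bar>s\<bar>)"

definition avec :: "('a \<Rightarrow> real \<Rightarrow> real) \<Rightarrow> 'a \<Rightarrow> real^'n \<Rightarrow> real^'n" where
  "avec \<Psi> x \<xi> = (if \<xi> = 0 then 0 else \<Psi> x (norm \<xi>) *\<^sub>R \<xi>)"

definition Apot :: "('a \<Rightarrow> real \<Rightarrow> real) \<Rightarrow> 'a \<Rightarrow> real^'n \<Rightarrow> real" where
  "Apot \<Psi> x \<xi> = integral {0..norm \<xi>} (Phi \<Psi> x)"

end

theory Submission
  imports Defs
begin

text \<open>
  By the chain rule, with \<open>t = w\<^sub>2 / w\<^sub>1\<close>, the gradient of \<open>w\<^sub>1 - w\<^sub>2\<^sup>r / w\<^sub>1\<^sup>r\<^sup>-\<^sup>1\<close> is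
  \<open>(1 + (r - 1) t\<^sup>r) \<nabla>w\<^sub>1 - r t\<^sup>r\<^sup>-\<^sup>1 \<nabla>w\<^sub>2\<close>.  Writing \<open>\<phi>(s) = \<Phi>(x,s) / s\<^sup>r\<^sup>-\<^sup>1\<close>, the Cauchy--Schwarz and Young
  inequalities bound its product with \<open>a(x,\<nabla>w\<^sub>1)\<close> from below by
  \<open>\<phi>(|\<nabla>w\<^sub>1|) (|\<nabla>w\<^sub>1|\<^sup>r - |\<nabla>w\<^sub>2|\<^sup>r)\<close>.  Adding the same bound with \<open>w\<^sub>1\<close> and \<open>w\<^sub>2\<close> exchanged gives
  \<open>(\<phi>(|\<nabla>w\<^sub>1|) - \<phi>(|\<nabla>w\<^sub>2|)) (|\<nabla>w\<^sub>1|\<^sup>r - |\<nabla>w\<^sub>2|\<^sup>r) \<ge> 0\<close>, so the integrands are already ordered almost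
  everywhere.  The bounded ratios keep \<open>(w\<^sub>1, w\<^sub>2)\<close> in a convex cone on which
  \<open>(a, b) \<mapsto> a - b\<^sup>r / a\<^sup>r\<^sup>-\<^sup>1\<close> is Lipschitz; this is what makes the chain rule and the
  integrability available.  The chain rule itself follows from the convergence of difference
  quotients in \<open>L\<^sup>1\<close>.
\<close>

section \<open>Smooth bump functions\<close>

text \<open>The gradients in the statement are picked by a choice operator, so a formula for the
  gradient of the quotient is of use only once weak gradients are known to be unique almost
  everywhere. That is the fundamental lemma of the calculus of variations, which needs enough test
  functions; hence the explicit smooth bumps. The definitions integrate against completed Lebesgue
  measure, whereas the translation and Fubini arguments run on \<open>lborel\<close>. Each use of a
  weak gradient is therefore localised to a compact subset of \<open>\<Omega>\<close> and replaced
  there by integrable Borel representatives. For r > 1 the derivative of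
  \<open>a - b^r / a^(r-1)\<close> is unbounded in the open quadrant, near the axis a = 0. It
  depends on b / a alone, so a bound on this ratio bounds the derivative, and convexity of the cone
  turns that into a Lipschitz bound. Each of the two ratio bounds serves one of the two quotients in
  the statement.\<close>

primrec smooth_upto :: "nat \<Rightarrow> (real \<Rightarrow> real) \<Rightarrow> bool" where
  "smooth_upto 0 f \<longleftrightarrow> continuous_on UNIV f"
| "smooth_upto (Suc k) f \<longleftrightarrow>
     (\<exists>f'. (\<forall>t. (f has_real_derivative f' t) (at t)) \<and> smooth_upto k f')"

lemma smooth_upto_SucI:
  "(\<And>t. (f has_real_derivative f' t) (at t)) \<Longrightarrow> smooth_upto k f' \<Longrightarrow> smooth_upto (Suc k) f"
  by auto

lemma smooth_upto_add:
  "smooth_upto k f \<Longrightarrow> smooth_upto k g \<Longrightarrow> smooth_upto k (\<lambda>t. f t + g t)"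
proof (induction k arbitrary: f g)
  case 0
  then show ?case by (auto intro!: continuous_intros)
next
  case (Suc k)
  then obtain f' g' where "\<forall>t. (f has_real_derivative f' t) (at t)" "smooth_upto k f'"
    "\<forall>t. (g has_real_derivative g' t) (at t)" "smooth_upto k g'" by auto
  then show ?case
    using Suc.IH[of f' g'] by (auto intro!: exI[of _ "\<lambda>t. f' t + g' t"] derivative_intros)
qed

lemma smooth_upto_affine:
  "smooth_upto k f \<Longrightarrow> smooth_upto k (\<lambda>t. c * f (a * t + b))"
proof (induction k arbitrary: f c)
  case 0
  then show ?case
    using continuous_on_compose2[of UNIV f UNIV "\<lambda>t. a * t + b"]
    by (simp add: continuous_on_add continuous_on_mult_left)
next
  case (Suc k)
  then obtain f' where f': "\<forall>t. (f has_real_derivative f' t) (at t)" "smooth_upto k f'" by auto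
  have "((\<lambda>t. c * f (a * t + b)) has_real_derivative (c * a) * f' (a * t + b)) (at t)" for t
  proof -
    have "((\<lambda>t. a * t + b) has_real_derivative a) (at t)"
      by (auto intro!: derivative_eq_intros)
    from DERIV_cmult[OF DERIV_chain2[OF f'(1)[rule_format] this], of c] show ?thesis
      by (simp add: ac_simps)
  qed
  then show ?case
    by (rule smooth_upto_SucI) (rule Suc.IH[OF f'(2), of "c * a"])
qed

text \<open>The family is closed under differentiation up to linear combinations: differentiating
  the member with index \<open>m\<close> gives those with indices \<open>m + 2\<close> and
  \<open>m + 1\<close>. This is why powers of \<open>1 / t\<close> are carried along although only
  \<open>flat_exp 0\<close> enters the bumps.\<close>

definition flat_exp :: "nat \<Rightarrow> real \<Rightarrow> real" where
  "flat_exp m t = (if 0 < t then (1 / t) ^ m * exp (- (1 / t)) else 0)"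

text \<open>Since \<open>flat_exp m 0 = 0\<close>, this is the difference quotient at the origin. On
  the right the substitution y = 1/t turns it into y^(m+1) / exp y; on the left it is constantly
  zero.\<close>

lemma flat_exp_div_tendsto_0: "((\<lambda>t. flat_exp m t / t) \<longlongrightarrow> 0) (at 0)"
proof -
  have lim: "((\<lambda>y::real. y ^ Suc m / exp y) \<longlongrightarrow> 0) at_top"
    by (rule tendsto_power_div_exp_0)
  have "((\<lambda>t::real. (1 / t) ^ Suc m / exp (1 / t)) \<longlongrightarrow> 0) (at_right 0)"
    using filterlim_compose[OF lim filterlim_inverse_at_top_right]
    by (simp add: inverse_eq_divide)
  then have "((\<lambda>t. flat_exp m t / t) \<longlongrightarrow> 0) (at_right 0)"
    by (rule Lim_transform_eventually)
      (auto simp: eventually_at_filter flat_exp_def exp_minus divide_simps intro!: always_eventually)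
  moreover have "((\<lambda>t. flat_exp m t / t) \<longlongrightarrow> 0) (at_left 0)"
    by (rule Lim_transform_eventually[OF tendsto_const])
      (auto simp: eventually_at_filter flat_exp_def intro!: always_eventually)
  ultimately show ?thesis by (simp add: filterlim_at_split)
qed

lemma DERIV_flat_exp:
  "(flat_exp m has_real_derivative flat_exp (m + 2) t + (- real m) * flat_exp (m + 1) t) (at t)"
proof -
  consider "0 < t" | "t < 0" | "t = 0" by linarith
  then show ?thesis
  proof cases
    case 1
    have "((\<lambda>t. (1 / t) ^ m * exp (- (1 / t))) has_real_derivative
        flat_exp (m + 2) t + (- real m) * flat_exp (m + 1) t) (at t)"
    proof (cases m)
      case 0
      then show ?thesis
        using 1 by (auto intro!: derivative_eq_intros simp: flat_exp_def field_simps power2_eq_square)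
    next
      case (Suc k)
      have d: "((\<lambda>t. 1 / t) has_real_derivative - ((1 / t)\<^sup>2)) (at t)"
        using 1 by (auto intro!: derivative_eq_intros simp: power2_eq_square)
      note DERIV_mult[OF DERIV_power_Suc[OF d, of k]
          DERIV_chain2[OF DERIV_exp DERIV_minus[OF d]]]
      then show ?thesis
        using 1 by (simp add: Suc flat_exp_def algebra_simps power2_eq_square diff_divide_distrib add_divide_distrib)
    qed
    then show ?thesis
      by (rule DERIV_cong_ev[THEN iffD1, rotated -1])
        (auto simp: flat_exp_def intro!: eventually_mono[OF eventually_gt_at_top]
           eventually_mono[OF order_tendstoD(1)[OF tendsto_ident_at 1]] 1
           eventually_nhds_in_open[of "{0<..}" t, THEN eventually_mono])
  next
    case 2
    have "((\<lambda>t. 0) has_real_derivative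
        flat_exp (m + 2) t + (- real m) * flat_exp (m + 1) t) (at t)"
      using 2 by (auto simp: flat_exp_def)
    then show ?thesis
      by (rule DERIV_cong_ev[THEN iffD1, rotated -1])
        (use 2 in \<open>auto simp: flat_exp_def intro!:
           eventually_nhds_in_open[of "{..<0}" t, THEN eventually_mono]\<close>)
  next
    case 3
    show ?thesis
      using flat_exp_div_tendsto_0[of m] 3 by (simp add: DERIV_def flat_exp_def)
  qed
qed

lemma smooth_upto_flat_exp: "smooth_upto k (flat_exp m)"
proof (induction k arbitrary: m)
  case 0
  then show ?case
    using DERIV_flat_exp[THEN DERIV_isCont] by (simp add: continuous_at_imp_continuous_on)
next
  case (Suc k)
  \<comment> \<open>The affine rule with slope 1 and offset 0 serves as closure under multiplication
    by a constant.\<close>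
  have "smooth_upto k (\<lambda>t. (- real m) * flat_exp (m + 1) (1 * t + 0))"
    by (rule smooth_upto_affine[OF Suc.IH])
  then have S: "smooth_upto k (\<lambda>t. flat_exp (m + 2) t + (- real m) * flat_exp (m + 1) t)"
    using smooth_upto_add[OF Suc.IH[of "m + 2"], of "\<lambda>t. (- real m) * flat_exp (m + 1) t"]
    by (simp only: mult_1 add_0_right)
  show ?case
    by (rule smooth_upto_SucI[OF DERIV_flat_exp S])
qed

section \<open>Closure properties of the smoothness classes in several variables\<close>

lemma pderivativeI:
  "(f has_derivative D) (at x) \<Longrightarrow> pderivative i f x = D (axis i 1)"
  by (simp add: pderivative_def frechet_derivative_at[symmetric])

lemma Ck_Suc_has_derivative:
  "Ck (Suc k) f \<Longrightarrow> (f has_derivative frechet_derivative f (at x)) (at x)"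
  by (simp add: differentiable_on_def frechet_derivative_works[symmetric])

lemma Ck_const: "Ck k (\<lambda>x::real^'n. c)"
proof (induction k arbitrary: c)
  case (Suc k)
  have "pderivative i (\<lambda>x::real^'n. c) = (\<lambda>x. 0)" for i
    by (intro ext pderivativeI[where D = "\<lambda>x. 0"]) simp
  then show ?case using Suc by simp
qed simp

lemma Ck_add: "Ck k f \<Longrightarrow> Ck k g \<Longrightarrow> Ck k (\<lambda>x. f x + g x)"
proof (induction k arbitrary: f g)
  case 0
  then show ?case by (auto intro!: continuous_intros)
next
  case (Suc k)
  have "((\<lambda>x. f x + g x) has_derivative
      (\<lambda>y. frechet_derivative f (at x) y + frechet_derivative g (at x) y)) (at x)" for x
    by (intro has_derivative_add Ck_Suc_has_derivative) fact+
  note d = pderivativeI[OF this]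
  have "pderivative i (\<lambda>x. f x + g x) = (\<lambda>x. pderivative i f x + pderivative i g x)" for i
    by (intro ext) (simp add: d pderivative_def)
  then show ?case using Suc by (auto intro!: differentiable_on_add)
qed

text \<open>In the product rule one factor stays undifferentiated; lowering its order lets the
  induction hypothesis of \<open>Ck_mult\<close> apply to it.\<close>

lemma Ck_SucD: "Ck (Suc k) f \<Longrightarrow> Ck k f"
proof (induction k arbitrary: f)
  case 0
  then show ?case by (auto intro: differentiable_imp_continuous_on)
next
  case (Suc k)
  then show ?case by auto
qed

lemma Ck_mult: "Ck k f \<Longrightarrow> Ck k g \<Longrightarrow> Ck k (\<lambda>x. f x * g x)"
proof (induction k arbitrary: f g)
  case 0
  then show ?case by (auto intro!: continuous_intros)
next
  case (Suc k)
  have "((\<lambda>x. f x * g x) has_derivative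
      (\<lambda>y. f x * frechet_derivative g (at x) y + frechet_derivative f (at x) y * g x)) (at x)" for x
    by (intro has_derivative_mult Ck_Suc_has_derivative) fact+
  note d = pderivativeI[OF this]
  have *: "pderivative i (\<lambda>x. f x * g x) = (\<lambda>x. f x * pderivative i g x + pderivative i f x * g x)" for i
    by (intro ext) (simp add: d pderivative_def)
  have "Ck k (\<lambda>x. f x * pderivative i g x + pderivative i f x * g x)" for i
    using Suc.prems Ck_SucD[OF Suc.prems(1)] Ck_SucD[OF Suc.prems(2)]
    by (intro Ck_add Suc.IH) simp_all
  then show ?case using Suc.prems by (auto intro!: differentiable_on_mult simp: *)
qed

lemma Ck_prod: "finite I \<Longrightarrow> (\<And>i. i \<in> I \<Longrightarrow> Ck k (f i)) \<Longrightarrow> Ck k (\<lambda>x. \<Prod>i\<in>I. f i x)"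
  by (induction I rule: finite_induct) (auto intro: Ck_const Ck_mult)

text \<open>The derivative in direction \<open>i\<close> is again a function of that single
  coordinate and all other partial derivatives vanish, so the induction stays within functions of
  one coordinate.\<close>

lemma Ck_component: "smooth_upto k f \<Longrightarrow> Ck k (\<lambda>x::real^'n. f (x $ i))"
proof (induction k arbitrary: f)
  case 0
  then show ?case
    using continuous_on_compose2[of UNIV f UNIV "\<lambda>x::real^'n. x $ i"]
    by (simp add: linear_continuous_on bounded_linear_vec_nth)
next
  case (Suc k)
  then obtain f' where f': "\<And>t. (f has_real_derivative f' t) (at t)" "smooth_upto k f'" by auto
  have d: "((\<lambda>x::real^'n. f (x $ i)) has_derivative (\<lambda>y. f' (x $ i) * y $ i)) (at x)" for x
    using has_derivative_compose[OF
        bounded_linear_imp_has_derivative[OF bounded_linear_vec_nth]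
        f'(1)[unfolded has_field_derivative_def]] .
  have "pderivative j (\<lambda>x::real^'n. f (x $ i)) = (if i = j then (\<lambda>x. f' (x $ i)) else (\<lambda>x. 0))" for j
    by (rule ext) (simp add: pderivativeI[OF d] axis_def)
  moreover have "(\<lambda>x::real^'n. f (x $ i)) differentiable_on UNIV"
    using d by (auto simp: differentiable_on_def differentiable_def)
  ultimately show ?case
    using Suc.IH[OF f'(2)] by (auto intro: Ck_const)
qed

lemma has_derivative_shift:
  assumes "(f has_derivative D) (at (x + c))"
  shows "((\<lambda>x. f (x + c)) has_derivative D) (at x)"
proof -
  have "((\<lambda>x. x + c) has_derivative (\<lambda>h. h)) (at x)"
    by (rule has_derivative_add_const[OF has_derivative_ident])
  from has_derivative_compose[OF this assms] show ?thesis by simp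
qed

text \<open>The two functions have the same derivatives at corresponding points, so the choice
  operator inside \<open>frechet_derivative\<close> is applied to one and the same predicate. This
  covers points of non-differentiability as well.\<close>

lemma pderivative_shift:
  "pderivative i (\<lambda>x. f (x + c)) x = pderivative i f (x + c)"
proof -
  have "((\<lambda>x. f (x + c)) has_derivative D) (at x) \<longleftrightarrow> (f has_derivative D) (at (x + c))" for D
    using has_derivative_shift[of f D x c] has_derivative_shift[of "\<lambda>x. f (x + c)" D "x + c" "- c"]
    by auto
  then show ?thesis
    by (simp add: pderivative_def frechet_derivative_def)
qed

lemma Ck_shift: "Ck k f \<Longrightarrow> Ck k (\<lambda>x. f (x + c))"
proof (induction k arbitrary: f)
  case 0
  then show ?case
    using continuous_on_compose2[of UNIV f UNIV "\<lambda>x. x + c"] by (simp add: continuous_on_add)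
next
  case (Suc k)
  have "((\<lambda>x. f (x + c)) has_derivative frechet_derivative f (at (x + c))) (at x)" for x
    by (intro has_derivative_shift Ck_Suc_has_derivative[OF Suc.prems])
  moreover have pd: "pderivative i (\<lambda>x. f (x + c)) = (\<lambda>x. pderivative i f (x + c))" for i
    by (rule ext) (rule pderivative_shift)
  ultimately have "(\<lambda>x. f (x + c)) differentiable_on UNIV"
    by (auto simp: differentiable_on_def differentiable_def)
  then show ?case
    using Suc.IH Suc.prems by (simp add: pd)
qed

section \<open>Continuity, boundedness and support of test functions\<close>

lemma test_functionD:
  assumes "test_function U \<phi>"
  shows "continuous_on UNIV \<phi>" "\<phi> differentiable (at x)" "continuous_on UNIV (pderivative i \<phi>)"
proof -
  have "Ck (Suc 0) \<phi>" using assms unfolding test_function_def by blast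
  then show "\<phi> differentiable (at x)" "continuous_on UNIV (pderivative i \<phi>)"
    by (auto simp: differentiable_on_def)
  then show "continuous_on UNIV \<phi>"
    using assms unfolding test_function_def by (metis Ck.simps(1))
qed

text \<open>The complement of the closed support is open and the function is zero on it, so its
  derivative is zero there too.\<close>

lemma test_function_outside:
  assumes "x \<notin> closure {x. \<phi> x \<noteq> 0}"
  shows "\<phi> x = 0" "pderivative i \<phi> x = 0"
proof -
  show "\<phi> x = 0" using assms closure_subset[of "{x. \<phi> x \<noteq> 0}"] by auto
  have "open (- closure {x. \<phi> x \<noteq> 0})" by auto
  then have "(\<phi> has_derivative (\<lambda>y. 0)) (at x)"
    by (rule has_derivative_transform_within_open[OF has_derivative_const[of 0]])
      (use assms closure_subset[of "{x. \<phi> x \<noteq> 0}"] in auto)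
  then show "pderivative i \<phi> x = 0"
    by (rule pderivativeI)
qed

lemma bounded_of_continuous_compact_support:
  fixes f :: "'a::euclidean_space \<Rightarrow> real"
  assumes "continuous_on UNIV f" "compact K" "\<And>x. x \<notin> K \<Longrightarrow> f x = 0"
  shows "\<exists>B\<ge>0. \<forall>x. \<bar>f x\<bar> \<le> B"
proof -
  have "compact (f ` K)"
    using assms by (intro compact_continuous_image) (auto intro: continuous_on_subset)
  then obtain B where "\<forall>y\<in>f ` K. norm y \<le> B" using compact_imp_bounded bounded_iff by blast
  then have "\<bar>f x\<bar> \<le> \<bar>B\<bar>" for x using assms(3)[of x] by (cases "x \<in> K") force+
  then show ?thesis by (intro exI[of _ "\<bar>B\<bar>"]) auto
qed

lemma test_function_bounded:
  assumes "test_function U \<phi>"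
  shows "\<exists>B\<ge>0. \<forall>x. \<bar>\<phi> x\<bar> \<le> B" "\<exists>B\<ge>0. \<forall>x. \<bar>pderivative i \<phi> x\<bar> \<le> B"
proof -
  have K: "compact (closure {x. \<phi> x \<noteq> 0})" using assms by (simp add: test_function_def)
  show "\<exists>B\<ge>0. \<forall>x. \<bar>\<phi> x\<bar> \<le> B" "\<exists>B\<ge>0. \<forall>x. \<bar>pderivative i \<phi> x\<bar> \<le> B"
    by (rule bounded_of_continuous_compact_support[OF _ K];
        use test_functionD[OF assms] test_function_outside[of _ \<phi>] in blast)+
qed

lemma borel_measurable_test_function:
  assumes "test_function U \<phi>"
  shows "\<phi> \<in> borel_measurable borel" "pderivative i \<phi> \<in> borel_measurable borel"
  using test_functionD[OF assms] by (auto intro!: borel_measurable_continuous_onI)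

lemma integrable_mult_bounded:
  fixes f \<phi> :: "'a \<Rightarrow> real"
  assumes "integrable M f" "\<phi> \<in> borel_measurable M" "\<exists>B\<ge>0. \<forall>x. \<bar>\<phi> x\<bar> \<le> B"
  shows "integrable M (\<lambda>x. f x * \<phi> x)"
proof -
  obtain B where B: "B \<ge> 0" "\<And>x. \<bar>\<phi> x\<bar> \<le> B" using assms by blast
  show ?thesis
  proof (rule Bochner_Integration.integrable_bound[of M "\<lambda>x. f x * B"])
    show "AE x in M. norm (f x * \<phi> x) \<le> norm (f x * B)"
      using B by (auto simp: abs_mult intro!: mult_left_mono)
  qed (use assms in auto)
qed

lemma integrable_test_function:
  assumes "test_function U \<phi>" "integrable lborel f"
  shows "integrable lborel (\<lambda>x. f x * \<phi> x)" "integrable lborel (\<lambda>x. f x * pderivative i \<phi> x)"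
  using assms borel_measurable_test_function[OF assms(1)] test_function_bounded[OF assms(1)]
  by (auto intro!: integrable_mult_bounded)

section \<open>Smooth approximation of boxes and the fundamental lemma of the calculus of
  variations\<close>

definition bump :: "real \<Rightarrow> real^'n \<Rightarrow> real^'n \<Rightarrow> real^'n \<Rightarrow> real" where
  "bump k a b x =
     (\<Prod>i\<in>UNIV. flat_exp 0 (k * (x $ i - a $ i)) * flat_exp 0 (k * (b $ i - x $ i)))"

lemma bump_outside: "0 < k \<Longrightarrow> x \<notin> box a b \<Longrightarrow> bump k a b x = 0"
  unfolding bump_def
  by (rule prod_zero) (auto simp: mem_box_cart flat_exp_def zero_less_mult_iff)

lemma bump_bounds: "0 \<le> bump k a b x" "bump k a b x \<le> 1"
proof -
  have "0 \<le> flat_exp 0 t" "flat_exp 0 t \<le> 1" for t by (auto simp: flat_exp_def)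
  then show "0 \<le> bump k a b x" "bump k a b x \<le> 1"
    by (auto simp: bump_def intro!: prod_nonneg prod_le_1 mult_le_one)
qed

text \<open>Inside the box every factor has the form exp(-1/(k s)) with s > 0 and tends to 1 as the
  scale k grows; outside, some factor has a nonpositive argument and the product is zero. The limit
  is thus the indicator of the open box.\<close>

lemma bump_tendsto:
  "(\<lambda>k. bump (real (Suc k)) a b x) \<longlonglongrightarrow> indicator (box a b) x"
proof (cases "x \<in> box a b")
  case True
  have "(\<lambda>k. flat_exp 0 (real (Suc k) * t)) \<longlonglongrightarrow> 1" if "0 < t" for t
  proof -
    have "(\<lambda>k. exp (- ((1 / t) * inverse (real (Suc k))))) \<longlonglongrightarrow> exp (- ((1 / t) * 0))"
      by (intro tendsto_intros LIMSEQ_inverse_real_of_nat)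
    moreover have "flat_exp 0 (real (Suc k) * t) = exp (- ((1 / t) * inverse (real (Suc k))))" for k
    proof -
      have "0 < real (Suc k) * t" using that by (intro mult_pos_pos) simp_all
      then show ?thesis by (simp add: flat_exp_def divide_simps)
    qed
    ultimately show ?thesis by simp
  qed
  then have "(\<lambda>k. bump (real (Suc k)) a b x) \<longlonglongrightarrow> (\<Prod>i\<in>(UNIV::'a set). 1 * 1)"
    unfolding bump_def using True by (intro tendsto_prod tendsto_mult) (auto simp: mem_box_cart)
  then show ?thesis using True by simp
next
  case False
  then show ?thesis using bump_outside[OF _ False, of "real (Suc _)"] by simp
qed

lemma test_function_bump:
  assumes "0 < k" "cbox a b \<subseteq> U"
  shows "test_function U (bump k a b)"
proof -
  have "Ck m (bump k a b)" for m
    unfolding bump_def[abs_def]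
  proof (intro Ck_prod Ck_mult)
    fix i
    have "Ck m (\<lambda>x::real^'a. 1 * flat_exp 0 (k * x $ i + (- k * a $ i)))"
      by (rule Ck_component[OF smooth_upto_affine[OF smooth_upto_flat_exp]])
    then show "Ck m (\<lambda>x. flat_exp 0 (k * (x $ i - a $ i)))"
      by (simp add: algebra_simps)
    have "Ck m (\<lambda>x::real^'a. 1 * flat_exp 0 ((- k) * x $ i + k * b $ i))"
      by (rule Ck_component[OF smooth_upto_affine[OF smooth_upto_flat_exp]])
    then show "Ck m (\<lambda>x. flat_exp 0 (k * (b $ i - x $ i)))"
      by (simp add: algebra_simps)
  qed auto
  moreover have sub: "{x. bump k a b x \<noteq> 0} \<subseteq> cbox a b"
    using bump_outside[OF assms(1), of _ a b] box_subset_cbox[of a b] by blast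
  moreover have "compact (closure {x. bump k a b x \<noteq> 0})"
    using bounded_subset[OF bounded_cbox sub] by simp
  moreover have "closure {x. bump k a b x \<noteq> 0} \<subseteq> U"
    using closure_minimal[OF sub closed_cbox] assms(2) by (rule order_trans)
  ultimately show ?thesis by (simp add: test_function_def)
qed

text \<open>Dominated convergence along the bumps, whose values lie between 0 and 1. The closed box
  has to lie in \<open>U\<close> because it contains the closed supports of the bumps.\<close>

lemma set_integral_box_eq_0:
  fixes f :: "real^'n \<Rightarrow> real"
  assumes f: "integrable lborel f"
    and tests: "\<And>\<psi>. test_function U \<psi> \<Longrightarrow> (\<integral>x. f x * \<psi> x \<partial>lborel) = 0"
    and "cbox a b \<subseteq> U"
  shows "(\<integral>x. f x * indicator (box a b) x \<partial>lborel) = 0"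
proof -
  have "(\<lambda>k. \<integral>x. f x * bump (real (Suc k)) a b x \<partial>lborel)
      \<longlonglongrightarrow> (\<integral>x. f x * indicator (box a b) x \<partial>lborel)"
  proof (rule integral_dominated_convergence[where w = "\<lambda>x. \<bar>f x\<bar>"])
    show "AE x in lborel. (\<lambda>k. f x * bump (real (Suc k)) a b x) \<longlonglongrightarrow> f x * indicator (box a b) x"
      by (intro AE_I2 tendsto_intros bump_tendsto)
    show "AE x in lborel. norm (f x * bump (real (Suc k)) a b x) \<le> \<bar>f x\<bar>" for k
      using bump_bounds[of "real (Suc k)" a b] by (auto simp: abs_mult intro!: mult_left_le)
    have [measurable]: "bump (real (Suc k)) a b \<in> borel_measurable borel" for k
      using borel_measurable_test_function(1)[OF test_function_bump[OF _ assms(3)]] by simp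
    show "(\<lambda>x. f x * bump (real (Suc k)) a b x) \<in> borel_measurable lborel" for k
      using f by measurable
  qed (use f in auto)
  then show ?thesis
    using tests[OF test_function_bump[OF _ assms(3)]] by (simp add: LIMSEQ_const_iff)
qed

text \<open>An open set is a countable union of closed boxes, and each of them differs from its open
  box by a null set, so only countably many exceptional sets are discarded.\<close>

lemma AE_open_of_boxes:
  fixes U :: "'a::euclidean_space set"
  assumes U: "open U"
    and boxes: "\<And>a b. cbox a b \<subseteq> U \<Longrightarrow> AE x in lborel. x \<in> box a b \<longrightarrow> P x"
  shows "AE x in lborel. x \<in> U \<longrightarrow> P x"
proof -
  obtain \<D> where \<D>: "countable \<D>" "\<And>X. X \<in> \<D> \<Longrightarrow> X \<subseteq> U" "\<And>X. X \<in> \<D> \<Longrightarrow> \<exists>a b. X = cbox a b" "\<Union>\<D> = U"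
    using open_countable_Union_open_cbox[OF U] by (metis PowD subsetD)
  have "AE x in lborel. x \<in> X \<longrightarrow> P x" if X: "X \<in> \<D>" for X
  proof -
    obtain a b where ab: "X = cbox a b" using \<D>(3)[OF X] by auto
    have "cbox a b - box a b \<in> null_sets lborel"
    proof (rule null_setsI)
      show "emeasure lborel (cbox a b - box a b) = 0"
        using emeasure_Diff[of lborel "box a b" "cbox a b"] box_subset_cbox[of a b]
        by (simp add: emeasure_lborel_box_eq emeasure_lborel_cbox_eq)
    qed auto
    then have "AE x in lborel. x \<notin> cbox a b - box a b" by (rule AE_not_in)
    moreover have "AE x in lborel. x \<in> box a b \<longrightarrow> P x"
      using boxes \<D>(2)[OF X] ab by simp
    ultimately show ?thesis by eventually_elim (auto simp: ab)
  qed
  then have "AE x in lborel. \<forall>X\<in>\<D>. x \<in> X \<longrightarrow> P x"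
    by (simp only: AE_ball_countable[OF \<D>(1)]) blast
  then show ?thesis by eventually_elim (use \<D>(4) in auto)
qed

text \<open>Cutting \<open>f\<close> off to one open box leaves a function whose integral vanishes
  over every open box. Open boxes are stable under intersection and generate the Borel sets, so a
  Dynkin argument gives integral zero over every Borel set, which forces the function to vanish
  almost everywhere.\<close>

lemma AE_zero_of_test_functions:
  fixes f :: "real^'n \<Rightarrow> real"
  assumes f: "integrable lborel f" and U: "open U"
    and tests: "\<And>\<psi>. test_function U \<psi> \<Longrightarrow> (\<integral>x. f x * \<psi> x \<partial>lborel) = 0"
  shows "AE x in lborel. x \<in> U \<longrightarrow> f x = 0"
proof -
  have box_zero: "AE x in lborel. x \<in> box c d \<longrightarrow> f x = 0" if cd: "cbox c d \<subseteq> U" for c d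
  proof -
    define g where "g x = f x * indicator (box c d) x" for x
    have g: "integrable lborel g"
      unfolding g_def using f by (intro integrable_real_mult_indicator) auto
    have box0: "(\<integral>x. g x * indicator (box a b) x \<partial>lborel) = 0" for a b
    proof (cases "box a b \<inter> box c d = {}")
      case True
      then have "(\<lambda>x. g x * indicator (box a b) x) = (\<lambda>x. 0)"
        by (auto simp: g_def indicator_def fun_eq_iff)
      then show ?thesis by simp
    next
      case False
      obtain a' b' where ab': "box a b \<inter> box c d = box a' b'"
        using box_Int_box by blast
      then have *: "closure (box a' b') \<subseteq> closure (box c d)" by (intro closure_mono) auto
      have sub: "cbox a' b' \<subseteq> U"
      proof -
        \<comment> \<open>Only for a nonempty open box is the closure the corresponding closed
          box.\<close>
        have "box a' b' \<noteq> {}" "box c d \<noteq> {}" using False ab' by auto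
        then show ?thesis using * cd by (metis closure_box subset_trans)
      qed
      have "(\<integral>x. f x * indicator (box a' b') x \<partial>lborel) = 0"
        using set_integral_box_eq_0[OF f tests sub] .
      also have "(\<lambda>x. f x * indicator (box a' b') x) = (\<lambda>x. g x * indicator (box a b) x)"
        unfolding ab'[symmetric] by (auto simp: g_def indicator_def)
      finally show ?thesis .
    qed
    \<comment> \<open>The integral over the whole space is the one over \<open>box c d\<close>; this
      is what handles complements in the Dynkin argument.\<close>
    have g0: "(\<integral>x. g x \<partial>lborel) = 0"
    proof -
      have "(\<lambda>x. g x * indicator (box c d) x) = g" by (auto simp: g_def indicator_def)
      then show ?thesis using box0[of c d] by simp
    qed
    have "(\<integral>x. g x * indicator A x \<partial>lborel) = 0" if A: "A \<in> sets lborel" for A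
    proof -
      let ?G = "range (\<lambda>(a, b). box a b :: (real^'n) set)"
      have sets_eq: "sets lborel = sigma_sets UNIV ?G"
        by (simp only: sets_lborel, subst borel_eq_box) (rule sets_measure_of, simp)
      then have A': "A \<in> sigma_sets UNIV ?G"
        using A by simp
      have "Int_stable ?G"
        by (auto simp: Int_stable_def box_Int_box intro!: rev_image_eqI[OF UNIV_I])
      moreover have "?G \<subseteq> Pow UNIV" by simp
      moreover note A'
      ultimately show ?thesis
      proof (induction rule: sigma_sets_induct_disjoint)
        case (basic A)
        then show ?case using box0 by auto
      next
        case (compl A)
        then have A: "A \<in> sets lborel"
          by (simp only: sets_eq)
        have "(\<integral>x. g x * indicator (UNIV - A) x \<partial>lborel) = (\<integral>x. g x - g x * indicator A x \<partial>lborel)"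
          by (intro Bochner_Integration.integral_cong) (auto simp: indicator_def)
        then show ?case
          using compl(2) g0 Bochner_Integration.integral_diff[OF g integrable_real_mult_indicator[OF A g]]
          by simp
      next
        case (union A)
        then have A: "A i \<in> sets lborel" for i
          by (auto simp only: sets_eq)
        have "(\<integral>x\<in>(\<Union>i. A i). g x \<partial>lborel) = (\<Sum>i. (\<integral>x\<in>A i. g x \<partial>lborel))"
        proof (rule lebesgue_integral_countable_add)
          show "set_integrable lborel (\<Union>i. A i) g"
            unfolding set_integrable_def
            using A by (intro integrable_mult_indicator g sets.countable_UN) blast
        qed (use union A in \<open>auto simp: disjoint_family_on_def\<close>)
        then show ?case
          using union by (simp add: set_lebesgue_integral_def mult.commute)
      qed simp
    qed
    then have "AE x in lborel. g x = 0"
      by (intro sigma_finite_measure.density_zero[OF sigma_finite_lborel] g) (auto simp: set_lebesgue_integral_def mult.commute)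
    then show ?thesis by eventually_elim (auto simp: g_def)
  qed
  then show ?thesis by (rule AE_open_of_boxes[OF U])
qed

section \<open>Continuity of translations in \<open>L\<^sup>1\<close>\<close>

lemma lborel_shift:
  fixes f :: "'a::euclidean_space \<Rightarrow> real"
  assumes [measurable]: "f \<in> borel_measurable borel"
  shows "integrable lborel (\<lambda>x. f (x + h)) \<longleftrightarrow> integrable lborel f"
    and "(\<integral>x. f (x + h) \<partial>lborel) = (\<integral>x. f x \<partial>lborel)"
proof -
  have "(+) h \<in> lborel \<rightarrow>\<^sub>M (borel :: 'a measure)" by measurable
  from integrable_distr_eq[OF this, of f] integral_distr[OF this, of f]
  show "integrable lborel (\<lambda>x. f (x + h)) \<longleftrightarrow> integrable lborel f"
    "(\<integral>x. f (x + h) \<partial>lborel) = (\<integral>x. f x \<partial>lborel)"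
    by (simp_all add: lborel_distr_plus add.commute)
qed

definition L1_modulus :: "('a::euclidean_space \<Rightarrow> real) \<Rightarrow> 'a \<Rightarrow> real" where
  "L1_modulus f h = (\<integral>x. \<bar>f (x + h) - f x\<bar> \<partial>lborel)"

lemma integrable_shift_diff:
  fixes f :: "'a::euclidean_space \<Rightarrow> real"
  assumes "integrable lborel f"
  shows "integrable lborel (\<lambda>x. \<bar>f (x + h) - f x\<bar>)"
  using assms lborel_shift(1)[of f h] by (simp add: borel_measurable_integrable)

text \<open>Outer regularity gives an open set, inner regularity a closed one. Intersecting the
  closed set with large balls makes it compact, and the loss tends to zero because \<open>A\<close>
  has finite measure.\<close>

lemma approximate_open_compact:
  fixes A :: "'a::euclidean_space set"
  assumes A: "A \<in> sets lborel" "emeasure lborel A < \<infinity>" and "0 < \<epsilon>"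
  obtains U K where "open U" "compact K" "K \<subseteq> A" "A \<subseteq> U" "emeasure lborel (U - K) < ennreal \<epsilon>"
proof -
  have AL: "A \<in> sets lebesgue" using A(1) by auto
  obtain U where U: "open U" "A \<subseteq> U" "U - A \<in> lmeasurable"
      "emeasure lebesgue (U - A) < ennreal (\<epsilon> / 2)"
    by (rule sets_lebesgue_outer_open[OF AL half_gt_zero[OF \<open>0 < \<epsilon>\<close>]])
  obtain C where C: "closed C" "C \<subseteq> A" "A - C \<in> lmeasurable"
      "emeasure lebesgue (A - C) < ennreal (\<epsilon> / 2)"
    by (rule sets_lebesgue_inner_closed[OF AL half_gt_zero[OF \<open>0 < \<epsilon>\<close>]])
  have [measurable]: "U \<in> sets lborel" "C \<in> sets lborel" "A \<in> sets lborel" using U C A by auto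
  have leb: "emeasure lebesgue S = emeasure lborel S" if "S \<in> sets lborel" for S :: "'a set"
    using that sets_completionI_sets[OF that] by (simp only: emeasure_completion main_part)
  define K where "K n = C \<inter> cball 0 (real n)" for n
  have K[measurable]: "K n \<in> sets lborel" and cK: "compact (K n)" for n
    using C(1) by (auto simp: K_def closed_Int_compact)
  have lim: "(\<lambda>n. emeasure lborel (A - K n)) \<longlonglongrightarrow> emeasure lborel (\<Inter>n. A - K n)"
  proof (rule Lim_emeasure_decseq)
    show "decseq (\<lambda>n. A - K n)" by (auto simp: decseq_def K_def)
    show "emeasure lborel (A - K n) \<noteq> \<infinity>" for n
      using A(2) emeasure_mono[OF _ A(1), of "A - K n"] by (auto simp: top_unique)
  qed (use A(1) K in \<open>auto intro!: sets.Diff\<close>)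
  have Int_eq: "(\<Inter>n. A - K n) = A - C"
    using real_arch_simple by (fastforce simp: K_def)
  have lt: "emeasure lborel (A - C) < ennreal (\<epsilon> / 2)"
    using C(4) A(1) \<open>C \<in> sets lborel\<close> by (simp only: leb sets.Diff)
  have "eventually (\<lambda>n. emeasure lborel (A - K n) < ennreal (\<epsilon> / 2)) sequentially"
    using order_tendstoD(2)[OF lim[unfolded Int_eq] lt] .
  then obtain n where n: "emeasure lborel (A - K n) < ennreal (\<epsilon> / 2)"
    using eventually_happens'[OF sequentially_bot] by blast
  have "emeasure lborel (U - K n) \<le> emeasure lborel ((U - A) \<union> (A - K n))"
    by (rule emeasure_mono) (use A(1) U(1) K in auto)
  also have "\<dots> \<le> emeasure lborel (U - A) + emeasure lborel (A - K n)"
    by (rule emeasure_subadditive) (use A(1) U(1) K in auto)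
  also have "\<dots> < ennreal (\<epsilon> / 2) + ennreal (\<epsilon> / 2)"
    using U(4) n A(1) \<open>U \<in> sets lborel\<close> by (intro add_strict_mono) (simp_all only: leb sets.Diff)
  also have "\<dots> = ennreal \<epsilon>" using \<open>0 < \<epsilon>\<close> by (simp flip: ennreal_plus)
  finally show ?thesis
    using U(1,2) cK C(2) by (intro that[of U "K n"]) (auto simp: K_def)
qed

text \<open>If \<open>h\<close> is shorter than the distance from \<open>K\<close> to the complement
  of \<open>U\<close>, the indicator of \<open>A\<close> can change between \<open>x\<close> and
  \<open>x + h\<close> only when one of the two points lies in \<open>U - K\<close>, a set of small
  measure.\<close>

lemma L1_modulus_indicator_small:
  fixes A :: "'a::euclidean_space set" and c :: real
  assumes A: "A \<in> sets lborel" "emeasure lborel A < \<infinity>" and "0 < \<epsilon>"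
  shows "\<exists>d>0. \<forall>h. norm h < d \<longrightarrow> L1_modulus (\<lambda>x. indicator A x *\<^sub>R c) h < \<epsilon>"
proof -
  \<comment> \<open>The estimate below yields \<open>2 * \<bar>c\<bar> * \<eta>\<close>; the extra 2
    in the denominator makes the final inequality strict and covers \<open>c = 0\<close>.\<close>
  define \<eta> where "\<eta> = \<epsilon> / (2 * \<bar>c\<bar> + 2)"
  have \<eta>: "0 < \<eta>" using \<open>0 < \<epsilon>\<close> by (simp add: \<eta>_def add_nonneg_pos)
  obtain U K where UK: "open U" "compact K" "K \<subseteq> A" "A \<subseteq> U" "emeasure lborel (U - K) < ennreal \<eta>"
    using approximate_open_compact[OF A \<eta>] .
  let ?D = "U - K"
  have D[measurable]: "?D \<in> sets borel" using UK by (auto simp: compact_imp_closed)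
  have iD: "integrable lborel (indicator ?D :: 'a \<Rightarrow> real)"
    using UK(5) by (intro integrable_real_indicator) (auto simp: order.strict_trans)
  have mD: "measure lborel ?D < \<eta>"
    using UK(5) \<eta> by (metis D emeasure_eq_ennreal_measure ennreal_less_iff infinity_ennreal_def
        measure_nonneg order_less_imp_not_less top.not_eq_extremum top_neq_ennreal)
  have "closed (- U)" "K \<inter> - U = {}" using UK by auto
  then obtain d where d: "d > 0" "\<And>x y. x \<in> K \<Longrightarrow> y \<notin> U \<Longrightarrow> d \<le> dist x y"
    using separate_compact_closed[OF UK(2)] by (metis ComplI)
  have "L1_modulus (\<lambda>x. indicator A x *\<^sub>R c) h < \<epsilon>" if h: "norm h < d" for h
  proof -
    have ptw: "\<bar>indicator A (x + h) *\<^sub>R c - indicator A x *\<^sub>R c\<bar>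
        \<le> \<bar>c\<bar> * (indicator ?D (x + h) + indicator ?D x)" for x
    proof -
      have "dist x (x + h) < d" "dist (x + h) x < d" using h by (auto simp: dist_norm)
      then have "x \<in> K \<Longrightarrow> x + h \<in> U" "x + h \<in> K \<Longrightarrow> x \<in> U"
        using d(2) by (meson not_less)+
      then show ?thesis
        using UK(3,4) by (auto simp: indicator_def)
    qed
    have iD': "integrable lborel (\<lambda>x. indicator ?D (x + h) :: real)"
      using lborel_shift(1)[of "indicator ?D" h] iD by simp
    have "L1_modulus (\<lambda>x. indicator A x *\<^sub>R c) h
        \<le> (\<integral>x. \<bar>c\<bar> * (indicator ?D (x + h) + indicator ?D x) \<partial>lborel)"
      unfolding L1_modulus_def
    proof (rule integral_mono)
      show "integrable lborel (\<lambda>x. \<bar>indicator A (x + h) *\<^sub>R c - indicator A x *\<^sub>R c\<bar>)"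
        using A by (intro integrable_shift_diff) auto
    qed (use iD iD' ptw in auto)
    also have "\<dots> = \<bar>c\<bar> * (2 * measure lborel ?D)"
      using iD iD' lborel_shift(2)[of "indicator ?D" h] by simp
    also have "\<dots> \<le> \<bar>c\<bar> * (2 * \<eta>)" using mD by (intro mult_left_mono) auto
    also have "\<dots> < (2 * \<bar>c\<bar> + 2) * \<eta>" using \<eta> by (simp add: algebra_simps)
    also have "\<dots> = \<epsilon>" by (simp add: \<eta>_def add_nonneg_eq_0_iff)
    finally show ?thesis .
  qed
  then show ?thesis using d(1) by blast
qed

text \<open>Density of simple functions: replacing \<open>f\<close> by an approximant costs their
  distance twice, at \<open>x\<close> and at \<open>x + h\<close>, and both costs agree by
  translation invariance. Hence the split of \<open>\<epsilon>\<close> into a half and two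
  quarters.\<close>

lemma L1_modulus_small:
  fixes f :: "'a::euclidean_space \<Rightarrow> real"
  assumes "integrable lborel f" "0 < \<epsilon>"
  shows "\<exists>d>0. \<forall>h. norm h < d \<longrightarrow> L1_modulus f h < \<epsilon>"
  using assms
proof (induction arbitrary: \<epsilon> rule: integrable_induct)
  case (base A c)
  then show ?case by (intro L1_modulus_indicator_small) auto
next
  case (add f g)
  obtain d1 d2 where d: "d1 > 0" "\<And>h. norm h < d1 \<Longrightarrow> L1_modulus f h < \<epsilon> / 2"
    "d2 > 0" "\<And>h. norm h < d2 \<Longrightarrow> L1_modulus g h < \<epsilon> / 2"
    using add.IH(1)[of "\<epsilon> / 2"] add.IH(2)[of "\<epsilon> / 2"] add.prems by auto
  have "L1_modulus (\<lambda>x. f x + g x) h \<le> L1_modulus f h + L1_modulus g h" for h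
  proof -
    have "L1_modulus (\<lambda>x. f x + g x) h \<le> (\<integral>x. \<bar>f (x + h) - f x\<bar> + \<bar>g (x + h) - g x\<bar> \<partial>lborel)"
      unfolding L1_modulus_def
    proof (rule integral_mono)
      show "integrable lborel (\<lambda>x. \<bar>f (x + h) + g (x + h) - (f x + g x)\<bar>)"
        using integrable_shift_diff[of "\<lambda>x. f x + g x" h] add.hyps by simp
    qed (auto intro!: Bochner_Integration.integrable_add integrable_shift_diff add.hyps)
    also have "\<dots> = L1_modulus f h + L1_modulus g h"
      unfolding L1_modulus_def
      by (intro Bochner_Integration.integral_add integrable_shift_diff add.hyps)
    finally show ?thesis .
  qed
  then show ?case
    using d by (intro exI[of _ "min d1 d2"]) (fastforce intro: le_less_trans)
next
  case (lim f s)
  have "(\<lambda>i. \<integral>x. \<bar>s i x - f x\<bar> \<partial>lborel) \<longlonglongrightarrow> (\<integral>x. 0 \<partial>(lborel :: 'a measure))"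
  \<comment> \<open>The approximants are bounded by \<open>2 * norm (f x)\<close>; adding
    \<open>norm (f x)\<close> gives the factor 3.\<close>
  proof (rule integral_dominated_convergence[where w = "\<lambda>x. 3 * \<bar>f x\<bar>"])
    show "AE x in lborel. (\<lambda>i. \<bar>s i x - f x\<bar>) \<longlonglongrightarrow> 0"
      using lim.hyps(2) by (auto intro!: tendsto_rabs_zero LIM_zero)
    show "AE x in lborel. norm \<bar>s i x - f x\<bar> \<le> 3 * \<bar>f x\<bar>" for i
    proof (rule AE_I2)
      fix x show "norm \<bar>s i x - f x\<bar> \<le> 3 * \<bar>f x\<bar>"
        using lim.hyps(3)[of x i] by simp
    qed
  qed (use lim in auto)
  then have "eventually (\<lambda>i. (\<integral>x. \<bar>s i x - f x\<bar> \<partial>lborel) < \<epsilon> / 4) sequentially"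
    using lim.prems by (intro order_tendstoD(2)) auto
  then obtain i where i: "(\<integral>x. \<bar>s i x - f x\<bar> \<partial>lborel) < \<epsilon> / 4"
    using eventually_happens'[OF sequentially_bot] by blast
  obtain d where d: "d > 0" "\<And>h. norm h < d \<Longrightarrow> L1_modulus (s i) h < \<epsilon> / 2"
    using lim.IH[of "\<epsilon> / 2" i] lim.prems by auto
  have "L1_modulus f h < \<epsilon>" if h: "norm h < d" for h
  proof -
    have int: "integrable lborel (\<lambda>x. \<bar>s i x - f x\<bar>)" using lim by auto
    have int': "integrable lborel (\<lambda>x. \<bar>s i (x + h) - f (x + h)\<bar>)"
      using lborel_shift(1)[of "\<lambda>x. \<bar>s i x - f x\<bar>" h] int by (simp add: borel_measurable_integrable)
    have "L1_modulus f h \<le> (\<integral>x. \<bar>s i (x + h) - s i x\<bar> +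
        (\<bar>s i (x + h) - f (x + h)\<bar> + \<bar>s i x - f x\<bar>) \<partial>lborel)"
      unfolding L1_modulus_def
      by (rule integral_mono) (use int int' integrable_shift_diff[OF lim.hyps(1)] integrable_shift_diff[OF lim.hyps(4)] in auto)
    also have "\<dots> = L1_modulus (s i) h + ((\<integral>x. \<bar>s i (x + h) - f (x + h)\<bar> \<partial>lborel)
        + (\<integral>x. \<bar>s i x - f x\<bar> \<partial>lborel))"
      unfolding L1_modulus_def using int int' integrable_shift_diff[OF lim.hyps(1), of i h] by simp
    also have "(\<integral>x. \<bar>s i (x + h) - f (x + h)\<bar> \<partial>lborel) = (\<integral>x. \<bar>s i x - f x\<bar> \<partial>lborel)"
      using lborel_shift(2)[of "\<lambda>x. \<bar>s i x - f x\<bar>" h] int by (simp add: borel_measurable_integrable)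
    finally show ?thesis using i d(2)[OF h] by linarith
  qed
  then show ?case using d(1) by blast
qed

section \<open>Difference quotients and the chain rule for weak derivatives\<close>

text \<open>One direction at a time and integrals over the whole space with respect to
  \<open>lborel\<close>: for Borel representatives, translations and Fubini apply directly to this
  form. The set \<open>U\<close> enters only through the test functions; integrability is stated
  separately.\<close>

definition has_weak_pderivative ::
    "(real^'n) set \<Rightarrow> 'n \<Rightarrow> (real^'n \<Rightarrow> real) \<Rightarrow> (real^'n \<Rightarrow> real) \<Rightarrow> bool" where
  "has_weak_pderivative U i u g \<longleftrightarrow>
     (\<forall>\<phi>. test_function U \<phi> \<longrightarrow>
        (\<integral>x. u x * pderivative i \<phi> x \<partial>lborel) = - (\<integral>x. g x * \<phi> x \<partial>lborel))"

lemma test_function_shift: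
  assumes \<psi>: "test_function V \<psi>" and V: "\<And>x. x \<in> V \<Longrightarrow> x + c \<in> U"
  shows "test_function U (\<lambda>x. \<psi> (x - c))"
proof -
  have "{x. \<psi> (x - c) \<noteq> 0} = (+) c ` {x. \<psi> x \<noteq> 0}"
    by (auto simp: image_iff intro!: exI[of _ "_ - c"])
  then have eq: "closure {x. \<psi> (x - c) \<noteq> 0} = (+) c ` closure {x. \<psi> x \<noteq> 0}"
    by (simp add: closure_translation)
  have "Ck k (\<lambda>x. \<psi> (x - c))" for k
    using Ck_shift[of k \<psi> "- c"] \<psi> by (simp add: test_function_def)
  moreover have "compact (closure {x. \<psi> (x - c) \<noteq> 0})"
    using \<psi> by (simp only: eq compact_translation test_function_def)
  moreover have "closure {x. \<psi> (x - c) \<noteq> 0} \<subseteq> U"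
    using \<psi> V by (auto simp: eq test_function_def add.commute)
  ultimately show ?thesis by (simp add: test_function_def)
qed

section \<open>Weak derivatives as increments along a coordinate direction\<close>

lemma DERIV_test_function_line:
  assumes "test_function U \<psi>"
  shows "((\<lambda>t. \<psi> (y - t *\<^sub>R axis i 1)) has_real_derivative
           - pderivative i \<psi> (y - t *\<^sub>R axis i 1)) (at t)"
proof -
  let ?D = "frechet_derivative \<psi> (at (y - t *\<^sub>R axis i 1))"
  have D: "(\<psi> has_derivative ?D) (at (y - t *\<^sub>R axis i 1))"
    using test_functionD(2)[OF assms] by (simp add: frechet_derivative_works[symmetric])
  have lin: "linear ?D" using D by (rule has_derivative_linear)
  have "((\<lambda>t. y - t *\<^sub>R axis i 1) has_derivative (\<lambda>s. - (s *\<^sub>R axis i 1))) (at t)"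
    by (auto intro!: derivative_eq_intros)
  from has_derivative_compose[OF this D]
  have "((\<lambda>t. \<psi> (y - t *\<^sub>R axis i 1)) has_derivative (\<lambda>s. ?D (- (s *\<^sub>R axis i 1)))) (at t)" .
  moreover have "(\<lambda>s. ?D (- (s *\<^sub>R axis i 1))) = (*) (- pderivative i \<psi> (y - t *\<^sub>R axis i 1))"
    by (rule ext) (simp add: pderivative_def linear_neg[OF lin] linear_cmul[OF lin])
  ultimately show ?thesis by (simp add: has_field_derivative_def)
qed

lemma test_function_line_integral:
  assumes "test_function U \<psi>" "0 \<le> h"
  shows "\<psi> (y - h *\<^sub>R axis i 1) - \<psi> y =
    - (\<integral>t. indicator {0..h} t * pderivative i \<psi> (y - t *\<^sub>R axis i 1) \<partial>lborel)"
proof -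
  have "(\<integral>t. - pderivative i \<psi> (y - t *\<^sub>R axis i 1) * indicator {0..h} t \<partial>lborel) =
      \<psi> (y - h *\<^sub>R axis i 1) - \<psi> (y - 0 *\<^sub>R axis i 1)"
  proof (rule integral_FTC_Icc_real[OF assms(2)])
    fix t
    show "((\<lambda>t. \<psi> (y - t *\<^sub>R axis i 1)) has_real_derivative
         - pderivative i \<psi> (y - t *\<^sub>R axis i 1)) (at t)"
      by (rule DERIV_test_function_line[OF assms(1)])
    have "continuous_on UNIV (\<lambda>t. pderivative i \<psi> (y - t *\<^sub>R axis i 1))"
      using test_functionD(3)[OF assms(1)]
      by (rule continuous_on_compose2) (auto intro!: continuous_intros)
    then have "isCont (\<lambda>t. pderivative i \<psi> (y - t *\<^sub>R axis i 1)) t"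
      by (simp add: continuous_on_eq_continuous_at)
    then show "isCont (\<lambda>t. - pderivative i \<psi> (y - t *\<^sub>R axis i 1)) t"
      by (rule isCont_minus)
  qed
  then show ?thesis by (simp add: mult.commute)
qed

text \<open>A bound on the L1 norms that is uniform in \<open>t\<close>, together with the finite
  length of \<open>{0..h}\<close>, makes the integrand integrable on the product of this interval
  with the space.\<close>

lemma Fubini_strip:
  fixes w :: "real \<Rightarrow> 'a::euclidean_space \<Rightarrow> real" and h :: real
  assumes meas: "(\<lambda>(t, x). w t x) \<in> borel_measurable (lborel \<Otimes>\<^sub>M lborel)"
    and int: "\<And>t. integrable lborel (w t)"
    and bound: "\<And>t. (\<integral>x. \<bar>w t x\<bar> \<partial>lborel) \<le> C"
  defines "W \<equiv> \<lambda>t x. indicator {0..h} t * w t x"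
  shows "integrable lborel (\<lambda>x. \<integral>t. W t x \<partial>lborel)"
    and "AE x in lborel. integrable lborel (\<lambda>t. W t x)"
    and "(\<integral>x. (\<integral>t. W t x \<partial>lborel) \<partial>lborel) =
           (\<integral>t. indicator {0..h} t * (\<integral>x. w t x \<partial>lborel) \<partial>lborel)"
proof -
  have psf: "pair_sigma_finite (lborel :: real measure) (lborel :: 'a measure)"
    by (intro pair_sigma_finite.intro sigma_finite_lborel)
  note meas[measurable]
  have W: "case_prod W \<in> borel_measurable (lborel \<Otimes>\<^sub>M lborel)"
    unfolding W_def by measurable
  have I: "integrable (lborel \<Otimes>\<^sub>M lborel) (case_prod W)"
  proof (rule pair_sigma_finite.Fubini_integrable[OF psf W])
    show "AE t in lborel. integrable lborel (\<lambda>x. case_prod W (t, x))"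
      using int by (simp add: W_def)
    have eq: "(\<integral>x. norm (case_prod W (t, x)) \<partial>lborel) = indicator {0..h} t * (\<integral>x. \<bar>w t x\<bar> \<partial>lborel)" for t
      by (simp add: W_def abs_mult)
    have bnd: "integrable lborel (\<lambda>t. indicator {0..h} t * \<bar>C\<bar> :: real)"
      by (intro integrable_mult_left integrable_real_indicator) (auto simp: emeasure_lborel_Icc_eq)
    show "integrable lborel (\<lambda>t. \<integral>x. norm (case_prod W (t, x)) \<partial>lborel)"
    proof (rule Bochner_Integration.integrable_bound[OF bnd])
      show "(\<lambda>t. \<integral>x. norm (case_prod W (t, x)) \<partial>lborel) \<in> borel_measurable lborel"
        using W by (intro lborel.borel_measurable_lebesgue_integral) simp
      show "AE t in lborel. norm (\<integral>x. norm (case_prod W (t, x)) \<partial>lborel)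
          \<le> norm (indicator {0..h} t * \<bar>C\<bar>)"
      proof (rule AE_I2)
        fix t
        have "\<bar>\<integral>x. \<bar>w t x\<bar> \<partial>lborel\<bar> \<le> \<bar>C\<bar>"
          using bound[of t] by (simp add: abs_of_nonneg)
        then show "norm (\<integral>x. norm (case_prod W (t, x)) \<partial>lborel) \<le> norm (indicator {0..h} t * \<bar>C\<bar>)"
          unfolding eq by (auto simp: indicator_def)
      qed
    qed
  qed
  from pair_sigma_finite.integrable_snd[OF psf I] show "integrable lborel (\<lambda>x. \<integral>t. W t x \<partial>lborel)" .
  from pair_sigma_finite.AE_integrable_snd[OF psf I] show "AE x in lborel. integrable lborel (\<lambda>t. W t x)" .
  have "(\<integral>x. (\<integral>t. W t x \<partial>lborel) \<partial>lborel) = (\<integral>t. (\<integral>x. W t x \<partial>lborel) \<partial>lborel)"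
    using pair_sigma_finite.Fubini_integral[OF psf I] by simp
  then show "(\<integral>x. (\<integral>t. W t x \<partial>lborel) \<partial>lborel) =
      (\<integral>t. indicator {0..h} t * (\<integral>x. w t x \<partial>lborel) \<partial>lborel)"
    by (simp add: W_def)
qed

text \<open>The identity is tested against \<open>\<psi>\<close>. Translations are moved onto
  \<open>\<psi>\<close>, whose increment is an integral of its derivative along a segment; after
  Fubini the weak derivative of \<open>u\<close> is used for each shift separately and the
  translation is moved back onto \<open>g\<close>. The assumption \<open>VU\<close> keeps the
  shifted test functions supported in \<open>U\<close>.\<close>

lemma weak_pderivative_increment:
  fixes u g :: "real^'n \<Rightarrow> real"
  assumes u: "integrable lborel u" and g: "integrable lborel g"
    and wd: "has_weak_pderivative U i u g" and V: "open V" and h: "0 \<le> h"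
    and VU: "\<And>x t. x \<in> V \<Longrightarrow> 0 \<le> t \<Longrightarrow> t \<le> h \<Longrightarrow> x + t *\<^sub>R axis i 1 \<in> U"
  shows "AE x in lborel. x \<in> V \<longrightarrow>
    u (x + h *\<^sub>R axis i 1) - u x = (\<integral>t. indicator {0..h} t * g (x + t *\<^sub>R axis i 1) \<partial>lborel)"
proof -
  let ?e = "axis i 1 :: real^'n"
  have [measurable]: "u \<in> borel_measurable borel" "g \<in> borel_measurable borel"
    using u g by (auto dest: borel_measurable_integrable)
  define I where "I x = (\<integral>t. indicator {0..h} t * g (x + t *\<^sub>R ?e) \<partial>lborel)" for x
  have int_g: "integrable lborel (\<lambda>x. g (x + c))" and int_u: "integrable lborel (\<lambda>x. u (x + c))" for c
    using u g by (auto simp: lborel_shift)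
  have I: "integrable lborel I"
    unfolding I_def
  proof (rule Fubini_strip(1))
    show "(\<integral>x. \<bar>g (x + t *\<^sub>R ?e)\<bar> \<partial>lborel) \<le> (\<integral>x. \<bar>g x\<bar> \<partial>lborel)" for t
      using lborel_shift(2)[of "\<lambda>x. \<bar>g x\<bar>" "t *\<^sub>R ?e"] by simp
  qed (use int_g in \<open>auto\<close>)
  have "AE x in lborel. x \<in> V \<longrightarrow> u (x + h *\<^sub>R ?e) - u x - I x = 0"
  proof (rule AE_zero_of_test_functions[OF _ V])
    show "integrable lborel (\<lambda>x. u (x + h *\<^sub>R ?e) - u x - I x)"
      using u int_u I by auto
    fix \<psi> assume \<psi>: "test_function V \<psi>"
    note [measurable] = borel_measurable_test_function[OF \<psi>]
    obtain B where B: "B \<ge> 0" "\<And>x. \<bar>\<psi> x\<bar> \<le> B" using test_function_bounded(1)[OF \<psi>] by blast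
    obtain B' where B': "B' \<ge> 0" "\<And>x. \<bar>pderivative i \<psi> x\<bar> \<le> B'"
      using test_function_bounded(2)[OF \<psi>] by blast
    have int_\<psi>: "integrable lborel (\<lambda>x. f x * \<psi> (x + c))"
      if "integrable lborel f" for f :: "real^'n \<Rightarrow> real" and c
      by (rule integrable_mult_bounded[OF that]) (use B in auto)
    have int_d\<psi>: "integrable lborel (\<lambda>x. f x * pderivative i \<psi> (x - c))"
      if "integrable lborel f" for f :: "real^'n \<Rightarrow> real" and c
      by (rule integrable_mult_bounded[OF that]) (use B' in auto)
    have int\<psi>0: "integrable lborel (\<lambda>x. f x * \<psi> x)"
      if "integrable lborel f" for f :: "real^'n \<Rightarrow> real"
      using int_\<psi>[OF that, of 0] by simp
    have weak: "(\<integral>y. u y * pderivative i \<psi> (y - t *\<^sub>R ?e) \<partial>lborel) = - (\<integral>x. g (x + t *\<^sub>R ?e) * \<psi> x \<partial>lborel)"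
      if t: "t \<in> {0..h}" for t
    proof -
      have "test_function U (\<lambda>x. \<psi> (x - t *\<^sub>R ?e))"
        by (rule test_function_shift[OF \<psi>]) (use VU t in auto)
      then have "(\<integral>y. u y * pderivative i (\<lambda>x. \<psi> (x - t *\<^sub>R ?e)) y \<partial>lborel)
          = - (\<integral>y. g y * \<psi> (y - t *\<^sub>R ?e) \<partial>lborel)"
        using wd unfolding has_weak_pderivative_def by blast
      moreover have "pderivative i (\<lambda>x. \<psi> (x - t *\<^sub>R ?e)) y = pderivative i \<psi> (y - t *\<^sub>R ?e)" for y
        using pderivative_shift[of i \<psi> "- (t *\<^sub>R ?e)" y] by simp
      ultimately show ?thesis
        using lborel_shift(2)[of "\<lambda>y. g y * \<psi> (y - t *\<^sub>R ?e)" "t *\<^sub>R ?e"] by simp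
    qed
    have "(\<integral>x. u (x + h *\<^sub>R ?e) * \<psi> x \<partial>lborel) = (\<integral>y. u y * \<psi> (y - h *\<^sub>R ?e) \<partial>lborel)"
      using lborel_shift(2)[of "\<lambda>y. u y * \<psi> (y - h *\<^sub>R ?e)" "h *\<^sub>R ?e"] by simp
    then have "(\<integral>x. u (x + h *\<^sub>R ?e) * \<psi> x \<partial>lborel) - (\<integral>x. u x * \<psi> x \<partial>lborel)
        = (\<integral>y. u y * (\<psi> (y - h *\<^sub>R ?e) - \<psi> y) \<partial>lborel)"
      using int_\<psi>[OF u, of "- (h *\<^sub>R ?e)"] int\<psi>0[OF u] by (simp add: right_diff_distrib)
    also have "\<dots> = - (\<integral>y. (\<integral>t. indicator {0..h} t * (u y * pderivative i \<psi> (y - t *\<^sub>R ?e)) \<partial>lborel) \<partial>lborel)"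
      unfolding test_function_line_integral[OF \<psi> h, where i = i]
      by (simp add: mult.left_commute[of "indicator _ _"])
    also have "(\<integral>y. (\<integral>t. indicator {0..h} t * (u y * pderivative i \<psi> (y - t *\<^sub>R ?e)) \<partial>lborel) \<partial>lborel)
        = (\<integral>t. indicator {0..h} t * (\<integral>y. u y * pderivative i \<psi> (y - t *\<^sub>R ?e) \<partial>lborel) \<partial>lborel)"
    proof (rule Fubini_strip(3))
      show "(\<integral>y. \<bar>u y * pderivative i \<psi> (y - t *\<^sub>R ?e)\<bar> \<partial>lborel) \<le> (\<integral>y. \<bar>u y\<bar> * B' \<partial>lborel)" for t
      proof (rule integral_mono)
        show "integrable lborel (\<lambda>y. \<bar>u y * pderivative i \<psi> (y - t *\<^sub>R ?e)\<bar>)"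
          by (intro integrable_abs int_d\<psi> u)
      qed (use u B' in \<open>auto simp: abs_mult intro!: mult_left_mono\<close>)
    qed (use int_d\<psi>[OF u] in auto)
    also have "\<dots> = (\<integral>t. indicator {0..h} t * - (\<integral>x. g (x + t *\<^sub>R ?e) * \<psi> x \<partial>lborel) \<partial>lborel)"
      by (rule Bochner_Integration.integral_cong) (use weak in \<open>auto simp: indicator_def\<close>)
    also have "\<dots> = - (\<integral>t. indicator {0..h} t * (\<integral>x. g (x + t *\<^sub>R ?e) * \<psi> x \<partial>lborel) \<partial>lborel)"
      by simp
    also have "(\<integral>t. indicator {0..h} t * (\<integral>x. g (x + t *\<^sub>R ?e) * \<psi> x \<partial>lborel) \<partial>lborel)
        = (\<integral>x. (\<integral>t. indicator {0..h} t * (g (x + t *\<^sub>R ?e) * \<psi> x) \<partial>lborel) \<partial>lborel)"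
    proof (rule Fubini_strip(3)[symmetric])
      fix t
      have "(\<integral>x. \<bar>g (x + t *\<^sub>R ?e) * \<psi> x\<bar> \<partial>lborel) \<le> (\<integral>x. \<bar>g (x + t *\<^sub>R ?e)\<bar> * B \<partial>lborel)"
      proof (rule integral_mono)
        show "integrable lborel (\<lambda>x. \<bar>g (x + t *\<^sub>R ?e) * \<psi> x\<bar>)"
          by (intro integrable_abs int\<psi>0 int_g)
      qed (use int_g B in \<open>auto simp: abs_mult intro!: mult_left_mono\<close>)
      also have "\<dots> = (\<integral>x. \<bar>g x\<bar> * B \<partial>lborel)"
        using lborel_shift(2)[of "\<lambda>x. \<bar>g x\<bar> * B" "t *\<^sub>R ?e"] by simp
      finally show "(\<integral>x. \<bar>g (x + t *\<^sub>R ?e) * \<psi> x\<bar> \<partial>lborel) \<le> (\<integral>x. \<bar>g x\<bar> * B \<partial>lborel)" .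
    qed (use int\<psi>0[OF int_g] in auto)
    also have "\<dots> = (\<integral>x. I x * \<psi> x \<partial>lborel)"
      by (simp add: I_def mult.assoc[symmetric])
    finally show "(\<integral>x. (u (x + h *\<^sub>R ?e) - u x - I x) * \<psi> x \<partial>lborel) = 0"
      using int\<psi>0[OF u] int\<psi>0[OF int_u] int\<psi>0[OF I] by (simp add: left_diff_distrib)
  qed
  then show ?thesis unfolding I_def by eventually_elim simp
qed

text \<open>By the increment formula the error is the mean over \<open>{0..h}\<close> of
  \<open>g (x + t e) - g x\<close>, with e the coordinate vector. Fubini bounds its L1 norm by the
  mean of the translation moduli of \<open>g\<close>, which are small for small
  \<open>h\<close>.\<close>

lemma difference_quotient_L1:
  fixes u g :: "real^'n \<Rightarrow> real"
  assumes u: "integrable lborel u" and g: "integrable lborel g"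
    and wd: "has_weak_pderivative U i u g" and V: "open V" and "0 < \<delta>" "0 < \<epsilon>"
    and VU: "\<And>x t. x \<in> V \<Longrightarrow> 0 \<le> t \<Longrightarrow> t \<le> \<delta> \<Longrightarrow> x + t *\<^sub>R axis i 1 \<in> U"
  shows "\<exists>d>0. \<forall>h. 0 < h \<and> h < d \<longrightarrow>
    (\<integral>x. indicator V x * \<bar>(u (x + h *\<^sub>R axis i 1) - u x) / h - g x\<bar> \<partial>lborel) \<le> \<epsilon>"
proof -
  let ?e = "axis i 1 :: real^'n"
  have [measurable]: "u \<in> borel_measurable borel" "g \<in> borel_measurable borel"
    using u g by (auto dest: borel_measurable_integrable)
  have [measurable]: "V \<in> sets borel" using V by auto
  have int_g: "integrable lborel (\<lambda>x. g (x + c))" and int_u: "integrable lborel (\<lambda>x. u (x + c))" for c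
    using u g by (auto simp: lborel_shift)
  obtain d where d: "d > 0" "\<And>h. norm h < d \<Longrightarrow> L1_modulus g h < \<epsilon>"
    using L1_modulus_small[OF g \<open>0 < \<epsilon>\<close>] by auto
  have "(\<integral>x. indicator V x * \<bar>(u (x + h *\<^sub>R ?e) - u x) / h - g x\<bar> \<partial>lborel) \<le> \<epsilon>"
    if h: "0 < h" "h < min \<delta> d" for h
  proof -
    let ?W = "\<lambda>t x. indicator {0..h} t * \<bar>g (x + t *\<^sub>R ?e) - g x\<bar>"
    have small: "(\<integral>x. \<bar>g (x + t *\<^sub>R ?e) - g x\<bar> \<partial>lborel) \<le> \<epsilon>" if "t \<in> {0..h}" for t
    proof -
      have "norm (t *\<^sub>R ?e) < d" using that h by (simp add: norm_axis_1)
      from d(2)[OF this] show ?thesis by (simp add: L1_modulus_def)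
    qed
    have bnd: "(\<integral>x. \<bar>\<bar>g (x + t *\<^sub>R ?e) - g x\<bar>\<bar> \<partial>lborel) \<le> (\<integral>x. \<bar>g x\<bar> \<partial>lborel) + (\<integral>x. \<bar>g x\<bar> \<partial>lborel)" for t
    proof -
      have "(\<integral>x. \<bar>\<bar>g (x + t *\<^sub>R ?e) - g x\<bar>\<bar> \<partial>lborel) \<le> (\<integral>x. \<bar>g (x + t *\<^sub>R ?e)\<bar> + \<bar>g x\<bar> \<partial>lborel)"
        by (rule integral_mono) (use g int_g in auto)
      also have "\<dots> = (\<integral>x. \<bar>g (x + t *\<^sub>R ?e)\<bar> \<partial>lborel) + (\<integral>x. \<bar>g x\<bar> \<partial>lborel)"
        using g int_g by simp
      also have "(\<integral>x. \<bar>g (x + t *\<^sub>R ?e)\<bar> \<partial>lborel) = (\<integral>x. \<bar>g x\<bar> \<partial>lborel)"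
        using lborel_shift(2)[of "\<lambda>x. \<bar>g x\<bar>" "t *\<^sub>R ?e"] by simp
      finally show ?thesis .
    qed
    have meas: "(\<lambda>(t, x). \<bar>g (x + t *\<^sub>R ?e) - g x\<bar>) \<in> borel_measurable (lborel \<Otimes>\<^sub>M lborel)"
      by measurable
    note F = Fubini_strip[OF meas integrable_shift_diff[OF g] bnd, of h]
    have meas': "(\<lambda>(t, x). g (x + t *\<^sub>R ?e)) \<in> borel_measurable (lborel \<Otimes>\<^sub>M lborel)"
      by measurable
    have bnd': "(\<integral>x. \<bar>g (x + t *\<^sub>R ?e)\<bar> \<partial>lborel) \<le> (\<integral>x. \<bar>g x\<bar> \<partial>lborel)" for t
      using lborel_shift(2)[of "\<lambda>x. \<bar>g x\<bar>" "t *\<^sub>R ?e"] by simp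
    note F' = Fubini_strip(2)[OF meas' int_g bnd', of h]
    have incr: "AE x in lborel. x \<in> V \<longrightarrow>
        u (x + h *\<^sub>R ?e) - u x = (\<integral>t. indicator {0..h} t * g (x + t *\<^sub>R ?e) \<partial>lborel)"
      by (rule weak_pderivative_increment[OF u g wd V]) (use h VU in auto)
    have "(\<integral>x. indicator V x * \<bar>(u (x + h *\<^sub>R ?e) - u x) / h - g x\<bar> \<partial>lborel)
        \<le> (\<integral>x. (\<integral>t. ?W t x \<partial>lborel) / h \<partial>lborel)"
    proof (rule integral_mono_AE)
      show "integrable lborel (\<lambda>x. indicator V x * \<bar>(u (x + h *\<^sub>R ?e) - u x) / h - g x\<bar>)"
        using u g int_u V by (intro integrable_mult_indicator[where 'b = real, simplified]) auto
      show "integrable lborel (\<lambda>x. (\<integral>t. ?W t x \<partial>lborel) / h)"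
        using F(1) by simp
      show "AE x in lborel. indicator V x * \<bar>(u (x + h *\<^sub>R ?e) - u x) / h - g x\<bar>
          \<le> (\<integral>t. ?W t x \<partial>lborel) / h"
        using incr F' F(2)
      proof eventually_elim
        case (elim x)
        have ic: "integrable lborel (\<lambda>t. indicator {0..h} t * g x)"
          by (intro integrable_mult_left integrable_real_indicator) (auto simp: emeasure_lborel_Icc_eq)
        have pos: "0 \<le> (\<integral>t. ?W t x \<partial>lborel)" by (intro integral_nonneg_AE) auto
        show ?case
        proof (cases "x \<in> V")
          case True
          have "(u (x + h *\<^sub>R ?e) - u x) - h * g x =
              (\<integral>t. indicator {0..h} t * g (x + t *\<^sub>R ?e) \<partial>lborel) - (\<integral>t. indicator {0..h} t * g x \<partial>lborel)"
            using True elim(1) h by simp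
          also have "\<dots> = (\<integral>t. indicator {0..h} t * g (x + t *\<^sub>R ?e) - indicator {0..h} t * g x \<partial>lborel)"
            using elim(2) ic by simp
          also have "\<bar>\<dots>\<bar> \<le> (\<integral>t. \<bar>indicator {0..h} t * g (x + t *\<^sub>R ?e) - indicator {0..h} t * g x\<bar> \<partial>lborel)"
            by (rule integral_abs_bound)
          also have "\<dots> = (\<integral>t. ?W t x \<partial>lborel)"
            by (rule Bochner_Integration.integral_cong) (auto simp: indicator_def)
          finally have "\<bar>(u (x + h *\<^sub>R ?e) - u x) - h * g x\<bar> / h \<le> (\<integral>t. ?W t x \<partial>lborel) / h"
            using h by (intro divide_right_mono) auto
          moreover have "\<bar>(u (x + h *\<^sub>R ?e) - u x) - h * g x\<bar> / h = \<bar>(u (x + h *\<^sub>R ?e) - u x) / h - g x\<bar>"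
          proof -
            have "(u (x + h *\<^sub>R ?e) - u x - h * g x) / h = (u (x + h *\<^sub>R ?e) - u x) / h - g x"
              using h by (simp add: diff_divide_distrib)
            then show ?thesis using h by (metis abs_divide abs_of_pos)
          qed
          ultimately show ?thesis using True by simp
        qed (use pos h in auto)
      qed
    qed
    also have "\<dots> = (\<integral>t. indicator {0..h} t * (\<integral>x. \<bar>g (x + t *\<^sub>R ?e) - g x\<bar> \<partial>lborel) \<partial>lborel) / h"
      using F(3) by simp
    also have "\<dots> \<le> (\<integral>t. indicator {0..h} t * \<epsilon> \<partial>lborel) / h"
    proof (intro divide_right_mono integral_mono)
      show i2: "integrable lborel (\<lambda>t. indicator {0..h} t * \<epsilon>)"
        by (intro integrable_mult_left integrable_real_indicator) (auto simp: emeasure_lborel_Icc_eq)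
      show "integrable lborel (\<lambda>t. indicator {0..h} t * (\<integral>x. \<bar>g (x + t *\<^sub>R ?e) - g x\<bar> \<partial>lborel))"
      proof (rule Bochner_Integration.integrable_bound[OF i2])
        show "AE t in lborel. norm (indicator {0..h} t * (\<integral>x. \<bar>g (x + t *\<^sub>R ?e) - g x\<bar> \<partial>lborel))
            \<le> norm (indicator {0..h} t * \<epsilon>)"
          using small \<open>0 < \<epsilon>\<close> by (auto simp: indicator_def)
        show "(\<lambda>t. indicator {0..h} t * (\<integral>x. \<bar>g (x + t *\<^sub>R ?e) - g x\<bar> \<partial>lborel)) \<in> borel_measurable lborel"
          by measurable
      qed
      show "indicator {0..h} t * (\<integral>x. \<bar>g (x + t *\<^sub>R ?e) - g x\<bar> \<partial>lborel) \<le> indicator {0..h} t * \<epsilon>" for t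
        using small[of t] by (auto simp: indicator_def)
    qed (use h in auto)
    also have "\<dots> = \<epsilon>" using h by simp
    finally show ?thesis .
  qed
  then show ?thesis using d(1) \<open>0 < \<delta>\<close> by (intro exI[of _ "min \<delta> d"]) auto
qed

section \<open>Limits of difference quotients and the chain rule for one partial derivative\<close>

lemma has_derivative_quotient_tendsto:
  fixes F :: "'a::real_normed_vector \<Rightarrow> 'b::real_normed_vector"
  assumes F: "(F has_derivative D) (at w within S)"
    and k: "\<And>n. 0 < k n" "k \<longlonglongrightarrow> 0" and q: "q \<longlonglongrightarrow> l"
    and S: "\<And>n. w + k n *\<^sub>R q n \<in> S"
  shows "(\<lambda>n. (F (w + k n *\<^sub>R q n) - F w) /\<^sub>R k n) \<longlonglongrightarrow> D l"
proof -
  have bl: "bounded_linear D" using F by (rule has_derivative_bounded_linear)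
  \<comment> \<open>The directions \<open>q n\<close> vary and merely converge; a common bound
    \<open>M\<close> makes the remainder small relative to \<open>k n\<close>. With the factor
    \<open>\<epsilon> / (2 * M)\<close> it is at most \<open>\<epsilon> / 2\<close> after division
    by \<open>k n\<close>.\<close>
  obtain M where M: "M > 0" "\<And>n. norm (q n) \<le> M"
    using q by (metis BseqE convergentI convergent_imp_Bseq)
  have "(\<lambda>n. (F (w + k n *\<^sub>R q n) - F w) /\<^sub>R k n - D (q n)) \<longlonglongrightarrow> 0"
  proof (rule LIMSEQ_I)
    fix \<epsilon> :: real assume \<epsilon>: "0 < \<epsilon>"
    have "\<epsilon> / (2 * M) > 0" using \<epsilon> M(1) by simp
    then obtain d where d: "d > 0"
      "\<And>y. y \<in> S \<Longrightarrow> norm (y - w) < d \<Longrightarrow> norm (F y - F w - D (y - w)) \<le> \<epsilon> / (2 * M) * norm (y - w)"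
      using F unfolding has_derivative_within_alt by blast
    have "eventually (\<lambda>n. k n < d / M) sequentially"
      using order_tendstoD(2)[OF k(2), of "d / M"] d(1) M(1) by simp
    then obtain N where N: "\<And>n. n \<ge> N \<Longrightarrow> k n < d / M"
      unfolding eventually_sequentially by blast
    have "norm ((F (w + k n *\<^sub>R q n) - F w) /\<^sub>R k n - D (q n) - 0) < \<epsilon>" if "n \<ge> N" for n
    proof -
      let ?y = "w + k n *\<^sub>R q n"
      have nk: "norm (?y - w) = k n * norm (q n)" using k(1)[of n] by simp
      also have "\<dots> \<le> k n * M" using k(1)[of n] M(2)[of n] by (intro mult_left_mono) auto
      finally have le: "norm (?y - w) \<le> k n * M" .
      also have "\<dots> < d" using N[OF that] M(1) by (simp add: field_simps)
      finally have "norm (F ?y - F w - D (?y - w)) \<le> \<epsilon> / (2 * M) * norm (?y - w)"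
        using d(2)[OF S] by blast
      also have "\<dots> \<le> \<epsilon> / (2 * M) * (k n * M)"
        using le \<epsilon> M(1) by (intro mult_left_mono) auto
      also have "\<dots> = (\<epsilon> / 2) * k n" using M(1) by simp
      finally have "norm (F ?y - F w - D (?y - w)) \<le> (\<epsilon> / 2) * k n" .
      moreover have "D (?y - w) = k n *\<^sub>R D (q n)"
        using bl by (simp add: bounded_linear.linear linear_cmul)
      ultimately have "norm (F ?y - F w - k n *\<^sub>R D (q n)) \<le> (\<epsilon> / 2) * k n" by simp
      moreover have "(F ?y - F w) /\<^sub>R k n - D (q n) = (F ?y - F w - k n *\<^sub>R D (q n)) /\<^sub>R k n"
        using k(1)[of n] by (simp add: scaleR_diff_right)
      ultimately have "norm ((F ?y - F w) /\<^sub>R k n - D (q n)) \<le> inverse (k n) * ((\<epsilon> / 2) * k n)"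
        using k(1)[of n] by (simp only: norm_scaleR) (intro mult_mono, simp_all)
      also have "\<dots> = \<epsilon> / 2" using k(1)[of n] by simp
      finally have "norm ((F ?y - F w) /\<^sub>R k n - D (q n)) \<le> \<epsilon> / 2" .
      then show ?thesis using \<epsilon> by simp
    qed
    then show "\<exists>N. \<forall>n\<ge>N. norm ((F (w + k n *\<^sub>R q n) - F w) /\<^sub>R k n - D (q n) - 0) < \<epsilon>" by blast
  qed
  moreover have "(\<lambda>n. D (q n)) \<longlonglongrightarrow> D l"
    by (rule bounded_linear.tendsto[OF bl q])
  ultimately show ?thesis
    using tendsto_add[of "\<lambda>n. (F (w + k n *\<^sub>R q n) - F w) /\<^sub>R k n - D (q n)" 0 sequentially "\<lambda>n. D (q n)" "D l"]
    by simp
qed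

lemma AE_lborel_shift:
  fixes c :: "'a::euclidean_space"
  assumes "AE x in lborel. P x"
  shows "AE x in lborel. P (x + c)"
proof -
  have m: "(+) c \<in> lborel \<rightarrow>\<^sub>M (borel :: 'a measure)" by measurable
  have "AE x in distr lborel borel ((+) c). P x" using assms by (simp only: lborel_distr_plus)
  from AE_distrD[OF m this] show ?thesis by (simp add: add.commute)
qed

text \<open>The majorant \<open>c * R n + w\<close> moves with \<open>n\<close>. Dominated
  convergence is therefore applied to the positive part of \<open>Z n - c * R n\<close>, which is
  bounded by the absolute value of \<open>w\<close>; the rest contributes at most \<open>c\<close>
  times the integral of \<open>R n\<close>.\<close>

lemma integral_tendsto_0_dominated_perturbed:
  fixes Z R :: "nat \<Rightarrow> 'a \<Rightarrow> real"
  assumes Z: "\<And>n. integrable M (Z n)" and R: "\<And>n. integrable M (R n)" and w: "integrable M w"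
    and nonneg: "\<And>n x. 0 \<le> Z n x" "\<And>n x. 0 \<le> R n x" and c: "0 \<le> c"
    and dom: "\<And>n. AE x in M. Z n x \<le> c * R n x + w x"
    and R0: "(\<lambda>n. \<integral>x. R n x \<partial>M) \<longlonglongrightarrow> 0"
    and Z0: "AE x in M. (\<lambda>n. Z n x) \<longlonglongrightarrow> 0"
  shows "(\<lambda>n. \<integral>x. Z n x \<partial>M) \<longlonglongrightarrow> 0"
proof -
  have "(\<lambda>n. \<integral>x. max 0 (Z n x - c * R n x) \<partial>M) \<longlonglongrightarrow> (\<integral>x. 0 \<partial>M)"
  proof (rule integral_dominated_convergence[where w = "\<lambda>x. \<bar>w x\<bar>"])
    show "AE x in M. (\<lambda>n. max 0 (Z n x - c * R n x)) \<longlonglongrightarrow> 0"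
      using Z0
    proof eventually_elim
      case (elim x)
      show ?case
      proof (rule tendsto_sandwich[OF _ _ tendsto_const elim])
        have "max 0 (Z n x - c * R n x) \<le> Z n x" for n
          using nonneg[where n = n and x = x] c by simp
        then show "\<forall>\<^sub>F n in sequentially. max 0 (Z n x - c * R n x) \<le> Z n x" by simp
      qed simp
    qed
    show "AE x in M. norm (max 0 (Z n x - c * R n x)) \<le> \<bar>w x\<bar>" for n
      using dom[of n] by eventually_elim auto
  qed (use Z R w in auto)
  then have lim: "(\<lambda>n. (\<integral>x. max 0 (Z n x - c * R n x) \<partial>M) + c * (\<integral>x. R n x \<partial>M)) \<longlonglongrightarrow> 0 + c * 0"
    using R0 by (intro tendsto_intros) auto
  have bound: "(\<integral>x. Z n x \<partial>M) \<le> (\<integral>x. max 0 (Z n x - c * R n x) \<partial>M) + c * (\<integral>x. R n x \<partial>M)" for n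
  proof -
    have i: "integrable M (\<lambda>x. max 0 (Z n x - c * R n x))"
      using Z R by (intro integrable_max) auto
    have "(\<integral>x. Z n x \<partial>M) \<le> (\<integral>x. max 0 (Z n x - c * R n x) + c * R n x \<partial>M)"
      by (rule integral_mono) (use Z R i in auto)
    also have "\<dots> = (\<integral>x. max 0 (Z n x - c * R n x) \<partial>M) + c * (\<integral>x. R n x \<partial>M)"
      using i R by simp
    finally show ?thesis .
  qed
  show ?thesis
    by (rule tendsto_sandwich[OF _ _ tendsto_const, where h =
          "\<lambda>n. (\<integral>x. max 0 (Z n x - c * R n x) \<partial>M) + c * (\<integral>x. R n x \<partial>M)"])
      (use bound lim nonneg in \<open>auto intro!: always_eventually Bochner_Integration.integral_nonneg\<close>)
qed

text \<open>The mean value theorem bounds the quotients of \<open>\<phi>\<close> by the supremum of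
  its partial derivative, which gives an integrable majorant. The limit carries a minus sign because
  the shift is backwards.\<close>

lemma test_function_quotient_tendsto:
  fixes f :: "real^'n \<Rightarrow> real"
  assumes \<phi>: "test_function U \<phi>" and f: "integrable lborel f"
    and k: "\<And>n. 0 < k n" "k \<longlonglongrightarrow> 0"
  shows "(\<lambda>n. \<integral>x. f x * ((\<phi> (x - k n *\<^sub>R axis i 1) - \<phi> x) / k n) \<partial>lborel)
           \<longlonglongrightarrow> - (\<integral>x. f x * pderivative i \<phi> x \<partial>lborel)"
proof -
  let ?e = "axis i 1 :: real^'n"
  note [measurable] = borel_measurable_test_function[OF \<phi>] borel_measurable_integrable[OF f, simplified]
  obtain B where B: "B \<ge> 0" "\<And>x. \<bar>pderivative i \<phi> x\<bar> \<le> B"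
    using test_function_bounded(2)[OF \<phi>] by blast
  have "(\<lambda>n. \<integral>x. f x * ((\<phi> (x - k n *\<^sub>R ?e) - \<phi> x) / k n) \<partial>lborel)
      \<longlonglongrightarrow> (\<integral>x. f x * (- pderivative i \<phi> x) \<partial>lborel)"
  proof (rule integral_dominated_convergence[where w = "\<lambda>x. \<bar>f x\<bar> * B"])
    show "AE x in lborel. (\<lambda>n. f x * ((\<phi> (x - k n *\<^sub>R ?e) - \<phi> x) / k n)) \<longlonglongrightarrow> f x * (- pderivative i \<phi> x)"
    proof (rule AE_I2, rule tendsto_mult_left)
      fix x
      have "((\<lambda>h. (\<phi> (x - h *\<^sub>R ?e) - \<phi> x) / h) \<longlongrightarrow> - pderivative i \<phi> x) (at 0)"
        using DERIV_test_function_line[OF \<phi>, of x i 0] by (simp add: DERIV_def)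
      moreover have "filterlim k (at 0) sequentially"
        using k by (auto simp: filterlim_at intro!: always_eventually less_imp_neq[symmetric])
      ultimately show "(\<lambda>n. (\<phi> (x - k n *\<^sub>R ?e) - \<phi> x) / k n) \<longlonglongrightarrow> - pderivative i \<phi> x"
        by (rule filterlim_compose)
    qed
    show "AE x in lborel. norm (f x * ((\<phi> (x - k n *\<^sub>R ?e) - \<phi> x) / k n)) \<le> \<bar>f x\<bar> * B" for n
    proof (rule AE_I2)
      fix x
      obtain z where "\<phi> (x - k n *\<^sub>R ?e) - \<phi> (x - 0 *\<^sub>R ?e) = (k n - 0) * (- pderivative i \<phi> (x - z *\<^sub>R ?e))"
        using MVT2[OF k(1)[of n], of "\<lambda>t. \<phi> (x - t *\<^sub>R ?e)" "\<lambda>t. - pderivative i \<phi> (x - t *\<^sub>R ?e)"]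
          DERIV_test_function_line[OF \<phi>, of x i] by blast
      then have "(\<phi> (x - k n *\<^sub>R ?e) - \<phi> x) / k n = - pderivative i \<phi> (x - z *\<^sub>R ?e)"
        using k(1)[of n] by simp
      then show "norm (f x * ((\<phi> (x - k n *\<^sub>R ?e) - \<phi> x) / k n)) \<le> \<bar>f x\<bar> * B"
        using B(2) by (simp only: real_norm_def abs_mult abs_minus_cancel) (intro mult_left_mono, auto)
    qed
  qed (use f in auto)
  then show ?thesis by simp
qed

text \<open>Differentiability of \<^term>\<open>F\<close> is only needed at the values that are attained, because the
  proof uses the almost everywhere convergence of a sequence of difference quotients instead of
  mollification.\<close>

lemma weak_pderivative_chain:
  fixes u\<^sub>1 u\<^sub>2 g\<^sub>1 g\<^sub>2 f \<gamma> :: "real^'n \<Rightarrow> real" and F :: "real \<times> real \<Rightarrow> real"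
  assumes u1: "integrable lborel u\<^sub>1" "integrable lborel g\<^sub>1" "has_weak_pderivative U i u\<^sub>1 g\<^sub>1"
    and u2: "integrable lborel u\<^sub>2" "integrable lborel g\<^sub>2" "has_weak_pderivative U i u\<^sub>2 g\<^sub>2"
    and f: "integrable lborel f" and \<gamma>: "integrable lborel \<gamma>"
    and Lip: "L-lipschitz_on S F" and B: "0 \<le> B"
    and AE: "AE x in lborel. x \<in> U \<longrightarrow> (u\<^sub>1 x, u\<^sub>2 x) \<in> S \<and> f x = F (u\<^sub>1 x, u\<^sub>2 x) \<and>
      \<bar>\<gamma> x\<bar> \<le> B * (\<bar>g\<^sub>1 x\<bar> + \<bar>g\<^sub>2 x\<bar>) \<and>
      (\<exists>D. (F has_derivative D) (at (u\<^sub>1 x, u\<^sub>2 x) within S) \<and> \<gamma> x = D (g\<^sub>1 x, g\<^sub>2 x))"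
    and V: "open V" and "0 < \<delta>"
    and VU: "\<And>x t. x \<in> V \<Longrightarrow> 0 \<le> t \<Longrightarrow> t \<le> \<delta> \<Longrightarrow> x + t *\<^sub>R axis i 1 \<in> U"
    and \<phi>: "test_function V \<phi>"
  shows "(\<integral>x. f x * pderivative i \<phi> x \<partial>lborel) = - (\<integral>x. \<gamma> x * \<phi> x \<partial>lborel)"
proof -
  let ?e = "axis i 1 :: real^'n"
  note [measurable] = borel_measurable_integrable[OF u1(1), simplified]
    borel_measurable_integrable[OF u1(2), simplified] borel_measurable_integrable[OF u2(1), simplified]
    borel_measurable_integrable[OF u2(2), simplified] borel_measurable_integrable[OF f, simplified]
    borel_measurable_integrable[OF \<gamma>, simplified] borel_measurable_test_function[OF \<phi>]
  have [measurable]: "V \<in> sets borel" using V by auto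
  have shift: "integrable lborel (\<lambda>x. v (x + c))" if "integrable lborel v" for v :: "real^'n \<Rightarrow> real" and c
    using that by (simp add: lborel_shift borel_measurable_integrable)
  define Q where "Q u h x = (u (x + h *\<^sub>R ?e) - u x) / h" for u :: "real^'n \<Rightarrow> real" and h x
  have Q: "integrable lborel (Q u h)" if "integrable lborel u" for u h
    unfolding Q_def using that shift by simp
  have ind: "integrable lborel (\<lambda>x. indicator V x * v x)" if "integrable lborel v" for v :: "real^'n \<Rightarrow> real"
    using that by (intro integrable_mult_indicator[where 'b = real, simplified]) auto
  \<comment> \<open>The summed errors of the two difference quotients; they tend to zero in L1 and
    form the moving part of the majorant.\<close>
  define R where "R h x = indicator V x * (\<bar>Q u\<^sub>1 h x - g\<^sub>1 x\<bar> + \<bar>Q u\<^sub>2 h x - g\<^sub>2 x\<bar>)" for h x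
  have R: "integrable lborel (R h)" for h
    unfolding R_def using Q u1 u2 by (intro ind) auto
  have R_nonneg: "0 \<le> R h x" for h x by (simp add: R_def)
  have R_small: "\<exists>d>0. \<forall>h. 0 < h \<and> h < d \<longrightarrow> (\<integral>x. R h x \<partial>lborel) \<le> \<epsilon>" if "0 < \<epsilon>" for \<epsilon>
  proof -
    have e2: "0 < \<epsilon> / 2" using that by simp
    obtain d1 where d1: "d1 > 0" "\<And>h. 0 < h \<Longrightarrow> h < d1 \<Longrightarrow>
        (\<integral>x. indicator V x * \<bar>Q u\<^sub>1 h x - g\<^sub>1 x\<bar> \<partial>lborel) \<le> \<epsilon> / 2"
      using difference_quotient_L1[OF u1 V \<open>0 < \<delta>\<close> e2 VU] unfolding Q_def by blast
    obtain d2 where d2: "d2 > 0" "\<And>h. 0 < h \<Longrightarrow> h < d2 \<Longrightarrow>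
        (\<integral>x. indicator V x * \<bar>Q u\<^sub>2 h x - g\<^sub>2 x\<bar> \<partial>lborel) \<le> \<epsilon> / 2"
      using difference_quotient_L1[OF u2 V \<open>0 < \<delta>\<close> e2 VU] unfolding Q_def by blast
    have i1: "integrable lborel (\<lambda>x. indicator V x * \<bar>Q u\<^sub>1 h x - g\<^sub>1 x\<bar>)" for h
      using Q u1 by (intro ind) auto
    have i2: "integrable lborel (\<lambda>x. indicator V x * \<bar>Q u\<^sub>2 h x - g\<^sub>2 x\<bar>)" for h
      using Q u2 by (intro ind) auto
    have "(\<integral>x. R h x \<partial>lborel) \<le> \<epsilon>" if "0 < h" "h < min d1 d2" for h
      using d1(2)[of h] d2(2)[of h] that i1[of h] i2[of h] by (simp add: R_def distrib_left)
    then show ?thesis using d1(1) d2(1) by (intro exI[of _ "min d1 d2"]) auto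
  qed
  \<comment> \<open>A null sequence of positive steps not exceeding \<open>\<delta>\<close>, so that
    points of \<open>V\<close> are moved within \<open>U\<close>.\<close>
  have h0: "(\<lambda>n. \<delta> / real (n + 2)) \<longlonglongrightarrow> 0"
    using LIMSEQ_ignore_initial_segment[OF lim_const_over_n[of \<delta>], of 2] by simp
  have h_pos: "0 < \<delta> / real (n + 2)" and h_le: "\<delta> / real (n + 2) \<le> \<delta>" for n
    using \<open>0 < \<delta>\<close> by (auto simp: field_simps)
  have R_lim: "(\<lambda>n. \<integral>x. norm (R (\<delta> / real (n + 2)) x) \<partial>lborel) \<longlonglongrightarrow> 0"
  proof (rule LIMSEQ_I)
    fix \<epsilon> :: real assume "0 < \<epsilon>"
    then obtain d where d: "d > 0" "\<And>h. 0 < h \<Longrightarrow> h < d \<Longrightarrow> (\<integral>x. R h x \<partial>lborel) \<le> \<epsilon> / 2"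
      using R_small[of "\<epsilon> / 2"] by auto
    obtain N where "\<And>n. n \<ge> N \<Longrightarrow> \<delta> / real (n + 2) < d"
      using order_tendstoD(2)[OF h0 d(1)] unfolding eventually_sequentially by blast
    then have "norm ((\<integral>x. norm (R (\<delta> / real (n + 2)) x) \<partial>lborel) - 0) < \<epsilon>" if "n \<ge> N" for n
      using d(2)[OF h_pos[of n]] that \<open>0 < \<epsilon>\<close> Bochner_Integration.integral_nonneg[of lborel "R (\<delta> / real (n + 2))"]
      by (force simp: R_nonneg)
    then show "\<exists>N. \<forall>n\<ge>N. norm ((\<integral>x. norm (R (\<delta> / real (n + 2)) x) \<partial>lborel) - 0) < \<epsilon>" by blast
  qed
  \<comment> \<open>Convergence in L1 gives almost everywhere convergence along a subsequence. One
    null sequence of steps is enough, because the limit of the test integrals along it already gives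
    the identity.\<close>
  obtain r where r: "strict_mono r" "AE x in lborel. (\<lambda>n. R (\<delta> / real (r n + 2)) x) \<longlonglongrightarrow> 0"
    using tendsto_L1_AE_subseq[OF R R_lim] by blast
  define k where "k n = \<delta> / real (r n + 2)" for n
  have k: "\<And>n. 0 < k n" "\<And>n. k n \<le> \<delta>" "k \<longlonglongrightarrow> 0"
    using h_pos h_le LIMSEQ_subseq_LIMSEQ[OF h0 r(1)] by (simp_all add: k_def[abs_def] o_def)
  have R_lim': "(\<lambda>n. \<integral>x. R (k n) x \<partial>lborel) \<longlonglongrightarrow> 0"
    using LIMSEQ_subseq_LIMSEQ[OF R_lim r(1)] by (simp add: k_def[abs_def] o_def R_nonneg)
  have R_AE: "AE x in lborel. (\<lambda>n. R (k n) x) \<longlonglongrightarrow> 0"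
    using r(2) by (simp add: k_def)
  define Z where "Z n x = indicator V x * \<bar>Q f (k n) x - \<gamma> x\<bar>" for n x
  \<comment> \<open>Only countably many translates of one null set are discarded, so for almost
    every \<open>x\<close> all shifted points are good at once.\<close>
  have good: "AE x in lborel. \<forall>n. x + k n *\<^sub>R ?e \<in> U \<longrightarrow> (u\<^sub>1 (x + k n *\<^sub>R ?e), u\<^sub>2 (x + k n *\<^sub>R ?e)) \<in> S \<and>
      f (x + k n *\<^sub>R ?e) = F (u\<^sub>1 (x + k n *\<^sub>R ?e), u\<^sub>2 (x + k n *\<^sub>R ?e))"
    unfolding AE_all_countable
  proof
    fix n
    show "AE x in lborel. x + k n *\<^sub>R ?e \<in> U \<longrightarrow> (u\<^sub>1 (x + k n *\<^sub>R ?e), u\<^sub>2 (x + k n *\<^sub>R ?e)) \<in> S \<and>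
      f (x + k n *\<^sub>R ?e) = F (u\<^sub>1 (x + k n *\<^sub>R ?e), u\<^sub>2 (x + k n *\<^sub>R ?e))"
      using AE_lborel_shift[OF AE, of "k n *\<^sub>R ?e"] by eventually_elim blast
  qed
  have Z_lim: "(\<lambda>n. \<integral>x. Z n x \<partial>lborel) \<longlonglongrightarrow> 0"
  \<comment> \<open>By the Lipschitz bound the quotient of \<open>f\<close> is at most
    \<open>L\<close> times the quotients of \<open>u\<^sub>1\<close> and \<open>u\<^sub>2\<close>,
    that is, \<open>L\<close> times their errors plus the sizes of the weak derivatives;
    \<open>B\<close> accounts for \<open>\<gamma>\<close>.\<close>
  proof (rule integral_tendsto_0_dominated_perturbed[where R = "\<lambda>n. R (k n)" and c = L
        and w = "\<lambda>x. (L + B) * (\<bar>g\<^sub>1 x\<bar> + \<bar>g\<^sub>2 x\<bar>)"])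
    show L: "0 \<le> L" using Lip by (rule lipschitz_on_nonneg)
    show "integrable lborel (Z n)" for n
      unfolding Z_def using Q f \<gamma> by (intro ind) auto
    show "AE x in lborel. Z n x \<le> L * R (k n) x + (L + B) * (\<bar>g\<^sub>1 x\<bar> + \<bar>g\<^sub>2 x\<bar>)" for n
      using AE good
    proof eventually_elim
      case (elim x)
      show ?case
      proof (cases "x \<in> V")
        case True
        have xU: "x \<in> U" "x + k n *\<^sub>R ?e \<in> U"
          using VU[OF True, of 0] VU[OF True, of "k n"] k(1,2)[of n] \<open>0 < \<delta>\<close> by auto
        have "\<bar>f (x + k n *\<^sub>R ?e) - f x\<bar> = dist (F (u\<^sub>1 (x + k n *\<^sub>R ?e), u\<^sub>2 (x + k n *\<^sub>R ?e))) (F (u\<^sub>1 x, u\<^sub>2 x))"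
          using elim xU by (simp add: dist_real_def)
        also have "\<dots> \<le> L * dist (u\<^sub>1 (x + k n *\<^sub>R ?e), u\<^sub>2 (x + k n *\<^sub>R ?e)) (u\<^sub>1 x, u\<^sub>2 x)"
          using elim xU by (intro lipschitz_onD[OF Lip]) auto
        also have "\<dots> \<le> L * (\<bar>u\<^sub>1 (x + k n *\<^sub>R ?e) - u\<^sub>1 x\<bar> + \<bar>u\<^sub>2 (x + k n *\<^sub>R ?e) - u\<^sub>2 x\<bar>)"
          using L norm_Pair_le[of "u\<^sub>1 (x + k n *\<^sub>R ?e) - u\<^sub>1 x" "u\<^sub>2 (x + k n *\<^sub>R ?e) - u\<^sub>2 x"]
          by (intro mult_left_mono) (auto simp: dist_norm)
        finally have "\<bar>f (x + k n *\<^sub>R ?e) - f x\<bar> / k n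
            \<le> L * (\<bar>u\<^sub>1 (x + k n *\<^sub>R ?e) - u\<^sub>1 x\<bar> + \<bar>u\<^sub>2 (x + k n *\<^sub>R ?e) - u\<^sub>2 x\<bar>) / k n"
          using k(1)[of n] by (intro divide_right_mono) auto
        then have "\<bar>Q f (k n) x\<bar> \<le> L * (\<bar>Q u\<^sub>1 (k n) x\<bar> + \<bar>Q u\<^sub>2 (k n) x\<bar>)"
          using k(1)[of n] by (simp add: Q_def add_divide_distrib[symmetric])
        also have "\<dots> \<le> L * (R (k n) x + (\<bar>g\<^sub>1 x\<bar> + \<bar>g\<^sub>2 x\<bar>))"
          using L True by (intro mult_left_mono) (auto simp: R_def)
        finally have "\<bar>Q f (k n) x\<bar> \<le> L * (R (k n) x + (\<bar>g\<^sub>1 x\<bar> + \<bar>g\<^sub>2 x\<bar>))" .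
        moreover have "\<bar>\<gamma> x\<bar> \<le> B * (\<bar>g\<^sub>1 x\<bar> + \<bar>g\<^sub>2 x\<bar>)" using elim xU by blast
        moreover have "Z n x \<le> \<bar>Q f (k n) x\<bar> + \<bar>\<gamma> x\<bar>" using True by (simp add: Z_def)
        ultimately show ?thesis by (simp add: distrib_left distrib_right)
      qed (use L B R_nonneg in \<open>auto simp: Z_def\<close>)
    qed
    show "AE x in lborel. (\<lambda>n. Z n x) \<longlonglongrightarrow> 0"
      using AE good R_AE
    proof eventually_elim
      case (elim x)
      show ?case
      proof (cases "x \<in> V")
        case True
        have xU: "x \<in> U" "x + k n *\<^sub>R ?e \<in> U" for n
          using VU[OF True, of 0] VU[OF True, of "k n"] k(1,2)[of n] \<open>0 < \<delta>\<close> by auto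
        obtain D where D: "(F has_derivative D) (at (u\<^sub>1 x, u\<^sub>2 x) within S)" "\<gamma> x = D (g\<^sub>1 x, g\<^sub>2 x)"
          using elim(1) xU by blast
        have Q0: "(\<lambda>n. Q v (k n) x) \<longlonglongrightarrow> g x"
          if "\<And>n. \<bar>Q v (k n) x - g x\<bar> \<le> R (k n) x" for v g
        proof -
          have "(\<lambda>n. Q v (k n) x - g x) \<longlonglongrightarrow> 0"
            by (rule Lim_null_comparison[OF _ elim(3)]) (use that in auto)
          then show ?thesis by (simp add: LIM_zero_iff)
        qed
        have "(\<lambda>n. (Q u\<^sub>1 (k n) x, Q u\<^sub>2 (k n) x)) \<longlonglongrightarrow> (g\<^sub>1 x, g\<^sub>2 x)"
          using True by (intro tendsto_Pair Q0) (auto simp: R_def)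
        \<comment> \<open>The shifted pair is the base pair moved by \<open>k n\<close> in the
          direction of the two quotients. This direction converges but is not constant, hence the
          limit lemma with varying directions.\<close>
        moreover have step: "(u\<^sub>1 x, u\<^sub>2 x) + k n *\<^sub>R (Q u\<^sub>1 (k n) x, Q u\<^sub>2 (k n) x)
            = (u\<^sub>1 (x + k n *\<^sub>R ?e), u\<^sub>2 (x + k n *\<^sub>R ?e))" for n
          using k(1)[of n] by (simp add: Q_def)
        ultimately have "(\<lambda>n. (F (u\<^sub>1 (x + k n *\<^sub>R ?e), u\<^sub>2 (x + k n *\<^sub>R ?e)) - F (u\<^sub>1 x, u\<^sub>2 x)) /\<^sub>R k n)
            \<longlonglongrightarrow> D (g\<^sub>1 x, g\<^sub>2 x)"
          using has_derivative_quotient_tendsto[OF D(1) k(1,3),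
              of "\<lambda>n. (Q u\<^sub>1 (k n) x, Q u\<^sub>2 (k n) x)" "(g\<^sub>1 x, g\<^sub>2 x)"] elim(2) xU by simp
        moreover have "(F (u\<^sub>1 (x + k n *\<^sub>R ?e), u\<^sub>2 (x + k n *\<^sub>R ?e)) - F (u\<^sub>1 x, u\<^sub>2 x)) /\<^sub>R k n = Q f (k n) x" for n
          using elim(1,2) xU by (simp add: Q_def divide_inverse mult.commute)
        ultimately have "(\<lambda>n. Q f (k n) x) \<longlonglongrightarrow> \<gamma> x" using D(2) by simp
        then show ?thesis using True by (simp add: Z_def LIM_zero tendsto_rabs_zero)
      qed (simp add: Z_def)
    qed
  qed (use R R_nonneg R_lim' u1 u2 in \<open>auto simp: Z_def\<close>)
  obtain C where C: "C \<ge> 0" "\<And>x. \<bar>\<phi> x\<bar> \<le> C" using test_function_bounded(1)[OF \<phi>] by blast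
  have int\<phi>: "integrable lborel (\<lambda>x. v x * \<phi> (x - c))"
    if "integrable lborel v" for v :: "real^'n \<Rightarrow> real" and c
    by (rule integrable_mult_bounded[OF that]) (use C in auto)
  have int\<phi>0: "integrable lborel (\<lambda>x. v x * \<phi> x)"
    if "integrable lborel v" for v :: "real^'n \<Rightarrow> real"
    using int\<phi>[OF that, of 0] by simp
  \<comment> \<open>Discrete integration by parts: the translation passes from \<open>f\<close> to
    the test function.\<close>
  have by_parts: "(\<integral>x. Q f h x * \<phi> x \<partial>lborel) = (\<integral>x. f x * ((\<phi> (x - h *\<^sub>R ?e) - \<phi> x) / h) \<partial>lborel)" for h
  proof -
    have "(\<integral>x. f (x + h *\<^sub>R ?e) * \<phi> x \<partial>lborel) = (\<integral>x. f x * \<phi> (x - h *\<^sub>R ?e) \<partial>lborel)"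
      using lborel_shift(2)[of "\<lambda>x. f x * \<phi> (x - h *\<^sub>R ?e)" "h *\<^sub>R ?e"] by simp
    moreover have "(\<integral>x. Q f h x * \<phi> x \<partial>lborel) = (\<integral>x. (f (x + h *\<^sub>R ?e) * \<phi> x - f x * \<phi> x) / h \<partial>lborel)"
      by (rule Bochner_Integration.integral_cong) (auto simp: Q_def left_diff_distrib)
    moreover have "(\<integral>x. f x * ((\<phi> (x - h *\<^sub>R ?e) - \<phi> x) / h) \<partial>lborel)
        = (\<integral>x. (f x * \<phi> (x - h *\<^sub>R ?e) - f x * \<phi> x) / h \<partial>lborel)"
      by (rule Bochner_Integration.integral_cong) (auto simp: right_diff_distrib)
    ultimately show ?thesis
      using int\<phi>[OF f, of "h *\<^sub>R ?e"] int\<phi>0[OF f] int\<phi>0[OF shift[OF f]] by auto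
  qed
  have "(\<lambda>n. (\<integral>x. Q f (k n) x * \<phi> x \<partial>lborel) - (\<integral>x. \<gamma> x * \<phi> x \<partial>lborel)) \<longlonglongrightarrow> 0"
  proof (rule Lim_null_comparison)
    show "(\<lambda>n. (\<integral>x. Z n x \<partial>lborel) * C) \<longlonglongrightarrow> 0"
      using tendsto_mult_right[OF Z_lim, of C] by simp
    have "norm ((\<integral>x. Q f (k n) x * \<phi> x \<partial>lborel) - (\<integral>x. \<gamma> x * \<phi> x \<partial>lborel)) \<le> (\<integral>x. Z n x \<partial>lborel) * C" for n
    proof -
      have i: "integrable lborel (\<lambda>x. Q f (k n) x * \<phi> x - \<gamma> x * \<phi> x)"
        using int\<phi>0[OF Q[OF f]] int\<phi>0[OF \<gamma>] by simp
      have "(\<integral>x. Q f (k n) x * \<phi> x \<partial>lborel) - (\<integral>x. \<gamma> x * \<phi> x \<partial>lborel)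
          = (\<integral>x. Q f (k n) x * \<phi> x - \<gamma> x * \<phi> x \<partial>lborel)"
        using int\<phi>0[OF Q[OF f]] int\<phi>0[OF \<gamma>] by simp
      also have "\<bar>\<dots>\<bar> \<le> (\<integral>x. \<bar>Q f (k n) x * \<phi> x - \<gamma> x * \<phi> x\<bar> \<partial>lborel)" by (rule integral_abs_bound)
      also have "\<dots> \<le> (\<integral>x. Z n x * C \<partial>lborel)"
      proof (rule integral_mono)
        show "integrable lborel (\<lambda>x. Z n x * C)"
          unfolding Z_def using Q f \<gamma> by (intro integrable_mult_left ind) auto
        fix x
        have "\<bar>Q f (k n) x * \<phi> x - \<gamma> x * \<phi> x\<bar> = \<bar>Q f (k n) x - \<gamma> x\<bar> * \<bar>\<phi> x\<bar>"
          by (simp add: left_diff_distrib[symmetric] abs_mult)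
        also have "\<dots> \<le> Z n x * C"
        proof (cases "x \<in> V")
          case False
          then have "\<phi> x = 0"
            using \<phi> test_function_outside(1)[of x \<phi>] by (auto simp: test_function_def)
          then show ?thesis using False by (simp add: Z_def)
        qed (use C in \<open>auto simp: Z_def intro!: mult_left_mono\<close>)
        finally show "\<bar>Q f (k n) x * \<phi> x - \<gamma> x * \<phi> x\<bar> \<le> Z n x * C" .
      qed (use i in auto)
      finally show ?thesis by simp
    qed
    then show "\<forall>\<^sub>F n in sequentially. norm ((\<integral>x. Q f (k n) x * \<phi> x \<partial>lborel) - (\<integral>x. \<gamma> x * \<phi> x \<partial>lborel))
        \<le> (\<integral>x. Z n x \<partial>lborel) * C" by simp
  qed
  then have "(\<lambda>n. \<integral>x. Q f (k n) x * \<phi> x \<partial>lborel) \<longlonglongrightarrow> (\<integral>x. \<gamma> x * \<phi> x \<partial>lborel)"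
    by (simp add: LIM_zero_iff)
  moreover have "(\<lambda>n. \<integral>x. Q f (k n) x * \<phi> x \<partial>lborel) \<longlonglongrightarrow> - (\<integral>x. f x * pderivative i \<phi> x \<partial>lborel)"
    unfolding by_parts by (rule test_function_quotient_tendsto[OF \<phi> f k(1,3)])
  ultimately show ?thesis using LIMSEQ_unique by force
qed

section \<open>Localisation, uniqueness of weak gradients and the chain rule on the domain\<close>

lemma AE_lebesgue_on_iff:
  assumes "\<Omega> \<in> sets lebesgue"
  shows "(AE x in lebesgue_on \<Omega>. P x) \<longleftrightarrow> (AE x in lborel. x \<in> \<Omega> \<longrightarrow> P x)"
  using assms by (simp add: AE_restrict_space_iff AE_completion_iff)

text \<open>A function measurable for the completed measure agrees almost everywhere with a Borel
  function, and Borel functions are what the translation and product measure lemmas require.\<close>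

lemma ex_borel_representative:
  fixes v :: "'a::euclidean_space \<Rightarrow> real"
  assumes "compact K" "integrable (lebesgue_on K) v"
  shows "\<exists>u. integrable lborel u \<and> (AE x in lborel. u x = indicator K x * v x)"
proof -
  have K: "K \<in> sets lebesgue" using assms(1) by (auto dest: compact_imp_closed)
  have i: "integrable lebesgue (\<lambda>x. indicator K x * v x)"
    using assms(2) integrable_restrict_space[of K lebesgue v] K by simp
  then have "(\<lambda>x. indicator K x * v x) \<in> borel_measurable lebesgue" by auto
  then obtain u where u: "u \<in> borel_measurable lborel" "AE x in lborel. indicator K x * v x = u x"
    using completion_ex_borel_measurable_real by blast
  have "AE x in lebesgue. indicator K x * v x = u x" using u(2) by (rule AE_completion)
  then have "integrable lebesgue u"
    using integrable_cong_AE_imp[OF i measurable_completion[OF u(1)]] by (simp add: eq_commute)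
  then have "integrable lborel u" using integrable_completion[OF u(1)] by simp
  then show ?thesis using u(2) by (auto simp: eq_commute)
qed

lemma integral_borel_representative:
  fixes v u \<phi> :: "'a::euclidean_space \<Rightarrow> real"
  assumes K: "compact K" "K \<subseteq> \<Omega>" and \<Omega>: "\<Omega> \<in> sets lebesgue"
    and v: "integrable (lebesgue_on K) v"
    and u: "integrable lborel u" "AE x in lborel. u x = indicator K x * v x"
    and \<phi>: "\<phi> \<in> borel_measurable borel" "\<And>x. x \<notin> K \<Longrightarrow> \<phi> x = 0"
  shows "(\<integral>x. v x * \<phi> x \<partial>lebesgue_on \<Omega>) = (\<integral>x. u x * \<phi> x \<partial>lborel)"
proof -
  have Ks: "K \<in> sets lebesgue" using K(1) by (auto dest: compact_imp_closed)
  have "integrable lebesgue (\<lambda>x. indicator K x * v x)"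
    using v integrable_restrict_space[of K lebesgue v] Ks by simp
  then have m: "(\<lambda>x. indicator K x * v x) \<in> borel_measurable lebesgue" by auto
  have \<phi>l: "\<phi> \<in> borel_measurable lebesgue" using \<phi>(1) by (intro measurable_completion) simp
  have ub: "u \<in> borel_measurable lborel" using u(1) by auto
  have "(\<integral>x. v x * \<phi> x \<partial>lebesgue_on \<Omega>) = (\<integral>x. indicator \<Omega> x * (v x * \<phi> x) \<partial>lebesgue)"
    using integral_restrict_space[of \<Omega> lebesgue "\<lambda>x. v x * \<phi> x"] \<Omega> by simp
  also have "\<dots> = (\<integral>x. (indicator K x * v x) * \<phi> x \<partial>lebesgue)"
    using K(2) \<phi>(2) by (intro Bochner_Integration.integral_cong) (auto simp: indicator_def)
  also have "\<dots> = (\<integral>x. u x * \<phi> x \<partial>lebesgue)"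
  proof (rule integral_cong_AE)
    show "AE x in lebesgue. indicator K x * v x * \<phi> x = u x * \<phi> x"
      using AE_completion[OF u(2)] by eventually_elim simp
    show "(\<lambda>x. u x * \<phi> x) \<in> borel_measurable lebesgue"
      using measurable_completion[OF ub] \<phi>l by (rule borel_measurable_times)
    show "(\<lambda>x. indicator K x * v x * \<phi> x) \<in> borel_measurable lebesgue"
      using m \<phi>l by (rule borel_measurable_times)
  qed
  also have "\<dots> = (\<integral>x. u x * \<phi> x \<partial>lborel)"
    using ub \<phi>(1) by (intro integral_completion) auto
  finally show ?thesis .
qed

lemma locally_integrable_component:
  "locally_integrable \<Omega> (G :: real^'n \<Rightarrow> real^'n) \<Longrightarrow> locally_integrable \<Omega> (\<lambda>x. G x $ i)"
  unfolding locally_integrable_def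
  by (auto intro: integrable_bounded_linear[OF bounded_linear_vec_nth])

text \<open>Cutting off to the compact \<open>K\<close> turns local integrability into global
  integrability. Test functions supported in \<open>U\<close> vanish outside \<open>K\<close>, so
  their integrals do not see the cut.\<close>

lemma weak_gradient_localize:
  fixes v :: "real^'n \<Rightarrow> real"
  assumes vG: "has_weak_gradient \<Omega> v G" and \<Omega>: "open \<Omega>"
    and K: "compact K" "K \<subseteq> \<Omega>" and U: "U \<subseteq> K"
  obtains u g where "integrable lborel u" "integrable lborel g"
    "AE x in lborel. x \<in> K \<longrightarrow> u x = v x \<and> g x = G x $ i" "has_weak_pderivative U i u g"
proof -
  have \<Omega>s: "\<Omega> \<in> sets lebesgue" using \<Omega> by auto
  have v: "integrable (lebesgue_on K) v" and G: "integrable (lebesgue_on K) (\<lambda>x. G x $ i)"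
    using vG K locally_integrable_component[of \<Omega> G i]
    unfolding has_weak_gradient_def locally_integrable_def by auto
  obtain u where u: "integrable lborel u" "AE x in lborel. u x = indicator K x * v x"
    using ex_borel_representative[OF K(1) v] by blast
  obtain g where g: "integrable lborel g" "AE x in lborel. g x = indicator K x * (G x $ i)"
    using ex_borel_representative[OF K(1) G] by blast
  have "has_weak_pderivative U i u g"
    unfolding has_weak_pderivative_def
  proof (intro allI impI)
    fix \<phi> assume \<phi>: "test_function U \<phi>"
    then have supp: "closure {x. \<phi> x \<noteq> 0} \<subseteq> K" using U by (auto simp: test_function_def)
    have "test_function \<Omega> \<phi>" using \<phi> U K(2) by (auto simp: test_function_def)
    then have "(\<integral>x. v x * pderivative i \<phi> x \<partial>lebesgue_on \<Omega>) = - (\<integral>x. G x $ i * \<phi> x \<partial>lebesgue_on \<Omega>)"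
      using vG unfolding has_weak_gradient_def by blast
    moreover have "(\<integral>x. v x * pderivative i \<phi> x \<partial>lebesgue_on \<Omega>) = (\<integral>x. u x * pderivative i \<phi> x \<partial>lborel)"
      using borel_measurable_test_function(2)[OF \<phi>] test_function_outside(2) supp
      by (intro integral_borel_representative[OF K \<Omega>s v u]) blast+
    moreover have "(\<integral>x. G x $ i * \<phi> x \<partial>lebesgue_on \<Omega>) = (\<integral>x. g x * \<phi> x \<partial>lborel)"
      using borel_measurable_test_function(1)[OF \<phi>] test_function_outside(1) supp
      by (intro integral_borel_representative[OF K \<Omega>s G g]) blast+
    ultimately show "(\<integral>x. u x * pderivative i \<phi> x \<partial>lborel) = - (\<integral>x. g x * \<phi> x \<partial>lborel)" by simp
  qed
  moreover have "AE x in lborel. x \<in> K \<longrightarrow> u x = v x \<and> g x = G x $ i"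
    using u(2) g(2) by eventually_elim simp
  ultimately show ?thesis using u(1) g(1) that by blast
qed

text \<open>On each box the two representatives of \<open>v\<close> agree almost everywhere, so the
  localised derivatives have equal integrals against every test function and the fundamental lemma
  applies to each component.\<close>

lemma weak_gradient_unique_AE:
  fixes v :: "real^'n \<Rightarrow> real"
  assumes G: "has_weak_gradient \<Omega> v G" and G': "has_weak_gradient \<Omega> v G'" and \<Omega>: "open \<Omega>"
  shows "AE x in lebesgue_on \<Omega>. G x = G' x"
proof -
  have "AE x in lborel. x \<in> \<Omega> \<longrightarrow> G x = G' x"
  proof (rule AE_open_of_boxes[OF \<Omega>])
    fix a b :: "real^'n" assume ab: "cbox a b \<subseteq> \<Omega>"
    have "AE x in lborel. x \<in> box a b \<longrightarrow> G x $ i = G' x $ i" for i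
    proof -
      obtain u g where g: "integrable lborel u" "integrable lborel g"
        "AE x in lborel. x \<in> cbox a b \<longrightarrow> u x = v x \<and> g x = G x $ i"
        "has_weak_pderivative (box a b) i u g"
        by (rule weak_gradient_localize[OF G \<Omega> compact_cbox ab box_subset_cbox])
      obtain u' g' where g': "integrable lborel u'" "integrable lborel g'"
        "AE x in lborel. x \<in> cbox a b \<longrightarrow> u' x = v x \<and> g' x = G' x $ i"
        "has_weak_pderivative (box a b) i u' g'"
        by (rule weak_gradient_localize[OF G' \<Omega> compact_cbox ab box_subset_cbox])
      have "AE x in lborel. x \<in> box a b \<longrightarrow> g x - g' x = 0"
      proof (rule AE_zero_of_test_functions)
        fix \<psi> assume \<psi>: "test_function (box a b) \<psi>"
        note [measurable] = borel_measurable_test_function[OF \<psi>]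
          borel_measurable_integrable[OF g(1), simplified] borel_measurable_integrable[OF g'(1), simplified]
        have "(\<integral>x. u x * pderivative i \<psi> x \<partial>lborel) = (\<integral>x. u' x * pderivative i \<psi> x \<partial>lborel)"
        proof (rule integral_cong_AE)
          show "AE x in lborel. u x * pderivative i \<psi> x = u' x * pderivative i \<psi> x"
            using g(3) g'(3)
          proof eventually_elim
            case (elim x)
            show ?case
            proof (cases "x \<in> cbox a b")
              case False
              then have "x \<notin> closure {x. \<psi> x \<noteq> 0}"
                using \<psi> box_subset_cbox[of a b] by (auto simp: test_function_def)
              then show ?thesis by (simp add: test_function_outside(2))
            qed (use elim in simp)
          qed
        qed measurable
        then have "(\<integral>x. g x * \<psi> x \<partial>lborel) = (\<integral>x. g' x * \<psi> x \<partial>lborel)"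
          using g(4) g'(4) \<psi> unfolding has_weak_pderivative_def by auto
        then show "(\<integral>x. (g x - g' x) * \<psi> x \<partial>lborel) = 0"
          using integrable_test_function(1)[OF \<psi> g(2)] integrable_test_function(1)[OF \<psi> g'(2)]
          by (simp add: left_diff_distrib)
      qed (use g g' in auto)
      then show ?thesis
        using g(3) g'(3) by eventually_elim (use box_subset_cbox[of a b] in auto)
    qed
    then have "AE x in lborel. \<forall>i\<in>UNIV. x \<in> box a b \<longrightarrow> G x $ i = G' x $ i"
      by (intro AE_finite_allI) auto
    then show "AE x in lborel. x \<in> box a b \<longrightarrow> G x = G' x"
      by eventually_elim (simp add: vec_eq_iff)
  qed
  then show ?thesis using \<Omega> by (subst AE_lebesgue_on_iff) auto
qed

lemma compact_neighbourhoods: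
  fixes C :: "'a::euclidean_space set"
  assumes "compact C" "open \<Omega>" "C \<subseteq> \<Omega>"
  obtains V U K \<delta> where "open V" "C \<subseteq> V" "U \<subseteq> K" "compact K" "K \<subseteq> \<Omega>" "0 < \<delta>"
    "\<And>x y. x \<in> V \<Longrightarrow> norm y \<le> \<delta> \<Longrightarrow> x + y \<in> U"
proof -
  have "closed (- \<Omega>)" "C \<inter> - \<Omega> = {}" using assms by auto
  then obtain d where d: "d > 0" "\<And>x y. x \<in> C \<Longrightarrow> y \<notin> \<Omega> \<Longrightarrow> d \<le> dist x y"
    using separate_compact_closed[OF assms(1)] by (metis ComplI)
  \<comment> \<open>A third of the distance: \<open>V\<close> is the
    \<open>\<delta>\<close>-neighbourhood of \<open>C\<close>, a further step of length
    \<open>\<delta>\<close> stays within \<open>2 * \<delta>\<close>, and this is still less than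
    \<open>d\<close>.\<close>
  define \<delta> where "\<delta> = d / 3"
  define V where "V = (\<Union>x\<in>C. ball x \<delta>)"
  define K where "K = {x + y | x y. x \<in> C \<and> y \<in> cball 0 (2 * \<delta>)}"
  have \<delta>: "0 < \<delta>" using d by (simp add: \<delta>_def)
  have "compact K" unfolding K_def by (rule compact_sums[OF assms(1) compact_cball])
  moreover have "K \<subseteq> \<Omega>"
  proof
    fix z assume "z \<in> K"
    then obtain x y where "z = x + y" "x \<in> C" "norm y \<le> 2 * \<delta>" by (auto simp: K_def)
    then have "dist x z < d" "x \<in> C" using d(1) by (auto simp: \<delta>_def dist_norm)
    then show "z \<in> \<Omega>" using d(2) by (meson not_less)
  qed
  moreover have "open V" "C \<subseteq> V" using \<delta> by (auto simp: V_def)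
  moreover have "x + y \<in> K" if "x \<in> V" "norm y \<le> \<delta>" for x y
  proof -
    obtain c where c: "c \<in> C" "dist c x < \<delta>" using \<open>x \<in> V\<close> by (auto simp: V_def)
    have "norm ((x - c) + y) \<le> norm (x - c) + norm y" by (rule norm_triangle_ineq)
    also have "\<dots> \<le> 2 * \<delta>" using c(2) that(2) by (simp add: dist_norm norm_minus_commute)
    finally have "(x - c) + y \<in> cball 0 (2 * \<delta>)" by simp
    moreover have "x + y = c + ((x - c) + y)" by simp
    ultimately show ?thesis unfolding K_def using c(1) by blast
  qed
  \<comment> \<open>The compact set serves as both \<open>U\<close> and \<open>K\<close>.\<close>
  ultimately show ?thesis using \<delta> that[of V K K \<delta>] by blast
qed

text \<open>The integral identity concerns one test function and one coordinate at a time, so it can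
  be checked near the support, where a margin \<open>\<delta>\<close> leaves room for difference
  quotients.\<close>

lemma has_weak_gradient_chain:
  fixes v\<^sub>1 v\<^sub>2 f :: "real^'n \<Rightarrow> real" and F :: "real \<times> real \<Rightarrow> real"
  assumes \<Omega>: "open \<Omega>" and v1: "has_weak_gradient \<Omega> v\<^sub>1 G\<^sub>1" and v2: "has_weak_gradient \<Omega> v\<^sub>2 G\<^sub>2"
    and f: "locally_integrable \<Omega> f" and G: "locally_integrable \<Omega> G"
    and Lip: "L-lipschitz_on S F" and B: "0 \<le> B"
    and AE: "AE x in lebesgue_on \<Omega>. (v\<^sub>1 x, v\<^sub>2 x) \<in> S \<and> f x = F (v\<^sub>1 x, v\<^sub>2 x) \<and>
      (\<exists>D. (F has_derivative D) (at (v\<^sub>1 x, v\<^sub>2 x) within S) \<and>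
        (\<forall>i. G x $ i = D (G\<^sub>1 x $ i, G\<^sub>2 x $ i) \<and> \<bar>G x $ i\<bar> \<le> B * (\<bar>G\<^sub>1 x $ i\<bar> + \<bar>G\<^sub>2 x $ i\<bar>)))"
  shows "has_weak_gradient \<Omega> f G"
proof -
  have \<Omega>s: "\<Omega> \<in> sets lebesgue" using \<Omega> by auto
  have "(\<integral>x. f x * pderivative i \<phi> x \<partial>lebesgue_on \<Omega>) = - (\<integral>x. G x $ i * \<phi> x \<partial>lebesgue_on \<Omega>)"
    if \<phi>: "test_function \<Omega> \<phi>" for \<phi> i
  proof -
    have C: "compact (closure {x. \<phi> x \<noteq> 0})" "closure {x. \<phi> x \<noteq> 0} \<subseteq> \<Omega>"
      using \<phi> by (auto simp: test_function_def)
    obtain V U K \<delta> where VUK: "open V" "closure {x. \<phi> x \<noteq> 0} \<subseteq> V" "U \<subseteq> K" "compact K" "K \<subseteq> \<Omega>" "0 < \<delta>"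
      "\<And>x y. x \<in> V \<Longrightarrow> norm y \<le> \<delta> \<Longrightarrow> x + y \<in> U"
      using compact_neighbourhoods[OF C(1) \<Omega> C(2)] by blast
    have VU: "x + t *\<^sub>R axis i 1 \<in> U" if "x \<in> V" "0 \<le> t" "t \<le> \<delta>" for x t
      using that by (intro VUK(7)) (auto simp: norm_axis_1)
    have "V \<subseteq> U" using VUK(7)[of _ 0] VUK(6) by auto
    then have supp: "closure {x. \<phi> x \<noteq> 0} \<subseteq> K" using VUK(2,3) by blast
    have \<phi>V: "test_function V \<phi>" using \<phi> VUK(2) by (simp add: test_function_def)
    obtain u1 g1 where u1: "integrable lborel u1" "integrable lborel g1"
      "AE x in lborel. x \<in> K \<longrightarrow> u1 x = v\<^sub>1 x \<and> g1 x = G\<^sub>1 x $ i" "has_weak_pderivative U i u1 g1"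
      by (rule weak_gradient_localize[OF v1 \<Omega> VUK(4,5,3)])
    obtain u2 g2 where u2: "integrable lborel u2" "integrable lborel g2"
      "AE x in lborel. x \<in> K \<longrightarrow> u2 x = v\<^sub>2 x \<and> g2 x = G\<^sub>2 x $ i" "has_weak_pderivative U i u2 g2"
      by (rule weak_gradient_localize[OF v2 \<Omega> VUK(4,5,3)])
    have fK: "integrable (lebesgue_on K) f" and GK: "integrable (lebesgue_on K) (\<lambda>x. G x $ i)"
      using f locally_integrable_component[OF G, of i] VUK(4,5) unfolding locally_integrable_def by auto
    obtain fb where fb: "integrable lborel fb" "AE x in lborel. fb x = indicator K x * f x"
      using ex_borel_representative[OF VUK(4) fK] by blast
    obtain gb where gb: "integrable lborel gb" "AE x in lborel. gb x = indicator K x * (G x $ i)"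
      using ex_borel_representative[OF VUK(4) GK] by blast
    have "(\<integral>x. fb x * pderivative i \<phi> x \<partial>lborel) = - (\<integral>x. gb x * \<phi> x \<partial>lborel)"
    proof (rule weak_pderivative_chain[OF u1(1,2,4) u2(1,2,4) fb(1) gb(1) Lip B _ VUK(1,6) VU \<phi>V])
      have "AE x in lborel. x \<in> \<Omega> \<longrightarrow> (v\<^sub>1 x, v\<^sub>2 x) \<in> S \<and> f x = F (v\<^sub>1 x, v\<^sub>2 x) \<and>
        (\<exists>D. (F has_derivative D) (at (v\<^sub>1 x, v\<^sub>2 x) within S) \<and>
          (\<forall>i. G x $ i = D (G\<^sub>1 x $ i, G\<^sub>2 x $ i) \<and> \<bar>G x $ i\<bar> \<le> B * (\<bar>G\<^sub>1 x $ i\<bar> + \<bar>G\<^sub>2 x $ i\<bar>)))"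
        using AE by (simp only: AE_lebesgue_on_iff[OF \<Omega>s])
      then show "AE x in lborel. x \<in> U \<longrightarrow> (u1 x, u2 x) \<in> S \<and> fb x = F (u1 x, u2 x) \<and>
        \<bar>gb x\<bar> \<le> B * (\<bar>g1 x\<bar> + \<bar>g2 x\<bar>) \<and>
        (\<exists>D. (F has_derivative D) (at (u1 x, u2 x) within S) \<and> gb x = D (g1 x, g2 x))"
        using u1(3) u2(3) fb(2) gb(2)
      proof eventually_elim
        case (elim x)
        show ?case
        proof
          assume "x \<in> U"
          then have "x \<in> K" "x \<in> \<Omega>" using VUK by auto
          with elim show "(u1 x, u2 x) \<in> S \<and> fb x = F (u1 x, u2 x) \<and>
            \<bar>gb x\<bar> \<le> B * (\<bar>g1 x\<bar> + \<bar>g2 x\<bar>) \<and>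
            (\<exists>D. (F has_derivative D) (at (u1 x, u2 x) within S) \<and> gb x = D (g1 x, g2 x))"
            by auto
        qed
      qed
    qed
    moreover have "(\<integral>x. f x * pderivative i \<phi> x \<partial>lebesgue_on \<Omega>) = (\<integral>x. fb x * pderivative i \<phi> x \<partial>lborel)"
      using borel_measurable_test_function(2)[OF \<phi>] test_function_outside(2) supp
      by (intro integral_borel_representative[OF VUK(4,5) \<Omega>s fK fb]) blast+
    moreover have "(\<integral>x. G x $ i * \<phi> x \<partial>lebesgue_on \<Omega>) = (\<integral>x. gb x * \<phi> x \<partial>lborel)"
      using borel_measurable_test_function(1)[OF \<phi>] test_function_outside(1) supp
      by (intro integral_borel_representative[OF VUK(4,5) \<Omega>s GK gb]) blast+
    ultimately show ?thesis by simp
  qed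
  then show ?thesis using f G by (simp add: has_weak_gradient_def)
qed

section \<open>Pointwise inequalities\<close>

text \<open>Weighted arithmetic-geometric mean inequality for \<open>\<tau> powr r\<close> and
  \<open>\<sigma> powr r\<close> with weights \<open>(r - 1) / r\<close> and \<open>1 / r\<close>.
  In this form \<open>r = 1\<close> is the harmless case of a zero weight instead of an infinite
  conjugate exponent.\<close>

lemma powr_Young:
  fixes \<tau> \<sigma> r :: real
  assumes "1 \<le> r" "0 < \<tau>" "0 \<le> \<sigma>"
  shows "r * (\<tau> powr (r - 1) * \<sigma>) \<le> (r - 1) * \<tau> powr r + \<sigma> powr r"
proof (cases "\<sigma> = 0")
  case False
  have "(\<tau> powr r) powr ((r - 1) / r) * (\<sigma> powr r) powr (1 / r)
      \<le> (r - 1) / r * \<tau> powr r + 1 / r * \<sigma> powr r"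
    using assms False by (intro Youngs_inequality_0) (auto simp: field_simps)
  moreover have "(\<tau> powr r) powr ((r - 1) / r) = \<tau> powr (r - 1)" "(\<sigma> powr r) powr (1 / r) = \<sigma>"
    using assms by (auto simp: powr_powr)
  ultimately have "\<tau> powr (r - 1) * \<sigma> \<le> ((r - 1) * \<tau> powr r + \<sigma> powr r) / r"
    by (simp add: add_divide_distrib)
  then have "r * (\<tau> powr (r - 1) * \<sigma>) \<le> r * (((r - 1) * \<tau> powr r + \<sigma> powr r) / r)"
    using assms(1) by (intro mult_left_mono) auto
  then show ?thesis using assms(1) by simp
qed (use assms in simp)

lemma avec_inner_lower_bound:
  fixes \<xi> \<eta> :: "real^'n"
  assumes r: "1 \<le> r" and t: "0 < t" and \<xi>: "\<xi> \<noteq> 0" and pos: "0 < \<Psi> x (norm \<xi>)"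
  shows "Phi \<Psi> x (norm \<xi>) / norm \<xi> powr (r - 1) * (norm \<xi> powr r - norm \<eta> powr r)
    \<le> avec \<Psi> x \<xi> \<bullet> ((1 + (r - 1) * t powr r) *\<^sub>R \<xi> - (r * t powr (r - 1)) *\<^sub>R \<eta>)"
proof -
  define s \<sigma> where "s = norm \<xi>" and "\<sigma> = norm \<eta>"
  have s: "0 < s" and \<sigma>: "0 \<le> \<sigma>" using \<xi> by (auto simp: s_def \<sigma>_def)
  \<comment> \<open>The value at \<open>s\<close> of the quotient that the theorem assumes monotone;
    it is positive and factors out of the whole estimate.\<close>
  define q where "q = \<Psi> x s * s / s powr (r - 1)"
  have q: "0 < q" using pos s by (simp add: q_def s_def)
  have \<Psi>: "\<Psi> x s * s = q * s powr (r - 1)" using s by (simp add: q_def)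
  have sr: "s powr (r - 1) * s = s powr r" using s by (simp add: powr_diff)
  \<comment> \<open>Young's inequality with \<open>\<tau> = t * s\<close>, which brings in the ratio
    with the powers \<open>r\<close> and \<open>r - 1\<close> found in the gradient.\<close>
  have "q * (s powr r - \<sigma> powr r) \<le> q * (s powr r + ((r - 1) * (t * s) powr r - r * ((t * s) powr (r - 1) * \<sigma>)))"
    using q powr_Young[OF r, of "t * s" \<sigma>] s t \<sigma> by (intro mult_left_mono) auto
  also have "\<dots> = q * (s powr (r - 1) * ((1 + (r - 1) * t powr r) * s - r * t powr (r - 1) * \<sigma>))"
  proof -
    have "(t * s) powr r = t powr r * (s powr (r - 1) * s)" "(t * s) powr (r - 1) = t powr (r - 1) * s powr (r - 1)"
      using s t by (auto simp: powr_mult sr)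
    then show ?thesis by (simp only: sr[symmetric]) (simp add: algebra_simps)
  qed
  also have "\<dots> = \<Psi> x s * ((1 + (r - 1) * t powr r) * s\<^sup>2 - r * t powr (r - 1) * (s * \<sigma>))"
    unfolding mult.assoc[symmetric] \<Psi>[symmetric] by (simp add: algebra_simps power2_eq_square)
  \<comment> \<open>The mixed term has a minus sign, so replacing the product of the norms by the
    smaller inner product increases the right-hand side.\<close>
  also have "\<dots> \<le> \<Psi> x s * ((1 + (r - 1) * t powr r) * s\<^sup>2 - r * t powr (r - 1) * (\<xi> \<bullet> \<eta>))"
    using pos r norm_cauchy_schwarz[of \<xi> \<eta>]
    by (intro mult_left_mono diff_left_mono) (auto simp: s_def \<sigma>_def)
  also have "\<dots> = avec \<Psi> x \<xi> \<bullet> ((1 + (r - 1) * t powr r) *\<^sub>R \<xi> - (r * t powr (r - 1)) *\<^sub>R \<eta>)"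
    using \<xi> by (simp add: avec_def s_def inner_diff_right power2_norm_eq_inner algebra_simps)
  finally show ?thesis
    using s by (simp add: q_def Phi_def s_def \<sigma>_def)
qed

lemma avec_picone_pointwise:
  fixes \<xi> \<eta> :: "real^'n"
  assumes r: "1 \<le> r" and a: "0 < a" and b: "0 < b" and pos: "\<And>s. 0 < s \<Longrightarrow> 0 < \<Psi> x s"
    and mono: "mono_on {0<..} (\<lambda>s. Phi \<Psi> x s / s powr (r - 1))"
  shows "0 \<le> avec \<Psi> x \<xi> \<bullet> ((1 + (r - 1) * (b / a) powr r) *\<^sub>R \<xi> - (r * (b / a) powr (r - 1)) *\<^sub>R \<eta>)
           + avec \<Psi> x \<eta> \<bullet> ((1 + (r - 1) * (a / b) powr r) *\<^sub>R \<eta> - (r * (a / b) powr (r - 1)) *\<^sub>R \<xi>)"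
proof -
  have self: "0 \<le> avec \<Psi> x \<zeta> \<bullet> (1 + (r - 1) * c powr r) *\<^sub>R \<zeta>" for \<zeta> :: "real^'n" and c
    using r pos[of "norm \<zeta>"] by (auto simp: avec_def)
  show ?thesis
  \<comment> \<open>The lower bound divides by a power of the norm. If one vector is zero, its own
    summand and the mixed term of the other one vanish, and only a nonnegative multiple of a squared
    norm can remain.\<close>
  proof (cases "\<xi> = 0 \<or> \<eta> = 0")
    case True
    then show ?thesis using self[of \<eta> "a / b"] self[of \<xi> "b / a"]
      by (auto simp: avec_def mult.left_commute)
  next
    case False
    let ?\<phi> = "\<lambda>s. Phi \<Psi> x s / s powr (r - 1)"
    \<comment> \<open>Both the quotient and \<open>s powr r\<close> are nondecreasing, so the two
      differences never have opposite signs.\<close>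
    have *: "0 \<le> (?\<phi> s - ?\<phi> \<sigma>) * (s powr r - \<sigma> powr r)" if "0 < s" "0 < \<sigma>" for s \<sigma>
    proof (cases "s \<le> \<sigma>")
      case True
      then show ?thesis
        using that r mono_onD[OF mono, of s \<sigma>] by (intro mult_nonpos_nonpos) (auto intro: powr_mono2)
    next
      case False
      then show ?thesis
        using that r mono_onD[OF mono, of \<sigma> s] by (intro mult_nonneg_nonneg) (auto intro: powr_mono2)
    qed
    have "0 \<le> ?\<phi> (norm \<xi>) * (norm \<xi> powr r - norm \<eta> powr r) + ?\<phi> (norm \<eta>) * (norm \<eta> powr r - norm \<xi> powr r)"
    proof -
      have "X * (c - d) + Y * (d - c) = (X - Y) * (c - d)" for X Y c d :: real
        by (simp add: algebra_simps)
      moreover have "0 < norm \<xi>" "0 < norm \<eta>" using False by auto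
      ultimately show ?thesis using * by (simp only:)
    qed
    also have "\<dots> \<le> avec \<Psi> x \<xi> \<bullet> ((1 + (r - 1) * (b / a) powr r) *\<^sub>R \<xi> - (r * (b / a) powr (r - 1)) *\<^sub>R \<eta>)
           + avec \<Psi> x \<eta> \<bullet> ((1 + (r - 1) * (a / b) powr r) *\<^sub>R \<eta> - (r * (a / b) powr (r - 1)) *\<^sub>R \<xi>)"
      using False a b by (intro add_mono avec_inner_lower_bound r pos) auto
    finally show ?thesis .
  qed
qed

text \<open>The function is homogeneous of degree one, so the coefficients of its derivative depend
  on \<open>b / a\<close> only. For the computation the denominator is written as the factor
  \<open>fst z powr (1 - r)\<close>, to which the product rule applies.\<close>

lemma picone_quotient_has_derivative:
  fixes a b r :: real
  assumes "0 < a" "0 < b" "(a, b) \<in> S"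
  shows "((\<lambda>z. fst z - snd z powr r / fst z powr (r - 1)) has_derivative
    (\<lambda>h. (1 + (r - 1) * (b / a) powr r) * fst h - (r * (b / a) powr (r - 1)) * snd h)) (at (a, b) within S)"
proof -
  have "((\<lambda>z. fst z - snd z powr r * fst z powr (1 - r)) has_derivative
      (\<lambda>h. fst h - (b powr r * (a powr (1 - r) * (0 * ln a + fst h * (1 - r) / a))
        + b powr r * (0 * ln b + snd h * r / b) * a powr (1 - r)))) (at (a, b) within S)"
    using assms by (auto intro!: derivative_eq_intros)
  moreover have "(\<lambda>h. fst h - (b powr r * (a powr (1 - r) * (0 * ln a + fst h * (1 - r) / a))
        + b powr r * (0 * ln b + snd h * r / b) * a powr (1 - r))) =
      (\<lambda>h. (1 + (r - 1) * (b / a) powr r) * fst h - (r * (b / a) powr (r - 1)) * snd h)"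
    using assms by (intro ext) (simp add: powr_diff powr_divide field_simps)
  moreover have "(\<lambda>z::real \<times> real. snd z powr r * fst z powr (1 - r)) = (\<lambda>z. snd z powr r / fst z powr (r - 1))"
    by (rule ext) (metis minus_diff_eq powr_minus_divide times_divide_eq_right mult.right_neutral)
  then have "(\<lambda>z::real \<times> real. fst z - snd z powr r * fst z powr (1 - r)) = (\<lambda>z. fst z - snd z powr r / fst z powr (r - 1))"
    by (simp add: fun_eq_iff)
  ultimately show ?thesis by simp
qed

text \<open>An upper bound on the second coordinate relative to the first bounds the derivative of
  the quotient; exchanging the two functions handles the other quotient. As an intersection of half
  planes the set is convex, which the mean value inequality requires.\<close>

definition ratio_cone :: "real \<Rightarrow> (real \<times> real) set" where
  "ratio_cone C = {z. 0 < fst z \<and> 0 < snd z \<and> snd z \<le> C * fst z}"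

lemma convex_ratio_cone: "convex (ratio_cone C)"
proof (rule convexI)
  fix z w :: "real \<times> real" and u v :: real
  assume zw: "z \<in> ratio_cone C" "w \<in> ratio_cone C" and uv: "0 \<le> u" "0 \<le> v" "u + v = 1"
  have "u > 0 \<or> v > 0" using uv by linarith
  then have pos: "0 < u * s + v * t" if "0 < s" "0 < t" for s t :: real
    using that uv by (auto intro: add_pos_nonneg add_nonneg_pos)
  have "u * snd z + v * snd w \<le> u * (C * fst z) + v * (C * fst w)"
    using zw uv by (intro add_mono mult_left_mono) (auto simp: ratio_cone_def)
  moreover have "0 < u * fst z + v * fst w" "0 < u * snd z + v * snd w"
    using zw by (auto simp: ratio_cone_def intro!: pos)
  ultimately show "u *\<^sub>R z + v *\<^sub>R w \<in> ratio_cone C"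
    by (simp add: ratio_cone_def distrib_left mult.left_commute)
qed

lemma picone_quotient_lipschitz:
  fixes r C :: real
  assumes r: "1 \<le> r" and C: "0 \<le> C"
  shows "\<exists>L. L-lipschitz_on (ratio_cone C) (\<lambda>z. fst z - snd z powr r / fst z powr (r - 1))"
proof -
  let ?D = "\<lambda>z h :: real \<times> real. (1 + (r - 1) * (snd z / fst z) powr r) * fst h - (r * (snd z / fst z) powr (r - 1)) * snd h"
  \<comment> \<open>The summands bound the coefficients of \<open>fst h\<close> and
    \<open>snd h\<close>. Both coefficients are nondecreasing in the ratio because
    \<open>r - 1\<close> is nonnegative, so they are evaluated at \<open>C\<close>.\<close>
  define L where "L = (1 + (r - 1) * C powr r) + r * C powr (r - 1)"
  have L: "0 \<le> L" using r by (simp add: L_def)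
  have "L-lipschitz_on (ratio_cone C) (\<lambda>z. fst z - snd z powr r / fst z powr (r - 1))"
  proof (rule bounded_derivative_imp_lipschitz[OF _ convex_ratio_cone _ L])
    fix z assume z: "z \<in> ratio_cone C"
    then show "((\<lambda>z. fst z - snd z powr r / fst z powr (r - 1)) has_derivative ?D z) (at z within ratio_cone C)"
      using picone_quotient_has_derivative[of "fst z" "snd z" "ratio_cone C" r]
      by (simp add: ratio_cone_def)
    show "onorm (?D z) \<le> L"
    proof (rule onorm_bound[OF L])
      fix h :: "real \<times> real"
      have ratio: "0 \<le> snd z / fst z" "snd z / fst z \<le> C"
        using z by (auto simp: ratio_cone_def divide_simps mult.commute)
      have "norm (?D z h) \<le> \<bar>(1 + (r - 1) * (snd z / fst z) powr r) * fst h\<bar> + \<bar>(r * (snd z / fst z) powr (r - 1)) * snd h\<bar>"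
        by (simp only: real_norm_def abs_triangle_ineq4)
      also have "\<dots> = (1 + (r - 1) * (snd z / fst z) powr r) * \<bar>fst h\<bar> + (r * (snd z / fst z) powr (r - 1)) * \<bar>snd h\<bar>"
        using r by (simp add: abs_mult)
      also have "\<dots> \<le> (1 + (r - 1) * C powr r) * norm h + (r * C powr (r - 1)) * norm h"
        using r ratio norm_fst_le[of "fst h" "snd h"] norm_snd_le[of "snd h" "fst h"]
        by (intro add_mono mult_mono mult_left_mono powr_mono2) auto
      also have "\<dots> = L * norm h" by (simp add: L_def distrib_right)
      finally show "norm (?D z h) \<le> L * norm h" .
    qed
  qed
  then show ?thesis by blast
qed

section \<open>Variable exponent Lebesgue spaces\<close>

lemma log_Hoelder_imp_continuous_on:
  assumes "log_Hoelder_on S p"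
  shows "continuous_on S p"
proof -
  obtain C where C: "\<And>x y. x \<in> S \<Longrightarrow> y \<in> S \<Longrightarrow> 0 < dist x y \<Longrightarrow> dist x y < 1/2 \<Longrightarrow>
      \<bar>p x - p y\<bar> * ln (1 / dist x y) \<le> C"
    using assms unfolding log_Hoelder_on_def by blast
  show ?thesis
    unfolding continuous_on_iff
  proof (intro ballI allI impI)
    fix x e assume x: "x \<in> S" and e: "(0::real) < e"
    \<comment> \<open>Points closer than \<open>exp (- M)\<close> make the logarithmic factor exceed
      \<open>M\<close>; the exponents then differ by less than
      \<open>(\<bar>C\<bar> + 1) / M\<close>, which is \<open>e\<close>.\<close>
    define M where "M = (\<bar>C\<bar> + 1) / e"
    have M: "0 < M" using e by (simp add: M_def add_nonneg_pos)
    have "dist (p y) (p x) < e" if y: "y \<in> S" "dist y x < min (1/2) (exp (- M))" for y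
    proof (cases "y = x")
      case False
      then have d: "0 < dist x y" "dist x y < 1/2" "dist x y < exp (- M)"
        using y by (auto simp: dist_commute)
      have "ln (dist x y) < - M" using d by (metis ln_less_cancel_iff exp_gt_zero ln_exp)
      then have "M < ln (1 / dist x y)" using d by (simp add: ln_div)
      then have "\<bar>p x - p y\<bar> * M \<le> \<bar>p x - p y\<bar> * ln (1 / dist x y)"
        by (intro mult_left_mono) auto
      also have "\<dots> \<le> C" using C[OF x y(1)] d by blast
      also have "\<dots> < \<bar>C\<bar> + 1" by simp
      also have "\<dots> = e * M" using e by (simp add: M_def)
      finally show ?thesis using M by (simp add: dist_real_def abs_minus_commute)
    qed (use e in simp)
    then show "\<exists>d>0. \<forall>x'\<in>S. dist x' x < d \<longrightarrow> dist (p x') (p x) < e"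
      by (intro exI[of _ "min (1/2) (exp (- M))"]) auto
  qed
qed

lemma var_Lebesgue_dominated:
  assumes u: "u \<in> var_Lebesgue \<Omega> p" and v: "v \<in> borel_measurable (lebesgue_on \<Omega>)"
    and p: "p \<in> borel_measurable (lebesgue_on \<Omega>)" "\<And>x. x \<in> \<Omega> \<Longrightarrow> 0 \<le> p x"
    and c: "0 \<le> c" and dom: "AE x in lebesgue_on \<Omega>. \<bar>v x\<bar> \<le> c * \<bar>u x\<bar>"
  shows "v \<in> var_Lebesgue \<Omega> p"
proof -
  obtain l where l: "l > 0" "integrable (lebesgue_on \<Omega>) (\<lambda>x. \<bar>u x / l\<bar> powr p x)"
    using u by (auto simp: var_Lebesgue_def)
  \<comment> \<open>The added 1 keeps the new Luxemburg scale positive when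
    \<open>c = 0\<close>.\<close>
  have "integrable (lebesgue_on \<Omega>) (\<lambda>x. \<bar>v x / (l * (c + 1))\<bar> powr p x)"
  proof (rule Bochner_Integration.integrable_bound[OF l(2)])
    show "AE x in lebesgue_on \<Omega>. norm (\<bar>v x / (l * (c + 1))\<bar> powr p x) \<le> norm (\<bar>u x / l\<bar> powr p x)"
      using dom AE_space
    proof eventually_elim
      case (elim x)
      have "\<bar>v x\<bar> \<le> (c + 1) * \<bar>u x\<bar>" using elim(1) by (simp add: distrib_right add_increasing2)
      then have "\<bar>v x / (l * (c + 1))\<bar> \<le> \<bar>u x / l\<bar>"
        using l(1) c by (simp add: abs_mult divide_simps mult.commute mult.left_commute)
      then show ?case using elim(2) p(2) by (auto intro!: powr_mono2)
    qed
  qed (use v p in measurable)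
  then show ?thesis using v l(1) c by (auto simp: var_Lebesgue_def intro!: exI[of _ "l * (c + 1)"])
qed

text \<open>With the scale \<open>l + m\<close> the quotient is a weighted mean of
  \<open>\<bar>u x\<bar> / l\<close> and \<open>\<bar>v x\<bar> / m\<close>, hence at most their
  maximum, and a power of the maximum is at most the sum of the two powers.\<close>

lemma var_Lebesgue_abs_add:
  assumes u: "u \<in> var_Lebesgue \<Omega> p" and v: "v \<in> var_Lebesgue \<Omega> p"
    and p: "p \<in> borel_measurable (lebesgue_on \<Omega>)" "\<And>x. x \<in> \<Omega> \<Longrightarrow> 0 \<le> p x"
  shows "(\<lambda>x. \<bar>u x\<bar> + \<bar>v x\<bar>) \<in> var_Lebesgue \<Omega> p"
proof -
  obtain l where l: "l > 0" "integrable (lebesgue_on \<Omega>) (\<lambda>x. \<bar>u x / l\<bar> powr p x)"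
    using u by (auto simp: var_Lebesgue_def)
  obtain m where m: "m > 0" "integrable (lebesgue_on \<Omega>) (\<lambda>x. \<bar>v x / m\<bar> powr p x)"
    using v by (auto simp: var_Lebesgue_def)
  have [measurable]: "u \<in> borel_measurable (lebesgue_on \<Omega>)" "v \<in> borel_measurable (lebesgue_on \<Omega>)"
    using u v by (auto simp: var_Lebesgue_def)
  note p(1)[measurable]
  have "integrable (lebesgue_on \<Omega>) (\<lambda>x. \<bar>(\<bar>u x\<bar> + \<bar>v x\<bar>) / (l + m)\<bar> powr p x)"
  proof (rule Bochner_Integration.integrable_bound[OF Bochner_Integration.integrable_add[OF l(2) m(2)]])
    show "AE x in lebesgue_on \<Omega>. norm (\<bar>(\<bar>u x\<bar> + \<bar>v x\<bar>) / (l + m)\<bar> powr p x)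
        \<le> norm (\<bar>u x / l\<bar> powr p x + \<bar>v x / m\<bar> powr p x)"
      using AE_space
    proof eventually_elim
      case (elim x)
      define M where "M = max (\<bar>u x\<bar> / l) (\<bar>v x\<bar> / m)"
      have "\<bar>u x\<bar> \<le> M * l" "\<bar>v x\<bar> \<le> M * m" using l(1) m(1) by (auto simp: M_def pos_divide_le_eq[symmetric])
      then have "(\<bar>u x\<bar> + \<bar>v x\<bar>) / (l + m) \<le> M"
        using l(1) m(1) by (simp add: pos_divide_le_eq distrib_left)
      then have "((\<bar>u x\<bar> + \<bar>v x\<bar>) / (l + m)) powr p x \<le> M powr p x"
        using elim p(2) l(1) m(1) by (intro powr_mono2) auto
      also have "M powr p x \<le> (\<bar>u x\<bar> / l) powr p x + (\<bar>v x\<bar> / m) powr p x"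
        by (auto simp: M_def max_def)
      finally show ?case using l(1) m(1) by (simp add: abs_of_nonneg)
    qed
  qed measurable
  then show ?thesis using l(1) m(1) by (auto simp: var_Lebesgue_def intro!: exI[of _ "l + m"])
qed

text \<open>An exponent bounded by \<open>P\<close> allows the Luxemburg scale \<open>l\<close> to
  be removed: its power is at most \<open>max 1 l powr P\<close>, where the maximum covers scales
  below 1.\<close>

lemma var_Lebesgue_integrable_powr:
  assumes u: "u \<in> var_Lebesgue \<Omega> p"
    and p: "p \<in> borel_measurable (lebesgue_on \<Omega>)" "\<And>x. x \<in> \<Omega> \<Longrightarrow> 0 \<le> p x" "\<And>x. x \<in> \<Omega> \<Longrightarrow> p x \<le> P"
  shows "integrable (lebesgue_on \<Omega>) (\<lambda>x. \<bar>u x\<bar> powr p x)"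
proof -
  obtain l where l: "l > 0" "integrable (lebesgue_on \<Omega>) (\<lambda>x. \<bar>u x / l\<bar> powr p x)"
    using u by (auto simp: var_Lebesgue_def)
  have [measurable]: "u \<in> borel_measurable (lebesgue_on \<Omega>)" using u by (auto simp: var_Lebesgue_def)
  note p(1)[measurable]
  show ?thesis
  proof (rule Bochner_Integration.integrable_bound[OF integrable_mult_right[OF l(2), of "max 1 l powr P"]])
    show "AE x in lebesgue_on \<Omega>. norm (\<bar>u x\<bar> powr p x) \<le> norm (max 1 l powr P * \<bar>u x / l\<bar> powr p x)"
      using AE_space
    proof eventually_elim
      case (elim x)
      then have x: "x \<in> \<Omega>" by simp
      have "\<bar>u x\<bar> powr p x = (l * \<bar>u x / l\<bar>) powr p x" using l(1) by simp
      also have "\<dots> = l powr p x * \<bar>u x / l\<bar> powr p x" by (rule powr_mult)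
      finally have eq: "\<bar>u x\<bar> powr p x = l powr p x * \<bar>u x / l\<bar> powr p x" .
      have "l powr p x \<le> max 1 l powr p x" using l(1) p(2)[OF x] by (intro powr_mono2) auto
      also have "\<dots> \<le> max 1 l powr P" using p(3)[OF x] by (intro powr_mono) auto
      finally show ?case unfolding eq by (simp add: mult_right_mono)
    qed
  qed measurable
qed

text \<open>For exponents at least 1 one has \<open>y \<le> 1 + y powr p x\<close>, and the constant
  is integrable because a bounded set has finite measure.\<close>

lemma var_Lebesgue_integrable:
  assumes u: "u \<in> var_Lebesgue \<Omega> p" and \<Omega>: "bounded \<Omega>" "\<Omega> \<in> sets lebesgue"
    and p: "\<And>x. x \<in> \<Omega> \<Longrightarrow> 1 \<le> p x"
  shows "integrable (lebesgue_on \<Omega>) u"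
proof -
  obtain l where l: "l > 0" "integrable (lebesgue_on \<Omega>) (\<lambda>x. \<bar>u x / l\<bar> powr p x)"
    using u by (auto simp: var_Lebesgue_def)
  have "\<Omega> \<in> lmeasurable" using \<Omega> by (rule bounded_set_imp_lmeasurable)
  then have "integrable (lebesgue_on \<Omega>) (\<lambda>x. 1 :: real)"
    by (simp add: integrable_restrict_space \<Omega>(2) fmeasurable_def)
  then have i: "integrable (lebesgue_on \<Omega>) (\<lambda>x. l * (1 + \<bar>u x / l\<bar> powr p x))"
    using l(2) by (intro integrable_mult_right Bochner_Integration.integrable_add)
  show ?thesis
  proof (rule Bochner_Integration.integrable_bound[OF i])
    show "AE x in lebesgue_on \<Omega>. norm (u x) \<le> norm (l * (1 + \<bar>u x / l\<bar> powr p x))"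
      using AE_space
    proof eventually_elim
      case (elim x)
      have "y \<le> 1 + y powr p x" if "0 \<le> y" for y
      proof (cases "y \<le> 1")
        case False
        then have "y powr 1 \<le> y powr p x" using p elim by (intro powr_mono) auto
        then show ?thesis using False by simp
      qed (simp add: add_increasing2)
      from this[of "\<bar>u x / l\<bar>"] have "\<bar>u x\<bar> \<le> l * (1 + \<bar>u x / l\<bar> powr p x)"
        using l(1) by (simp add: pos_divide_le_eq mult.commute)
      then show ?case using l(1) by simp
    qed
  qed (use u in \<open>simp add: var_Lebesgue_def\<close>)
qed

section \<open>Local integrability and measurability of compositions\<close>

lemma locally_integrable_of_integrable:
  fixes f :: "'a::euclidean_space \<Rightarrow> 'b::{banach, second_countable_topology}"
  assumes "integrable (lebesgue_on \<Omega>) f" and \<Omega>: "\<Omega> \<in> sets lebesgue"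
  shows "locally_integrable \<Omega> f"
  unfolding locally_integrable_def
proof (intro allI impI)
  fix K :: "'a set" assume K: "compact K \<and> K \<subseteq> \<Omega>"
  then have Ks: "K \<in> sets lebesgue" by (auto dest: compact_imp_closed)
  have "integrable lebesgue (\<lambda>x. indicator \<Omega> x *\<^sub>R f x)"
    using assms by (simp add: integrable_restrict_space)
  then have "integrable lebesgue (\<lambda>x. indicator K x *\<^sub>R (indicator \<Omega> x *\<^sub>R f x))"
    using Ks by (rule integrable_mult_indicator[rotated])
  also have "(\<lambda>x. indicator K x *\<^sub>R (indicator \<Omega> x *\<^sub>R f x)) = (\<lambda>x. indicator K x *\<^sub>R f x)"
    by (intro ext) (use K in \<open>auto simp: indicator_def\<close>)
  finally show "integrable (lebesgue_on K) f" using Ks by (simp add: integrable_restrict_space)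
qed

text \<open>Integrability on a compact set includes measurability there, and countably many closed
  boxes cover an open set.\<close>

lemma locally_integrable_measurable:
  fixes f :: "'a::euclidean_space \<Rightarrow> 'b::{banach, second_countable_topology}"
  assumes f: "locally_integrable \<Omega> f" and \<Omega>: "open \<Omega>"
  shows "f \<in> borel_measurable (lebesgue_on \<Omega>)"
proof -
  obtain \<D> where \<D>: "countable \<D>" "\<D> \<subseteq> Pow \<Omega>" "\<And>X. X \<in> \<D> \<Longrightarrow> \<exists>a b. X = cbox a b" "\<Union>\<D> = \<Omega>"
    using open_countable_Union_open_cbox[OF \<Omega>] by metis
  have \<Omega>s: "\<Omega> \<in> sets lebesgue" using \<Omega> by auto
  have X: "X \<in> sets lebesgue" "compact X" "X \<subseteq> \<Omega>" if XD: "X \<in> \<D>" for X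
  proof -
    obtain a b where "X = cbox a b" using \<D>(3)[OF XD] by blast
    then show "X \<in> sets lebesgue" "compact X" by auto
    show "X \<subseteq> \<Omega>" using \<D>(2) XD by blast
  qed
  show ?thesis
  proof (rule measurable_piecewise_restrict[OF \<D>(1)])
    show "X \<inter> space (lebesgue_on \<Omega>) \<in> sets (lebesgue_on \<Omega>)" if "X \<in> \<D>" for X
      using X[OF that] \<Omega>s by (auto simp: sets_restrict_space)
    show "space (lebesgue_on \<Omega>) \<subseteq> \<Union>\<D>" using \<D>(4) by simp
    show "f \<in> borel_measurable (restrict_space (lebesgue_on \<Omega>) X)" if "X \<in> \<D>" for X
    proof -
      have "restrict_space (lebesgue_on \<Omega>) X = lebesgue_on X"
        using X[OF that] \<Omega>s by (subst restrict_restrict_space) (auto simp: Int_absorb1)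
      then show ?thesis using f X[OF that] by (auto simp: locally_integrable_def)
    qed
  qed
qed

text \<open>Lebesgue measure is complete, so preimages that differ within a null set are measurable
  together.\<close>

lemma borel_measurable_AE_lebesgue_on:
  fixes f g :: "'a::euclidean_space \<Rightarrow> real"
  assumes \<Omega>: "\<Omega> \<in> sets lebesgue" and f: "f \<in> borel_measurable (lebesgue_on \<Omega>)"
    and eq: "AE x in lebesgue_on \<Omega>. f x = g x"
  shows "g \<in> borel_measurable (lebesgue_on \<Omega>)"
proof -
  let ?f = "\<lambda>x. indicator \<Omega> x *\<^sub>R f x" and ?g = "\<lambda>x. indicator \<Omega> x *\<^sub>R g x"
  have f': "?f \<in> borel_measurable lebesgue"
    using f \<Omega> borel_measurable_restrict_space_iff[of \<Omega> lebesgue f] by simp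
  have "AE x in lebesgue. x \<in> \<Omega> \<longrightarrow> f x = g x"
    using eq \<Omega> by (simp add: AE_restrict_space_iff)
  then have AE: "AE x in lebesgue. ?f x = ?g x" by eventually_elim (auto simp: indicator_def)
  have "?g \<in> borel_measurable lebesgue"
  proof (rule measurableI)
    fix S :: "real set" assume S: "S \<in> sets borel"
    have "AE x in lebesgue. x \<in> ?f -` S \<inter> space lebesgue \<longleftrightarrow> x \<in> ?g -` S \<inter> space lebesgue"
      using AE by eventually_elim (simp only: vimage_eq Int_iff)
    then show "?g -` S \<inter> space lebesgue \<in> sets lebesgue"
      by (rule completion.in_sets_AE) (use measurable_sets[OF f' S] in auto)
  qed simp
  then show ?thesis using \<Omega> borel_measurable_restrict_space_iff[of \<Omega> lebesgue g] by simp
qed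

text \<open>\<open>g\<close> is approximated from above by functions with countably many values. For
  each fixed value \<open>\<Psi>\<close> is measurable in \<open>x\<close>, and continuity in the
  second variable gives convergence almost everywhere.\<close>

lemma Caratheodory_measurable:
  fixes \<Psi> :: "'a::euclidean_space \<Rightarrow> real \<Rightarrow> real"
  assumes \<Omega>: "\<Omega> \<in> sets lebesgue"
    and meas: "\<And>s. 0 < s \<Longrightarrow> (\<lambda>x. \<Psi> x s) \<in> borel_measurable (lebesgue_on \<Omega>)"
    and cont: "AE x in lebesgue_on \<Omega>. continuous_on {0<..} (\<Psi> x)"
    and g: "g \<in> borel_measurable (lebesgue_on \<Omega>)"
  shows "(\<lambda>x. if 0 < g x then \<Psi> x (g x) else 0) \<in> borel_measurable (lebesgue_on \<Omega>)"
proof -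
  note g[measurable]
  define k where "k n x = \<lfloor>real (Suc n) * g x\<rfloor>" for n x
  \<comment> \<open>Rounding up: the added 1 makes the grid point positive for every
    \<open>i \<ge> 0\<close>, where \<open>\<Psi>\<close> is known to be measurable.\<close>
  define s where "s n i = (real_of_int i + 1) / real (Suc n)" for n i
  \<comment> \<open>The inner guard replaces the slices with negative index by zero, so that every
    slice is measurable; it is satisfied wherever \<open>g x\<close> is positive.\<close>
  define h where "h n x = (if 0 < g x then (if 0 \<le> k n x then \<Psi> x (s n (k n x)) else 0) else 0)" for n x
  have k[measurable]: "k n \<in> lebesgue_on \<Omega> \<rightarrow>\<^sub>M count_space UNIV" for n
    unfolding k_def by measurable
  have "(\<lambda>x. if 0 \<le> k n x then \<Psi> x (s n (k n x)) else 0) \<in> borel_measurable (lebesgue_on \<Omega>)" for n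
  proof (rule measurable_compose_countable[where f = "\<lambda>i x. if 0 \<le> i then \<Psi> x (s n i) else 0", OF _ k])
    fix i :: int
    show "(\<lambda>x. if 0 \<le> i then \<Psi> x (s n i) else 0) \<in> borel_measurable (lebesgue_on \<Omega>)"
      using meas[of "s n i"] by (cases "0 \<le> i") (auto simp: s_def)
  qed
  then have h[measurable]: "h n \<in> borel_measurable (lebesgue_on \<Omega>)" for n
    unfolding h_def by measurable
  have lim: "(\<lambda>x. lim (\<lambda>n. h n x)) \<in> borel_measurable (lebesgue_on \<Omega>)"
    by (rule borel_measurable_lim_metric[OF h])
  have "AE x in lebesgue_on \<Omega>. lim (\<lambda>n. h n x) = (if 0 < g x then \<Psi> x (g x) else 0)"
    using cont
  proof eventually_elim
    case (elim x)
    show ?case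
    proof (cases "0 < g x")
      case True
      have k0: "0 \<le> k n x" for n using True by (simp add: k_def)
      have bounds: "g x \<le> s n (k n x)" "s n (k n x) \<le> g x + inverse (real (Suc n))" for n
      proof -
        let ?N = "real (Suc n)"
        have fl: "real_of_int (k n x) \<le> ?N * g x" "?N * g x \<le> real_of_int (k n x) + 1"
          unfolding k_def by linarith+
        show "g x \<le> s n (k n x)"
          using fl(2) by (simp add: s_def pos_le_divide_eq mult.commute del: of_nat_Suc)
        have "s n (k n x) \<le> (?N * g x + 1) / ?N"
          unfolding s_def using fl(1) by (intro divide_right_mono) auto
        also have "\<dots> = g x + inverse ?N"
          by (simp add: add_divide_distrib inverse_eq_divide del: of_nat_Suc)
        finally show "s n (k n x) \<le> g x + inverse ?N" .
      qed
      have "(\<lambda>n. s n (k n x)) \<longlonglongrightarrow> g x"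
      proof (rule tendsto_sandwich[OF _ _ tendsto_const])
        show "(\<lambda>n. g x + inverse (real (Suc n))) \<longlonglongrightarrow> g x"
          using tendsto_add[OF tendsto_const LIMSEQ_inverse_real_of_nat, of "g x"] by simp
      qed (use bounds in auto)
      moreover have "s n (k n x) \<in> {0<..}" for n using bounds(1)[of n] True by simp
      ultimately have "(\<lambda>n. \<Psi> x (s n (k n x))) \<longlonglongrightarrow> \<Psi> x (g x)"
        using elim True unfolding continuous_on_sequentially by (auto simp: o_def)
      then show ?thesis using True k0 by (simp add: h_def limI)
    qed (simp add: h_def)
  qed
  then show ?thesis by (rule borel_measurable_AE_lebesgue_on[OF \<Omega> lim])
qed

text \<open>For a family of one interval (\<open>n = 1\<close>) the definition is already a
  continuity estimate, and the interval from \<open>s / 2\<close> to \<open>2 * s\<close> is a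
  neighbourhood of \<open>s\<close>.\<close>

lemma locally_absolutely_continuous_pos_imp_continuous_on:
  assumes "locally_absolutely_continuous_pos f"
  shows "continuous_on {0<..} f"
proof -
  have "isCont f s" if s: "0 < s" for s
    unfolding continuous_at_eps_delta
  proof (intro allI impI)
    fix \<epsilon> :: real assume \<epsilon>: "0 < \<epsilon>"
    have "absolutely_continuous_on_interval (s / 2) (2 * s) f"
      using assms s by (simp add: locally_absolutely_continuous_pos_def)
    then obtain \<delta> where \<delta>: "\<delta> > 0" "\<forall>(n::nat) l u.
        (\<forall>i<n. s / 2 \<le> l i \<and> l i \<le> u i \<and> u i \<le> 2 * s) \<and>
        disjoint_family_on (\<lambda>i. {l i<..<u i}) {..<n} \<and>
        (\<Sum>i<n. u i - l i) < \<delta> \<longrightarrow> (\<Sum>i<n. \<bar>f (u i) - f (l i)\<bar>) < \<epsilon>"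
      using \<epsilon> unfolding absolutely_continuous_on_interval_def by blast
    have *: "\<bar>f b - f a\<bar> < \<epsilon>" if "s / 2 \<le> a" "a \<le> b" "b \<le> 2 * s" "b - a < \<delta>" for a b
      using \<delta>(2)[rule_format, of 1 "\<lambda>_. a" "\<lambda>_. b"] that by (simp add: disjoint_family_on_def)
    have "dist (f y) (f s) < \<epsilon>" if y: "dist y s < min \<delta> (s / 2)" for y
    proof (cases "y \<le> s")
      case True
      then have "s / 2 \<le> y" "s - y < \<delta>" using y by (auto simp: dist_real_def)
      then show ?thesis using *[of y s] True s by (simp add: dist_real_def abs_minus_commute)
    next
      case False
      then have "y \<le> 2 * s" "y - s < \<delta>" using y s by (auto simp: dist_real_def)
      then show ?thesis using *[of s y] False s by (simp add: dist_real_def)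
    qed
    then show "\<exists>d>0. \<forall>x'. dist x' s < d \<longrightarrow> dist (f x') (f s) < \<epsilon>"
      using \<delta>(1) s by (intro exI[of _ "min \<delta> (s / 2)"]) auto
  qed
  then show ?thesis by (intro continuous_at_imp_continuous_on) auto
qed

section \<open>The Picone-type inequality\<close>

text \<open>The chosen function is a weak gradient as soon as one exists, and uniqueness then
  identifies it with any explicitly computed one.\<close>

lemma weak_gradient_AE_eq:
  assumes "has_weak_gradient \<Omega> v G" "open \<Omega>"
  shows "has_weak_gradient \<Omega> v (weak_gradient \<Omega> v)"
    and "AE x in lebesgue_on \<Omega>. weak_gradient \<Omega> v x = G x"
proof -
  show "has_weak_gradient \<Omega> v (weak_gradient \<Omega> v)"
    unfolding weak_gradient_def
    using someI[where P = "has_weak_gradient \<Omega> v", OF assms(1)] .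
  then show "AE x in lebesgue_on \<Omega>. weak_gradient \<Omega> v x = G x"
    using assms by (rule weak_gradient_unique_AE)
qed

lemma has_weak_gradient_measurable:
  assumes "has_weak_gradient \<Omega> v G" "open \<Omega>"
  shows "G \<in> borel_measurable (lebesgue_on \<Omega>)"
  using assms by (intro locally_integrable_measurable) (auto simp: has_weak_gradient_def)

text \<open>The Sobolev space speaks of some gradient with finite norm, the integrals of the chosen
  one. The two agree almost everywhere, so the norm bound is transferred by domination.\<close>

lemma var_Sobolev_weak_gradient:
  assumes v: "v \<in> var_Sobolev \<Omega> p" and \<Omega>: "open \<Omega>"
    and p: "p \<in> borel_measurable (lebesgue_on \<Omega>)" "\<And>x. x \<in> \<Omega> \<Longrightarrow> 0 \<le> p x"
  shows "has_weak_gradient \<Omega> v (weak_gradient \<Omega> v)"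
    and "(\<lambda>x. norm (weak_gradient \<Omega> v x)) \<in> var_Lebesgue \<Omega> p"
proof -
  obtain G where G: "has_weak_gradient \<Omega> v G" "(\<lambda>x. norm (G x)) \<in> var_Lebesgue \<Omega> p"
    using v by (auto simp: var_Sobolev_def)
  show wg: "has_weak_gradient \<Omega> v (weak_gradient \<Omega> v)"
    by (rule weak_gradient_AE_eq(1)[OF G(1) \<Omega>])
  show "(\<lambda>x. norm (weak_gradient \<Omega> v x)) \<in> var_Lebesgue \<Omega> p"
  proof (rule var_Lebesgue_dominated[OF G(2) _ p, where c = 1])
    show "(\<lambda>x. norm (weak_gradient \<Omega> v x)) \<in> borel_measurable (lebesgue_on \<Omega>)"
      using has_weak_gradient_measurable[OF wg \<Omega>] by simp
    show "AE x in lebesgue_on \<Omega>. \<bar>norm (weak_gradient \<Omega> v x)\<bar> \<le> 1 * \<bar>norm (G x)\<bar>"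
      using weak_gradient_AE_eq(2)[OF G(1) \<Omega>] by eventually_elim simp
  qed simp_all
qed

lemma has_weak_gradient_uminus:
  assumes "has_weak_gradient \<Omega> v G"
  shows "has_weak_gradient \<Omega> (\<lambda>x. - v x) (\<lambda>x. - G x)"
  using assms by (simp add: has_weak_gradient_def locally_integrable_def)

text \<open>Boundedness of the ratio bounds both coefficients of \<open>G\<close>, so that
  domination by the given functions and gradients applies. The result is used as it stands for the
  first quotient, and with the two functions exchanged for the negative of the second.\<close>

lemma picone_quotient_var_Sobolev:
  fixes w\<^sub>1 w\<^sub>2 p :: "real^'n \<Rightarrow> real"
  assumes \<Omega>: "open \<Omega>" "bounded \<Omega>"
    and p: "p \<in> borel_measurable (lebesgue_on \<Omega>)" "\<And>x. x \<in> \<Omega> \<Longrightarrow> 1 \<le> p x"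
    and w1: "w\<^sub>1 \<in> var_Sobolev \<Omega> p" "AE x in lebesgue_on \<Omega>. 0 < w\<^sub>1 x"
    and w2: "w\<^sub>2 \<in> var_Sobolev \<Omega> p" "AE x in lebesgue_on \<Omega>. 0 < w\<^sub>2 x"
    and ratio: "(\<lambda>x. w\<^sub>2 x / w\<^sub>1 x) \<in> Linfty \<Omega>" and r: "1 \<le> r"
  defines "v \<equiv> \<lambda>x. w\<^sub>1 x - w\<^sub>2 x powr r / w\<^sub>1 x powr (r - 1)"
    and "G \<equiv> \<lambda>x. (1 + (r - 1) * (w\<^sub>2 x / w\<^sub>1 x) powr r) *\<^sub>R weak_gradient \<Omega> w\<^sub>1 x
                - (r * (w\<^sub>2 x / w\<^sub>1 x) powr (r - 1)) *\<^sub>R weak_gradient \<Omega> w\<^sub>2 x"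
  shows "v \<in> var_Lebesgue \<Omega> p" "has_weak_gradient \<Omega> v G" "(\<lambda>x. norm (G x)) \<in> var_Lebesgue \<Omega> p"
proof -
  have \<Omega>s: "\<Omega> \<in> sets lebesgue" using \<Omega>(1) by auto
  have p0: "0 \<le> p x" if "x \<in> \<Omega>" for x using p(2)[OF that] by simp
  note g1 = var_Sobolev_weak_gradient[OF w1(1) \<Omega>(1) p(1) p0]
  note g2 = var_Sobolev_weak_gradient[OF w2(1) \<Omega>(1) p(1) p0]
  have wL: "w\<^sub>1 \<in> var_Lebesgue \<Omega> p" "w\<^sub>2 \<in> var_Lebesgue \<Omega> p"
    using w1 w2 by (auto simp: var_Sobolev_def)
  have [measurable]: "w\<^sub>1 \<in> borel_measurable (lebesgue_on \<Omega>)" "w\<^sub>2 \<in> borel_measurable (lebesgue_on \<Omega>)"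
    using wL by (auto simp: var_Lebesgue_def)
  note [measurable] = has_weak_gradient_measurable[OF g1(1) \<Omega>(1)] has_weak_gradient_measurable[OF g2(1) \<Omega>(1)]
  obtain C\<^sub>0 where C0: "AE x in lebesgue_on \<Omega>. \<bar>w\<^sub>2 x / w\<^sub>1 x\<bar> \<le> C\<^sub>0"
    using ratio by (auto simp: Linfty_def)
  \<comment> \<open>The absolute value provides the nonnegative bound that the Lipschitz lemma on
    the cone expects.\<close>
  define C where "C = \<bar>C\<^sub>0\<bar>"
  have C: "0 \<le> C" "AE x in lebesgue_on \<Omega>. 0 \<le> w\<^sub>2 x / w\<^sub>1 x \<and> w\<^sub>2 x / w\<^sub>1 x \<le> C"
  proof -
    show "AE x in lebesgue_on \<Omega>. 0 \<le> w\<^sub>2 x / w\<^sub>1 x \<and> w\<^sub>2 x / w\<^sub>1 x \<le> C"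
      using C0 w1(2) w2(2) by eventually_elim (auto simp: C_def)
  qed (simp add: C_def)
  define \<alpha> \<beta> where "\<alpha> x = 1 + (r - 1) * (w\<^sub>2 x / w\<^sub>1 x) powr r"
    and "\<beta> x = r * (w\<^sub>2 x / w\<^sub>1 x) powr (r - 1)" for x
  have G: "G x = \<alpha> x *\<^sub>R weak_gradient \<Omega> w\<^sub>1 x - \<beta> x *\<^sub>R weak_gradient \<Omega> w\<^sub>2 x" for x
    by (simp add: G_def \<alpha>_def \<beta>_def)
  define B where "B = (1 + (r - 1) * C powr r) + r * C powr (r - 1)"
  have B: "0 \<le> B" using r by (simp add: B_def)
  have \<alpha>\<beta>: "AE x in lebesgue_on \<Omega>. \<bar>\<alpha> x\<bar> \<le> B \<and> \<bar>\<beta> x\<bar> \<le> B"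
    using C(2)
  proof eventually_elim
    case (elim x)
    then have "(w\<^sub>2 x / w\<^sub>1 x) powr r \<le> C powr r" "(w\<^sub>2 x / w\<^sub>1 x) powr (r - 1) \<le> C powr (r - 1)"
      using r by (auto intro!: powr_mono2)
    then have le: "\<alpha> x \<le> 1 + (r - 1) * C powr r" "\<beta> x \<le> r * C powr (r - 1)"
      using r by (auto simp: \<alpha>_def \<beta>_def intro!: mult_left_mono)
    have "0 \<le> \<alpha> x" "0 \<le> \<beta> x" "0 \<le> 1 + (r - 1) * C powr r" "0 \<le> r * C powr (r - 1)"
      using r by (auto simp: \<alpha>_def \<beta>_def)
    then show ?case using le unfolding B_def by linarith
  qed
  have Gmeas: "G \<in> borel_measurable (lebesgue_on \<Omega>)" unfolding G_def by measurable
  show v: "v \<in> var_Lebesgue \<Omega> p"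
  proof (rule var_Lebesgue_dominated[OF wL(1) _ p(1) p0, where c = "1 + C powr r"])
    show "v \<in> borel_measurable (lebesgue_on \<Omega>)" unfolding v_def by measurable
    show "AE x in lebesgue_on \<Omega>. \<bar>v x\<bar> \<le> (1 + C powr r) * \<bar>w\<^sub>1 x\<bar>"
      using C(2) w1(2) w2(2)
    proof eventually_elim
      case (elim x)
      \<comment> \<open>The quotient is \<open>w\<^sub>1\<close> times a power of the bounded ratio,
        hence dominated by \<open>w\<^sub>1\<close> alone.\<close>
      have "w\<^sub>2 x powr r / w\<^sub>1 x powr (r - 1) = w\<^sub>1 x * (w\<^sub>2 x / w\<^sub>1 x) powr r"
        using elim by (simp add: powr_diff powr_divide)
      moreover have "(w\<^sub>2 x / w\<^sub>1 x) powr r \<le> C powr r" using elim r by (intro powr_mono2) auto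
      ultimately have "w\<^sub>2 x powr r / w\<^sub>1 x powr (r - 1) \<le> w\<^sub>1 x * C powr r"
        using elim by (simp add: mult_left_mono)
      moreover have "0 \<le> w\<^sub>2 x powr r / w\<^sub>1 x powr (r - 1)" by simp
      moreover have "0 \<le> w\<^sub>1 x * C powr r" using elim by simp
      moreover have "(1 + C powr r) * \<bar>w\<^sub>1 x\<bar> = w\<^sub>1 x + w\<^sub>1 x * C powr r"
        using elim by (simp add: algebra_simps)
      ultimately show ?case using elim unfolding v_def by linarith
    qed
  qed simp_all
  show GL: "(\<lambda>x. norm (G x)) \<in> var_Lebesgue \<Omega> p"
  proof (rule var_Lebesgue_dominated[OF var_Lebesgue_abs_add[OF g1(2) g2(2) p(1) p0] _ p(1) p0 B])
    show "AE x in lebesgue_on \<Omega>. \<bar>norm (G x)\<bar> \<le> B * \<bar>\<bar>norm (weak_gradient \<Omega> w\<^sub>1 x)\<bar> + \<bar>norm (weak_gradient \<Omega> w\<^sub>2 x)\<bar>\<bar>"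
      using \<alpha>\<beta>
    proof eventually_elim
      case (elim x)
      have "norm (G x) \<le> \<bar>\<alpha> x\<bar> * norm (weak_gradient \<Omega> w\<^sub>1 x) + \<bar>\<beta> x\<bar> * norm (weak_gradient \<Omega> w\<^sub>2 x)"
        using norm_triangle_ineq4[of "\<alpha> x *\<^sub>R weak_gradient \<Omega> w\<^sub>1 x"
            "\<beta> x *\<^sub>R weak_gradient \<Omega> w\<^sub>2 x"]
        by (simp add: G)
      also have "\<dots> \<le> B * norm (weak_gradient \<Omega> w\<^sub>1 x) + B * norm (weak_gradient \<Omega> w\<^sub>2 x)"
        using elim by (intro add_mono mult_right_mono) auto
      finally show ?case by (simp add: distrib_left)
    qed
  qed (use Gmeas in auto)
  \<comment> \<open>Exponents at least 1 on a bounded set give integrability; the definition of a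
    weak gradient demands it locally.\<close>
  have "integrable (lebesgue_on \<Omega>) G"
    using var_Lebesgue_integrable[OF GL \<Omega>(2) \<Omega>s p(2)] Gmeas by (simp add: integrable_norm_iff)
  then have Gloc: "locally_integrable \<Omega> G" using \<Omega>s by (rule locally_integrable_of_integrable)
  have vloc: "locally_integrable \<Omega> v"
    using var_Lebesgue_integrable[OF v \<Omega>(2) \<Omega>s p(2)] \<Omega>s by (rule locally_integrable_of_integrable)
  let ?F = "\<lambda>z :: real \<times> real. fst z - snd z powr r / fst z powr (r - 1)"
  obtain L where L: "L-lipschitz_on (ratio_cone C) ?F"
    using picone_quotient_lipschitz[OF r C(1)] by blast
  show "has_weak_gradient \<Omega> v G"
  proof (rule has_weak_gradient_chain[OF \<Omega>(1) g1(1) g2(1) vloc Gloc L B])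
    show "AE x in lebesgue_on \<Omega>. (w\<^sub>1 x, w\<^sub>2 x) \<in> ratio_cone C \<and> v x = ?F (w\<^sub>1 x, w\<^sub>2 x) \<and>
      (\<exists>D. (?F has_derivative D) (at (w\<^sub>1 x, w\<^sub>2 x) within ratio_cone C) \<and>
        (\<forall>i. G x $ i = D (weak_gradient \<Omega> w\<^sub>1 x $ i, weak_gradient \<Omega> w\<^sub>2 x $ i) \<and>
          \<bar>G x $ i\<bar> \<le> B * (\<bar>weak_gradient \<Omega> w\<^sub>1 x $ i\<bar> + \<bar>weak_gradient \<Omega> w\<^sub>2 x $ i\<bar>)))"
      using C(2) w1(2) w2(2) \<alpha>\<beta>
    proof eventually_elim
      case (elim x)
      have S: "(w\<^sub>1 x, w\<^sub>2 x) \<in> ratio_cone C"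
        using elim by (simp add: ratio_cone_def pos_divide_le_eq)
      have bound: "\<bar>G x $ i\<bar> \<le> B * (\<bar>weak_gradient \<Omega> w\<^sub>1 x $ i\<bar> + \<bar>weak_gradient \<Omega> w\<^sub>2 x $ i\<bar>)" for i
      proof -
        have "\<bar>G x $ i\<bar> \<le> \<bar>\<alpha> x\<bar> * \<bar>weak_gradient \<Omega> w\<^sub>1 x $ i\<bar> + \<bar>\<beta> x\<bar> * \<bar>weak_gradient \<Omega> w\<^sub>2 x $ i\<bar>"
          using abs_triangle_ineq4[of "\<alpha> x * weak_gradient \<Omega> w\<^sub>1 x $ i" "\<beta> x * weak_gradient \<Omega> w\<^sub>2 x $ i"]
          by (simp add: G abs_mult)
        also have "\<dots> \<le> B * \<bar>weak_gradient \<Omega> w\<^sub>1 x $ i\<bar> + B * \<bar>weak_gradient \<Omega> w\<^sub>2 x $ i\<bar>"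
          using elim by (intro add_mono mult_right_mono) auto
        finally show ?thesis by (simp add: distrib_left)
      qed
      have "(?F has_derivative (\<lambda>h. \<alpha> x * fst h - \<beta> x * snd h)) (at (w\<^sub>1 x, w\<^sub>2 x) within ratio_cone C)"
        unfolding \<alpha>_def \<beta>_def using elim S by (intro picone_quotient_has_derivative) auto
      then show ?case
        using S bound by (auto simp: v_def G intro!: exI[of _ "\<lambda>h. \<alpha> x * fst h - \<beta> x * snd h"])
    qed
  qed
qed

section \<open>Integrability of the integrands\<close>

lemma mult_le_powr_conj:
  fixes x y p :: real
  assumes "1 < p" "0 \<le> x" "0 \<le> y"
  shows "x * y \<le> x powr (p / (p - 1)) + y powr p"
proof -
  have "x * y \<le> x powr (p / (p - 1)) / (p / (p - 1)) + y powr p / p"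
    using assms by (intro Youngs_inequality) (auto simp: field_simps)
  also have "\<dots> \<le> x powr (p / (p - 1)) + y powr p"
  proof (intro add_mono)
    have le: "a / c \<le> a" if "0 \<le> a" "1 \<le> c" for a c :: real
      using divide_left_mono[of 1 c a] that by simp
    show "x powr (p / (p - 1)) / (p / (p - 1)) \<le> x powr (p / (p - 1))" "y powr p / p \<le> y powr p"
      by (rule le; use assms(1) in simp)+
  qed
  finally show ?thesis .
qed

text \<open>The conjugate exponent turns \<open>x powr (p - 1)\<close> into \<open>x powr p\<close>;
  this is how the growth bound for \<open>Phi\<close> is matched with the modular of the
  gradient.\<close>

lemma powr_mult_le:
  fixes x y p :: real
  assumes "1 < p" "0 \<le> x" "0 \<le> y"
  shows "x powr (p - 1) * y \<le> x powr p + y powr p"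
  using mult_le_powr_conj[of p "x powr (p - 1)" y] assms by (simp add: powr_powr)

lemma integrable_avec_inner:
  fixes \<Omega> :: "(real^'n) set"
  assumes \<Omega>: "open \<Omega>"
    and p: "p \<in> borel_measurable (lebesgue_on \<Omega>)" "\<And>x. x \<in> \<Omega> \<Longrightarrow> 1 < p x" "\<And>x. x \<in> \<Omega> \<Longrightarrow> p x \<le> P"
    and Psi_pos: "\<And>x s. x \<in> \<Omega> \<Longrightarrow> 0 < s \<Longrightarrow> 0 < \<Psi> x s"
    and Psi_meas: "\<And>s. 0 < s \<Longrightarrow> (\<lambda>x. \<Psi> x s) \<in> borel_measurable (lebesgue_on \<Omega>)"
    and Psi_cont: "AE x in lebesgue_on \<Omega>. continuous_on {0<..} (\<Psi> x)"
    and a0: "a\<^sub>0 \<in> var_Lebesgue \<Omega> (conj_exponent p)" and b: "0 \<le> b"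
    and growth: "AE x in lebesgue_on \<Omega>. \<forall>s\<ge>0. Phi \<Psi> x s \<le> a\<^sub>0 x + b * \<bar>s\<bar> powr (p x - 1)"
    and G: "G \<in> borel_measurable (lebesgue_on \<Omega>)" "(\<lambda>x. norm (G x)) \<in> var_Lebesgue \<Omega> p"
    and H: "H \<in> borel_measurable (lebesgue_on \<Omega>)" "(\<lambda>x. norm (H x)) \<in> var_Lebesgue \<Omega> p"
  shows "integrable (lebesgue_on \<Omega>) (\<lambda>x. avec \<Psi> x (G x) \<bullet> H x)"
proof -
  note [measurable] = G(1) H(1)
  have p0: "0 \<le> p x" if "x \<in> \<Omega>" for x using p(2)[OF that] by simp
  obtain l where l: "l > 0" "integrable (lebesgue_on \<Omega>) (\<lambda>x. \<bar>a\<^sub>0 x / l\<bar> powr conj_exponent p x)"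
    using a0 by (auto simp: var_Lebesgue_def)
  note iG = var_Lebesgue_integrable_powr[OF G(2) p(1) p0 p(3)]
  note iH = var_Lebesgue_integrable_powr[OF H(2) p(1) p0 p(3)]
  \<comment> \<open>The majorant comes from the growth bound and Young's inequality. The term with
    \<open>a\<^sub>0\<close> keeps its Luxemburg scale \<open>l\<close>, for which the modular is
    known to be finite, while the gradient norms enter unscaled because \<open>p\<close> is bounded
    by \<open>P\<close>.\<close>
  have i: "integrable (lebesgue_on \<Omega>) (\<lambda>x. l * (\<bar>a\<^sub>0 x / l\<bar> powr conj_exponent p x + \<bar>norm (H x)\<bar> powr p x)
      + b * (\<bar>norm (G x)\<bar> powr p x + \<bar>norm (H x)\<bar> powr p x))"
    using l(2) iG iH by (intro Bochner_Integration.integrable_add integrable_mult_right)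
  have "\<Omega> \<in> sets lebesgue" using \<Omega> by auto
  then have [measurable]: "(\<lambda>x. if 0 < norm (G x) then \<Psi> x (norm (G x)) else 0) \<in> borel_measurable (lebesgue_on \<Omega>)"
    by (rule Caratheodory_measurable) (use Psi_meas Psi_cont in measurable)
  have avec: "avec \<Psi> x (G x) = (if 0 < norm (G x) then \<Psi> x (norm (G x)) else 0) *\<^sub>R G x" for x
    by (simp add: avec_def)
  show ?thesis
  proof (rule Bochner_Integration.integrable_bound[OF i])
    show "(\<lambda>x. avec \<Psi> x (G x) \<bullet> H x) \<in> borel_measurable (lebesgue_on \<Omega>)"
      unfolding avec by measurable
    show "AE x in lebesgue_on \<Omega>. norm (avec \<Psi> x (G x) \<bullet> H x) \<le>
      norm (l * (\<bar>a\<^sub>0 x / l\<bar> powr conj_exponent p x + \<bar>norm (H x)\<bar> powr p x)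
        + b * (\<bar>norm (G x)\<bar> powr p x + \<bar>norm (H x)\<bar> powr p x))"
      using growth AE_space
    proof eventually_elim
      case (elim x)
      then have x: "x \<in> \<Omega>" by simp
      have "norm (avec \<Psi> x (G x)) = Phi \<Psi> x (norm (G x))"
        using Psi_pos[OF x, of "norm (G x)"] by (auto simp: avec_def Phi_def abs_of_pos)
      also have "\<dots> \<le> \<bar>a\<^sub>0 x\<bar> + b * norm (G x) powr (p x - 1)"
        using elim(1)[rule_format, of "norm (G x)"] by simp
      finally have "norm (avec \<Psi> x (G x)) * norm (H x) \<le> (\<bar>a\<^sub>0 x\<bar> + b * norm (G x) powr (p x - 1)) * norm (H x)"
        by (rule mult_right_mono) simp
      also have "\<dots> = l * (\<bar>a\<^sub>0 x / l\<bar> * norm (H x)) + b * (norm (G x) powr (p x - 1) * norm (H x))"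
        using l(1) by (simp add: algebra_simps)
      also have "\<dots> \<le> l * (\<bar>a\<^sub>0 x / l\<bar> powr conj_exponent p x + norm (H x) powr p x)
          + b * (norm (G x) powr p x + norm (H x) powr p x)"
        unfolding conj_exponent_def using p(2)[OF x] l(1) b
        by (intro add_mono mult_left_mono mult_le_powr_conj powr_mult_le) auto
      finally have "norm (avec \<Psi> x (G x) \<bullet> H x) \<le> l * (\<bar>a\<^sub>0 x / l\<bar> powr conj_exponent p x + norm (H x) powr p x)
          + b * (norm (G x) powr p x + norm (H x) powr p x)"
        using Cauchy_Schwarz_ineq2[of "avec \<Psi> x (G x)" "H x"] by simp
      then show ?case using order_trans[OF _ abs_ge_self] by simp
    qed
  qed
qed

text \<open>The integral of a non-integrable function is 0 by convention, and
  \<open>weak_gradient\<close> is an arbitrary function where no weak gradient exists. Sobolev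
  membership and integrability are therefore part of the conclusion, so that the inequality compares
  genuine integrals.\<close>

theorem theorem4p1:
  fixes \<Omega> :: "(real^'n) set"
    and p :: "real^'n \<Rightarrow> real"
    and \<Psi> :: "real^'n \<Rightarrow> real \<Rightarrow> real"
    and a\<^sub>0 w\<^sub>1 w\<^sub>2 :: "real^'n \<Rightarrow> real"
    and b \<delta>\<^sub>0 \<delta>\<^sub>0' r :: real
  assumes dim: "CARD('n) \<ge> 2"
    and domain: "bounded_lipschitz_domain \<Omega>"
    and p_gt_1: "\<And>x. x \<in> closure \<Omega> \<Longrightarrow> 1 < p x"
    and p_regular:
      "log_Hoelder_on (closure \<Omega>) p \<and>
         exponent_min \<Omega> p \<ge> 2 * real CARD('n) / (real CARD('n) + 2) \<or>
       continuous_on (closure \<Omega>) p \<and>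
         exponent_min \<Omega> p > 2 * real CARD('n) / (real CARD('n) + 2)"
    and Psi_pos: "\<And>x s. x \<in> closure \<Omega> \<Longrightarrow> 0 < s \<Longrightarrow> 0 < \<Psi> x s"
    and Psi_measurable:
      "\<And>s. 0 < s \<Longrightarrow> (\<lambda>x. \<Psi> x s) \<in> borel_measurable (lebesgue_on (closure \<Omega>))"
    and Psi_ac: "AE x in lebesgue_on \<Omega>. locally_absolutely_continuous_pos (\<Psi> x)"
    and Psi_limit: "\<And>x. x \<in> \<Omega> \<Longrightarrow> ((\<lambda>s. \<Psi> x s * s) \<longlongrightarrow> 0) (at_right 0)"
    and Psi_strict_mono: "AE x in lebesgue_on \<Omega>. strict_mono_on {0<..} (\<lambda>s. \<Psi> x s * s)"
    and a0_Lp: "a\<^sub>0 \<in> var_Lebesgue \<Omega> (conj_exponent p)"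
    and a0_nonneg: "AE x in lebesgue_on \<Omega>. 0 \<le> a\<^sub>0 x"
    and b_nonneg: "0 \<le> b"
    and growth:
      "AE x in lebesgue_on \<Omega>. \<forall>s\<ge>0. Phi \<Psi> x s \<le> a\<^sub>0 x + b * \<bar>s\<bar> powr (p x - 1)"
    and delta_pos: "0 < \<delta>\<^sub>0"
    and delta'_nonneg: "0 \<le> \<delta>\<^sub>0'"
    and coercive:
      "\<And>v. v \<in> var_Sobolev \<Omega> p \<Longrightarrow>
         (\<integral>x. Apot \<Psi> x (weak_gradient \<Omega> v x) \<partial>lebesgue_on \<Omega>)
           \<ge> \<delta>\<^sub>0 * (\<integral>x. norm (weak_gradient \<Omega> v x) powr p x \<partial>lebesgue_on \<Omega>) - \<delta>\<^sub>0'"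
    and r_ge_1: "1 \<le> r"
    and Phi_quotient_mono:
      "AE x in lebesgue_on \<Omega>. mono_on {0<..} (\<lambda>s. Phi \<Psi> x s / s powr (r - 1))"
    and w1: "w\<^sub>1 \<in> var_Sobolev \<Omega> p" "AE x in lebesgue_on \<Omega>. 0 < w\<^sub>1 x"
    and w2: "w\<^sub>2 \<in> var_Sobolev \<Omega> p" "AE x in lebesgue_on \<Omega>. 0 < w\<^sub>2 x"
    and ratios: "(\<lambda>x. w\<^sub>2 x / w\<^sub>1 x) \<in> Linfty \<Omega>" "(\<lambda>x. w\<^sub>1 x / w\<^sub>2 x) \<in> Linfty \<Omega>"
  defines "v\<^sub>1 \<equiv> \<lambda>x. w\<^sub>1 x - w\<^sub>2 x powr r / w\<^sub>1 x powr (r - 1)"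
    and "v\<^sub>2 \<equiv> \<lambda>x. w\<^sub>1 x powr r / w\<^sub>2 x powr (r - 1) - w\<^sub>2 x"
  defines "F\<^sub>1 \<equiv> \<lambda>x. avec \<Psi> x (weak_gradient \<Omega> w\<^sub>1 x) \<bullet> weak_gradient \<Omega> v\<^sub>1 x"
    and "F\<^sub>2 \<equiv> \<lambda>x. avec \<Psi> x (weak_gradient \<Omega> w\<^sub>2 x) \<bullet> weak_gradient \<Omega> v\<^sub>2 x"
  shows "v\<^sub>1 \<in> var_Sobolev \<Omega> p \<and> v\<^sub>2 \<in> var_Sobolev \<Omega> p \<and>
         integrable (lebesgue_on \<Omega>) F\<^sub>1 \<and> integrable (lebesgue_on \<Omega>) F\<^sub>2 \<and>
         (\<integral>x. F\<^sub>1 x \<partial>lebesgue_on \<Omega>) \<ge> (\<integral>x. F\<^sub>2 x \<partial>lebesgue_on \<Omega>)"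
proof -
  have \<Omega>: "open \<Omega>" "bounded \<Omega>" using domain by (auto simp: bounded_lipschitz_domain_def)
  have \<Omega>s: "\<Omega> \<in> sets lebesgue" using \<Omega>(1) by auto
  have sub: "\<Omega> \<subseteq> closure \<Omega>" by (rule closure_subset)
  have p_cont: "continuous_on (closure \<Omega>) p"
    using p_regular log_Hoelder_imp_continuous_on by blast
  have p_meas: "p \<in> borel_measurable (lebesgue_on \<Omega>)"
    by (rule continuous_imp_measurable_on_sets_lebesgue[OF continuous_on_subset[OF p_cont sub] \<Omega>s])
  \<comment> \<open>Compactness bounds the exponent from above, which is what passes from finite
    Luxemburg norms to finite modulars.\<close>
  have "compact (p ` closure \<Omega>)"
    using p_cont \<Omega>(2) by (intro compact_continuous_image) auto
  then obtain P where "\<forall>y\<in>p ` closure \<Omega>. norm y \<le> P"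
    using compact_imp_bounded bounded_iff by blast
  then have p_le: "p x \<le> P" if "x \<in> \<Omega>" for x using that sub by force
  have p1: "1 < p x" if "x \<in> \<Omega>" for x using that sub p_gt_1 by blast
  have p1': "1 \<le> p x" and p0: "0 \<le> p x" if "x \<in> \<Omega>" for x using p1[OF that] by simp_all
  define D\<^sub>1 D\<^sub>2 where "D\<^sub>1 = weak_gradient \<Omega> w\<^sub>1" and "D\<^sub>2 = weak_gradient \<Omega> w\<^sub>2"
  define G\<^sub>1 where "G\<^sub>1 x = (1 + (r - 1) * (w\<^sub>2 x / w\<^sub>1 x) powr r) *\<^sub>R D\<^sub>1 x
      - (r * (w\<^sub>2 x / w\<^sub>1 x) powr (r - 1)) *\<^sub>R D\<^sub>2 x" for x
  define G\<^sub>2 where "G\<^sub>2 x = (1 + (r - 1) * (w\<^sub>1 x / w\<^sub>2 x) powr r) *\<^sub>R D\<^sub>2 x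
      - (r * (w\<^sub>1 x / w\<^sub>2 x) powr (r - 1)) *\<^sub>R D\<^sub>1 x" for x
  note q1 = picone_quotient_var_Sobolev[OF \<Omega> p_meas p1' w1 w2 ratios(1) r_ge_1,
      folded v\<^sub>1_def D\<^sub>1_def D\<^sub>2_def, folded G\<^sub>1_def]
  note q2 = picone_quotient_var_Sobolev[OF \<Omega> p_meas p1' w2 w1 ratios(2) r_ge_1,
      folded D\<^sub>1_def D\<^sub>2_def, folded G\<^sub>2_def]
  have v1: "has_weak_gradient \<Omega> v\<^sub>1 G\<^sub>1" "v\<^sub>1 \<in> var_Sobolev \<Omega> p"
    using q1 by (auto simp: var_Sobolev_def)
  \<comment> \<open>The second function is the negative of the quotient with the two roles
    exchanged, so its weak gradient is \<open>- G\<^sub>2\<close>.\<close>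
  have v2_eq: "v\<^sub>2 = (\<lambda>x. - (w\<^sub>2 x - w\<^sub>1 x powr r / w\<^sub>2 x powr (r - 1)))"
    by (simp add: v\<^sub>2_def)
  have v2: "has_weak_gradient \<Omega> v\<^sub>2 (\<lambda>x. - G\<^sub>2 x)"
    unfolding v2_eq by (rule has_weak_gradient_uminus[OF q2(2)])
  have "v\<^sub>2 \<in> var_Lebesgue \<Omega> p"
    unfolding v2_eq
    by (rule var_Lebesgue_dominated[OF q2(1) _ p_meas p0, of _ 1])
      (use q2(1) in \<open>auto simp: var_Lebesgue_def simp del: minus_diff_eq\<close>)
  then have v2': "v\<^sub>2 \<in> var_Sobolev \<Omega> p"
    using v2 q2(3) by (auto simp: var_Sobolev_def intro!: exI[of _ "\<lambda>x. - G\<^sub>2 x"])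
  have Psi_meas: "(\<lambda>x. \<Psi> x s) \<in> borel_measurable (lebesgue_on \<Omega>)" if "0 < s" for s
    using Psi_measurable[OF that] sub by (rule measurable_restrict_mono)
  have Psi_cont: "AE x in lebesgue_on \<Omega>. continuous_on {0<..} (\<Psi> x)"
    using Psi_ac by eventually_elim (rule locally_absolutely_continuous_pos_imp_continuous_on)
  have Psi_pos': "0 < \<Psi> x s" if "x \<in> \<Omega>" "0 < s" for x s
    using Psi_pos that sub by blast
  have int: "integrable (lebesgue_on \<Omega>) (\<lambda>x. avec \<Psi> x (weak_gradient \<Omega> w x) \<bullet> weak_gradient \<Omega> v x)"
    if "w \<in> var_Sobolev \<Omega> p" "v \<in> var_Sobolev \<Omega> p" for w v
    by (rule integrable_avec_inner[OF \<Omega>(1) p_meas p1 p_le Psi_pos' Psi_meas Psi_cont a0_Lp b_nonneg growth])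
      (use var_Sobolev_weak_gradient[OF that(1) \<Omega>(1) p_meas p0]
        var_Sobolev_weak_gradient[OF that(2) \<Omega>(1) p_meas p0]
        has_weak_gradient_measurable[OF _ \<Omega>(1)] in blast)+
  have F: "integrable (lebesgue_on \<Omega>) F\<^sub>1" "integrable (lebesgue_on \<Omega>) F\<^sub>2"
    unfolding F\<^sub>1_def F\<^sub>2_def using w1(1) w2(1) v1(2) v2' by (auto intro: int)
  have "(\<integral>x. F\<^sub>2 x \<partial>lebesgue_on \<Omega>) \<le> (\<integral>x. F\<^sub>1 x \<partial>lebesgue_on \<Omega>)"
  proof (rule integral_mono_AE[OF F(2,1)])
    show "AE x in lebesgue_on \<Omega>. F\<^sub>2 x \<le> F\<^sub>1 x"
      using weak_gradient_AE_eq(2)[OF v1(1) \<Omega>(1)] weak_gradient_AE_eq(2)[OF v2 \<Omega>(1)]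
        w1(2) w2(2) Phi_quotient_mono AE_space
    proof eventually_elim
      case (elim x)
      \<comment> \<open>Since the gradient of \<open>v\<^sub>2\<close> at \<open>x\<close> is
        \<open>- G\<^sub>2 x\<close>, this sum is exactly
        \<open>F\<^sub>1 x - F\<^sub>2 x\<close>.\<close>
      have "0 \<le> avec \<Psi> x (D\<^sub>1 x) \<bullet> G\<^sub>1 x + avec \<Psi> x (D\<^sub>2 x) \<bullet> G\<^sub>2 x"
        unfolding G\<^sub>1_def G\<^sub>2_def
        using elim Psi_pos' by (intro avec_picone_pointwise r_ge_1) auto
      then show ?case
        using elim(1,2) by (simp add: F\<^sub>1_def F\<^sub>2_def D\<^sub>1_def D\<^sub>2_def)
    qed
  qed
  then show ?thesis using v1(2) v2' F by blast
qed

end
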